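(* Let $n\ge2$, $m\ge1$ and let $F$ satisfy the structural assumptions listed in the context. Any solution $\mathbf{u}$ of $\Delta\mathbf{u}=f(|\mathbf{u}|)\frac{\mathbf{u}}{|\mathbf{u}|}\chi_{\{|\mathbf{u}|>0\}}$ in $B_1(0)\subset\mathbb{R}^n$ satisfies $$|\mathbf{u}(x)|\le C\,\mathrm{dist}^2(x,\Gamma_0(\mathbf{u}))\quad\text{and}\quad|\nabla\mathbf{u}(x)|\le C\,\mathrm{dist}(x,\Gamma_0(\mathbf{u}))\quad\text{for every }x\in B_{1/2}(0),$$ where the constant $C>0$ depends only on $n$, $c_0$, $C_0$ and $E(\mathbf{u},0,1):=\int_{B_1(0)}|\nabla\mathbf{u}|^2+F(|\mathbf{u}|)\,dx$.
   Context: Assumptions on $F$: $F\in C^{2,\alpha}([0,\infty))$ for some $\alpha\in(0,1)$, $F(0)=0$, and with $f:=\frac12F'$ there are constants $c_0,C_0>0$ with $c_0\le f(s)\le C_0$ and $0\le F''(s)\le C_0$ for all $s\ge0$. A solution is a function $\mathbf{u}\in W^{1,2}(B_1(0);\mathbb{R}^m)$ satisfying the system weakly; it is locally $C^{1,\alpha'}$ for all $\alpha'\in(0,1)$ and this representative is used. $\Gamma_0(\mathbf{u}):=B_1(0)\cap\partial\{|\mathbf{u}|>0\}\cap\{\nabla\mathbf{u}=0\}$, with the convention $\mathrm{dist}(x,\emptyset)=+\infty$. *)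

theory Defs
  imports "HOL-Analysis.Analysis"
begin

section \<open>Classical derivatives and Hoelder continuity\<close>

definition grad :: "(real^'n \<Rightarrow> real) \<Rightarrow> real^'n \<Rightarrow> real^'n" where
  "grad g x = (\<chi> j. frechet_derivative g (at x) (axis j 1))"

definition holder_on :: "real \<Rightarrow> 'a::metric_space set \<Rightarrow> ('a \<Rightarrow> 'b::metric_space) \<Rightarrow> bool" where
  "holder_on a S g \<longleftrightarrow> (\<exists>L. \<forall>x\<in>S. \<forall>y\<in>S. dist (g x) (g y) \<le> L * dist x y powr a)"

definition loc_C1_holder :: "real \<Rightarrow> (real^'n) set \<Rightarrow> (real^'n \<Rightarrow> real) \<Rightarrow> bool" where
  "loc_C1_holder a \<Omega> w \<longleftrightarrow> (\<forall>x\<in>\<Omega>. w differentiable (at x)) \<and>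
     (\<forall>K. compact K \<and> K \<subseteq> \<Omega> \<longrightarrow> holder_on a K (grad w))"


section \<open>The nonlinearity\<close>

text \<open>Derivative on the half-line \<open>[0,\<infinity>)\<close>, one-sided at \<open>0\<close>.\<close>

definition hderiv :: "(real \<Rightarrow> real) \<Rightarrow> real \<Rightarrow> real" where
  "hderiv F s = vector_derivative F (at s within {0..})"

text \<open>Under the structural assumptions \<open>F\<close> has at least linear growth, so the Hoelder condition in
  \<open>C\<^sup>2\<^sup>,\<^sup>\<alpha>([0,\<infinity>))\<close> cannot refer to a finite norm on the half-line; it is
  imposed on bounded subintervals \<open>[0,R]\<close>.\<close>

definition C2_holder :: "real \<Rightarrow> (real \<Rightarrow> real) \<Rightarrow> bool" where
  "C2_holder a F \<longleftrightarrow> F differentiable_on {0..} \<and> hderiv F differentiable_on {0..} \<and>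
     continuous_on {0..} (hderiv (hderiv F)) \<and>
     (\<forall>R>0. holder_on a {0..R} (hderiv (hderiv F)))"

definition f_of :: "(real \<Rightarrow> real) \<Rightarrow> real \<Rightarrow> real" where
  "f_of F s = 1/2 * hderiv F s"

definition structural :: "real \<Rightarrow> real \<Rightarrow> (real \<Rightarrow> real) \<Rightarrow> bool" where
  "structural c\<^sub>0 C\<^sub>0 F \<longleftrightarrow> (\<exists>\<alpha>. 0 < \<alpha> \<and> \<alpha> < 1 \<and> C2_holder \<alpha> F) \<and> F 0 = 0 \<and>
     (\<forall>s\<ge>0. c\<^sub>0 \<le> f_of F s \<and> f_of F s \<le> C\<^sub>0 \<and>
             0 \<le> hderiv (hderiv F) s \<and> hderiv (hderiv F) s \<le> C\<^sub>0)"


section \<open>Sobolev functions\<close>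

primrec Ck :: "nat \<Rightarrow> (real^'n \<Rightarrow> real) \<Rightarrow> bool" where
  "Ck 0 \<phi> \<longleftrightarrow> continuous_on UNIV \<phi>"
| "Ck (Suc k) \<phi> \<longleftrightarrow> (\<forall>x. \<phi> differentiable (at x)) \<and> (\<forall>j. Ck k (\<lambda>x. grad \<phi> x $ j))"

text \<open>\<open>C\<^sub>c\<^sup>\<infinity>(\<Omega>)\<close>, the functions being extended by zero to the whole space.\<close>

definition test_fun :: "(real^'n) set \<Rightarrow> (real^'n \<Rightarrow> real) \<Rightarrow> bool" where
  "test_fun \<Omega> \<phi> \<longleftrightarrow> (\<forall>k. Ck k \<phi>) \<and> compact (closure {x. \<phi> x \<noteq> 0}) \<and> closure {x. \<phi> x \<noteq> 0} \<subseteq> \<Omega>"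

definition L2_on :: "(real^'n) set \<Rightarrow> (real^'n \<Rightarrow> 'b::euclidean_space) \<Rightarrow> bool" where
  "L2_on \<Omega> w \<longleftrightarrow> w \<in> borel_measurable (lebesgue_on \<Omega>) \<and>
     integrable (lebesgue_on \<Omega>) (\<lambda>x. (norm (w x))\<^sup>2)"

definition has_weak_grad :: "(real^'n) set \<Rightarrow> (real^'n \<Rightarrow> real) \<Rightarrow> (real^'n \<Rightarrow> real^'n) \<Rightarrow> bool" where
  "has_weak_grad \<Omega> w G \<longleftrightarrow> L2_on \<Omega> G \<and>
     (\<forall>\<phi> j. test_fun \<Omega> \<phi> \<longrightarrow>
        (LINT x|lebesgue_on \<Omega>. w x * grad \<phi> x $ j) = - (LINT x|lebesgue_on \<Omega>. G x $ j * \<phi> x))"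

definition W12 :: "(real^'n) set \<Rightarrow> (real^'n \<Rightarrow> real) \<Rightarrow> bool" where
  "W12 \<Omega> w \<longleftrightarrow> L2_on \<Omega> w \<and> (\<exists>G. has_weak_grad \<Omega> w G)"

text \<open>The choice is unique up to null sets; below it occurs only under integrals over \<open>\<Omega>\<close>.\<close>

definition weak_grad :: "(real^'n) set \<Rightarrow> (real^'n \<Rightarrow> real) \<Rightarrow> real^'n \<Rightarrow> real^'n" where
  "weak_grad \<Omega> w = (SOME G. has_weak_grad \<Omega> w G)"


section \<open>Solutions, energy and the set \<open>\<Gamma>\<^sub>0\<close>\<close>

text \<open>The constant in the growth estimate must not depend on the dimension \<open>m\<close> of the target, so
  \<open>m\<close> has to be quantified inside formulas. A map \<open>u\<close> into \<open>\<real>\<^sup>m\<close> is therefore given by its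
  components \<open>\<lambda>x. u x i\<close> with \<open>i < m\<close>; components with \<open>i \<ge> m\<close> are ignored.\<close>

definition vnorm :: "nat \<Rightarrow> (real^'n \<Rightarrow> nat \<Rightarrow> real) \<Rightarrow> real^'n \<Rightarrow> real" where
  "vnorm m u x = L2_set (u x) {..<m}"

definition grad_norm :: "nat \<Rightarrow> (real^'n \<Rightarrow> nat \<Rightarrow> real) \<Rightarrow> real^'n \<Rightarrow> real" where
  "grad_norm m u x = L2_set (\<lambda>i. norm (grad (\<lambda>y. u y i) x)) {..<m}"

definition rhs :: "(real \<Rightarrow> real) \<Rightarrow> nat \<Rightarrow> (real^'n \<Rightarrow> nat \<Rightarrow> real) \<Rightarrow> real^'n \<Rightarrow> nat \<Rightarrow> real" where
  "rhs F m u x i = (if vnorm m u x > 0 then f_of F (vnorm m u x) * (u x i / vnorm m u x) else 0)"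

definition weak_solution :: "(real \<Rightarrow> real) \<Rightarrow> nat \<Rightarrow> (real^'n) set \<Rightarrow> (real^'n \<Rightarrow> nat \<Rightarrow> real) \<Rightarrow> bool" where
  "weak_solution F m \<Omega> u \<longleftrightarrow> (\<forall>i<m. W12 \<Omega> (\<lambda>x. u x i)) \<and>
     (\<forall>i<m. \<forall>\<phi>. test_fun \<Omega> \<phi> \<longrightarrow>
        - (LINT x|lebesgue_on \<Omega>. weak_grad \<Omega> (\<lambda>y. u y i) x \<bullet> grad \<phi> x)
          = (LINT x|lebesgue_on \<Omega>. rhs F m u x i * \<phi> x))"

text \<open>Weak solutions have a representative that is locally \<open>C\<^sup>1\<^sup>,\<^sup>a\<close> for every
  \<open>a \<in> (0,1)\<close>. The last conjunct says that \<open>u\<close> is this representative, so that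
  pointwise values of \<open>u\<close> and of its gradient are meaningful in \<open>B\<^sub>1(0)\<close>.\<close>

definition solution :: "(real \<Rightarrow> real) \<Rightarrow> nat \<Rightarrow> (real^'n \<Rightarrow> nat \<Rightarrow> real) \<Rightarrow> bool" where
  "solution F m u \<longleftrightarrow> weak_solution F m (ball 0 1) u \<and>
     (\<forall>a. 0 < a \<and> a < 1 \<longrightarrow> (\<forall>i<m. loc_C1_holder a (ball 0 1) (\<lambda>x. u x i)))"

definition energy ::
  "(real \<Rightarrow> real) \<Rightarrow> nat \<Rightarrow> (real^'n \<Rightarrow> nat \<Rightarrow> real) \<Rightarrow> real^'n \<Rightarrow> real \<Rightarrow> real" where
  "energy F m u x\<^sub>0 r = (LINT x|lebesgue_on (ball x\<^sub>0 r).
     (\<Sum>i<m. (norm (weak_grad (ball x\<^sub>0 r) (\<lambda>y. u y i) x))\<^sup>2) + F (vnorm m u x))"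

definition \<Gamma>\<^sub>0 :: "nat \<Rightarrow> (real^'n \<Rightarrow> nat \<Rightarrow> real) \<Rightarrow> (real^'n) set" where
  "\<Gamma>\<^sub>0 m u = ball 0 1 \<inter> frontier {x \<in> ball 0 1. vnorm m u x > 0} \<inter> {x \<in> ball 0 1. grad_norm m u x = 0}"

text \<open>Unlike \<^const>\<open>infdist\<close>, the distance to the empty set is \<open>\<infinity>\<close>.\<close>

definition edist_set :: "'a::metric_space \<Rightarrow> 'a set \<Rightarrow> ennreal" where
  "edist_set x S = (INF y\<in>S. ennreal (dist x y))"

end

theory Submission imports Defs "HOL-Computational_Algebra.Polynomial" begin

text \<open>Write \<open>\<Delta>u = g\<close> with \<open>\<bar>g\<bar> \<le> C\<^sub>0\<close> and \<open>g \<bullet> u \<ge> c\<^sub>0 \<bar>u\<bar>\<close>; nothing else about the equation is used.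
  Let \<open>\<eta>\<^sub>R\<close> and \<open>\<zeta>\<^sub>R\<close> be rescalings (of fixed mass) of radial bump functions with
  \<open>\<nabla>\<zeta> = - z \<eta>\<close>, so that the \<open>R\<close>-derivative of \<open>\<eta>\<^sub>R\<close> is \<open>R \<Delta>\<zeta>\<^sub>R\<close>. Hence the \<open>R\<close>-derivative of
  \<open>\<eta>\<^sub>R * u\<close> is \<open>R \<zeta>\<^sub>R * g\<close>, and integrating in \<open>R\<close> yields, near a point where \<open>u\<close> and \<open>\<nabla>u\<close> vanish,
  \<open>u(x) = p\<^sub>R(x) + O(R\<^sup>2)\<close> for \<open>\<bar>x\<bar> \<le> R\<close>, where \<open>p\<^sub>R\<close> is the quadratic form of the Hessian of
  \<open>\<eta>\<^sub>R * u\<close> at the point, suitably normalised. A priori the coefficients of \<open>p\<^sub>R\<close> may grow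
  logarithmically as \<open>R\<close> decreases. But the logarithmic derivative in \<open>R\<close> of their squared norm is, up to
  bounded terms, a positive weighted integral of \<open>g \<bullet> p\<^sub>R\<close>, i.e. of \<open>g \<bullet> u\<close>, and so is bounded
  below by a positive multiple of the norm minus a constant. Thus the norm increases with \<open>R\<close> whenever it
  is large, hence stays bounded as \<open>R\<close> tends to \<open>0\<close>, which is quadratic growth. The energy
  enters only through the bound of \<open>\<integral>\<bar>u\<bar>\<close> that follows from \<open>F(s) \<ge> 2 c\<^sub>0 s\<close>.\<close>

section \<open>A smooth bump function on the line\<close>

text \<open>The right-hand side jumps where u vanishes, and a merely bounded g allows a Hessian to
  diverge logarithmically: the scale derivative of the averaged Hessian pairs g with a bounded
  kernel divided by R, and 1/R is not integrable at 0. Nothing worse can happen: once the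
  second-order Taylor polynomial in h is removed, the scale derivative is of order |h|^3/R^2, and
  integrating it from a fixed scale R0 down to R leaves O(R^2). The sign needed for the remaining
  term comes from the radial form of the kernels. The Hessian of zeta is -eta times the identity
  plus 2 z z^T times a second derivative of the profile. Contracted with the averaged Hessian H it
  gives a nonnegative weight times the quadratic form of H, minus trace(H) eta; the trace is itself
  an average of g, hence harmless. Replacing the quadratic form by a multiple of u costs O(R^2),
  after which the coercivity of g against u applies. Norms in the target are obtained by testing
  with functionals of norm at most 1, and the only sums estimated crudely run over the n or n^2
  domain indices, so no constant sees m.\<close>

text \<open>The exponent \<open>-2/t\<close>, rather than \<open>-1/t\<close>, makes the bump function convex on all of \<open>(0,1]\<close>;
  its second derivative is the weight in the final positivity argument.\<close>

definition bump :: "real poly \<Rightarrow> real \<Rightarrow> real" where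
  "bump p t = (if t > 0 then poly p (1 / t) * exp (- 2 / t) else 0)"

text \<open>With X = 1/t one has d/dt = - X^2 d/dX, so the derivative of p(X) exp(-2X) is X^2 (2 p -
  p')(X) exp(-2X); \<open>[:0, 0, 1:]\<close> is X^2. The shape is preserved, so iterating on
  polynomials yields all derivatives.\<close>

definition bump_deriv_poly :: "real poly \<Rightarrow> real poly" where
  "bump_deriv_poly p = [:0, 0, 1:] * ([:2:] * p - pderiv p)"

lemma poly_exp_tendsto_0: "((\<lambda>x. poly p x * exp (- 2 * x)) \<longlongrightarrow> (0::real)) at_top"
proof -
  have pow: "((\<lambda>x. x ^ i * exp (- 2 * x)) \<longlongrightarrow> (0::real)) at_top" for i
  proof (rule tendsto_sandwich[where f = "\<lambda>_. 0" and h = "\<lambda>x. x ^ i / exp x"])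
    show "((\<lambda>x. x ^ i / exp x) \<longlongrightarrow> (0::real)) at_top" by (rule tendsto_power_div_exp_0)
    show "\<forall>\<^sub>F x in at_top. 0 \<le> x ^ i * exp (- 2 * x :: real)"
      using eventually_ge_at_top[of "0::real"] by eventually_elim auto
    show "\<forall>\<^sub>F x in at_top. x ^ i * exp (- 2 * x) \<le> x ^ i / exp (x::real)"
      using eventually_ge_at_top[of "0::real"]
    proof eventually_elim
      fix x :: real assume "x \<ge> 0"
      then have "exp (- 2 * x) \<le> exp (- x)" by simp
      then have "x ^ i * exp (- 2 * x) \<le> x ^ i * exp (- x)"
        using \<open>x \<ge> 0\<close> by (intro mult_left_mono) auto
      then show "x ^ i * exp (- 2 * x) \<le> x ^ i / exp x"
        by (simp add: exp_minus divide_inverse)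
    qed
  qed auto
  have "((\<lambda>x. \<Sum>i\<le>degree p. coeff p i * (x ^ i * exp (- 2 * x))) \<longlongrightarrow> (\<Sum>i\<le>degree p. coeff p i * 0)) at_top"
    by (intro tendsto_intros pow)
  then show ?thesis
    by (simp add: poly_altdef sum_distrib_right mult.assoc)
qed

lemma bump_has_deriv: "(bump p has_real_derivative bump (bump_deriv_poly p) t) (at t)"
proof (cases t "0::real" rule: linorder_cases)
  case less
  have "((\<lambda>_. 0) has_real_derivative bump (bump_deriv_poly p) t) (at t)"
    using less by (simp add: bump_def)
  moreover have "\<forall>\<^sub>F x in nhds t. bump p x = 0"
    using eventually_nhds_in_open[of "{..<0}" t] less by (auto elim!: eventually_mono simp: bump_def)
  ultimately show ?thesis by (subst DERIV_cong_ev[OF refl _ refl]) auto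
next
  case greater
  have "((\<lambda>t. poly p (1 / t) * exp (- 2 / t)) has_real_derivative bump (bump_deriv_poly p) t) (at t)"
  proof -
    have inv: "((\<lambda>t. c / t) has_real_derivative - (c / t^2)) (at t)" for c :: real
      using greater by (auto intro!: derivative_eq_intros simp: power2_eq_square)
    have "((\<lambda>t. poly p (1 / t)) has_real_derivative - (1 / t^2) * poly (pderiv p) (1 / t)) (at t)"
      using DERIV_chain2[OF poly_DERIV inv, of p 1] by (simp add: mult.commute)
    from DERIV_mult[OF this DERIV_chain2[OF DERIV_exp inv[of "-2"]]]
    show ?thesis
      using greater by (simp add: bump_def bump_deriv_poly_def algebra_simps power2_eq_square)
  qed
  moreover have "\<forall>\<^sub>F x in nhds t. bump p x = poly p (1 / x) * exp (- 2 / x)"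
    using eventually_nhds_in_open[of "{0<..}" t] greater by (auto elim!: eventually_mono simp: bump_def)
  ultimately show ?thesis by (subst DERIV_cong_ev[OF refl _ refl]) auto
next
  case equal
  \<comment> \<open>The difference quotient at 0 is \<open>bump p y / y\<close>; the division by y
    contributes the extra factor X = 1/y, which is the polynomial \<open>[:0,1:]\<close>.\<close>
  have lim: "((\<lambda>y. poly ([:0,1:] * p) (inverse y) * exp (- 2 * inverse y)) \<longlongrightarrow> 0) (at_right 0)"
    by (rule filterlim_compose[OF poly_exp_tendsto_0 filterlim_inverse_at_top_right])
  have "((\<lambda>y. bump p y / y) \<longlongrightarrow> 0) (at 0)"
    unfolding filterlim_at_split
  proof
    show "((\<lambda>y. bump p y / y) \<longlongrightarrow> 0) (at_left 0)"
      by (rule tendsto_eventually) (auto simp: eventually_at_left_field bump_def intro: exI[of _ "-1"])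
    show "((\<lambda>y. bump p y / y) \<longlongrightarrow> 0) (at_right 0)"
      by (rule Lim_transform_eventually[OF lim])
         (auto simp: eventually_at_right_field bump_def field_simps intro: exI[of _ 1])
  qed
  then show ?thesis
    unfolding equal has_field_derivative_iff by (simp add: bump_def)
qed

definition kb :: "nat \<Rightarrow> real \<Rightarrow> real" where
  "kb j = bump ((bump_deriv_poly ^^ j) 1)"

lemma kb_deriv: "(kb j has_real_derivative kb (Suc j) t) (at t)"
  using bump_has_deriv by (simp add: kb_def)

lemma kb_nonpos [simp]: "t \<le> 0 \<Longrightarrow> kb j t = 0"
  by (simp add: kb_def bump_def)

lemma kb_continuous: "continuous_on A (kb j)"
  by (rule continuous_at_imp_continuous_on) (auto intro: DERIV_isCont kb_deriv)

text \<open>The range t \<le> 1 is the one reached by 1 - |z|^2. To the left of 0 the function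
  vanishes, so compactness of [0,1] suffices.\<close>

lemma kb_bounded: "\<exists>B>0. \<forall>t\<le>1. \<bar>kb j t\<bar> \<le> B"
proof -
  have "bounded (kb j ` {0..1})"
    by (intro compact_imp_bounded compact_continuous_image kb_continuous compact_Icc)
  then obtain B where B: "B > 0" "\<forall>x\<in>kb j ` {0..1}. norm x \<le> B"
    unfolding bounded_pos by (elim exE conjE)
  then have "\<bar>kb j t\<bar> \<le> B" if "t \<le> 1" for t
  proof (cases "t \<le> 0")
    case True then show ?thesis using \<open>B > 0\<close> by simp
  next
    case False
    with that have "kb j t \<in> kb j ` {0..1}" by simp
    from B(2)[rule_format, OF this] show ?thesis by simp
  qed
  with \<open>B > 0\<close> show ?thesis by blast
qed

lemma kb1_eq: "t > 0 \<Longrightarrow> kb 1 t = 2 / t^2 * exp (- 2 / t)"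
proof -
  have "(bump_deriv_poly ^^ 1) 1 = [:0, 0, 2:]"
    by (simp add: bump_deriv_poly_def pderiv_1)
  then have "kb 1 = bump [:0, 0, 2:]"
    unfolding kb_def by (rule arg_cong)
  then show "t > 0 \<Longrightarrow> kb 1 t = 2 / t^2 * exp (- 2 / t)"
    by (simp add: bump_def power2_eq_square)
qed

lemma kb2_eq: "t > 0 \<Longrightarrow> kb 2 t = 4 * (1 - t) / t^4 * exp (- 2 / t)"
proof -
  have 1: "(bump_deriv_poly ^^ 2) 1 = [:0, 0, 0, -4, 4:]"
  proof -
    have a: "bump_deriv_poly 1 = [:0, 0, 2:]"
      by (simp add: bump_deriv_poly_def pderiv_1)
    have b: "bump_deriv_poly [:0, 0, 2:] = [:0, 0, 0, -4, 4:]"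
      by (simp add: bump_deriv_poly_def pderiv_pCons)
    show ?thesis
      unfolding numeral_2_eq_2 funpow.simps o_def id_def a b by (rule refl)
  qed
  have "poly [:0, 0, 0, -4, 4:] (1 / t) = 4 * (1 - t) / t^4" if "t > 0"
  proof -
    have "t^4 = t * t * t * t" by (simp add: power4_eq_xxxx)
    with that show ?thesis by (simp add: field_simps)
  qed
  moreover have "kb 2 = bump [:0, 0, 0, -4, 4:]"
    unfolding kb_def by (rule arg_cong[OF 1])
  ultimately show "t > 0 \<Longrightarrow> kb 2 t = 4 * (1 - t) / t^4 * exp (- 2 / t)"
    by (simp only: bump_def if_True)
qed

lemma kb1_pos: "0 < t \<Longrightarrow> 0 < kb 1 t"
  using kb1_eq[of t] by simp

lemma kb1_nonneg: "0 \<le> kb 1 t"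
  using kb1_pos[of t] by (cases "t \<le> 0") auto

text \<open>The factor 1 - t changes sign exactly at the largest value of 1 - |z|^2; with the
  exponent -1/t it would be 1 - 2t. This is the sign of the weight in
  \<open>qmoment\<close>.\<close>

lemma kb2_nonneg: "t \<le> 1 \<Longrightarrow> 0 \<le> kb 2 t"
  by (cases "t \<le> 0") (auto simp: kb2_eq)

lemma kb2_pos: "0 < t \<Longrightarrow> t < 1 \<Longrightarrow> 0 < kb 2 t"
  by (simp add: kb2_eq)


section \<open>Gradients and smooth functions\<close>

text \<open>A relational form of the gradient: gradients of composite expressions are assembled by
  introduction rules, and \<open>GD_grad\<close> then evaluates \<open>grad\<close> in one
  step.\<close>

definition GD :: "(real^'n \<Rightarrow> real) \<Rightarrow> (real^'n \<Rightarrow> real^'n) \<Rightarrow> bool" where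
  "GD f G \<longleftrightarrow> (\<forall>x. (f has_derivative (\<lambda>h. G x \<bullet> h)) (at x))"

lemma has_derivative_imp_grad:
  assumes "(f has_derivative (\<lambda>h. g \<bullet> h)) (at x)" shows "grad f x = g"
proof -
  have "frechet_derivative f (at x) = (\<lambda>h. g \<bullet> h)"
    using frechet_derivative_at[OF assms] by simp
  then show ?thesis by (simp add: grad_def vec_eq_iff inner_axis)
qed

lemma differentiable_imp_grad:
  assumes "f differentiable (at x)" shows "(f has_derivative (\<lambda>h. grad f x \<bullet> h)) (at x)"
proof -
  have d: "(f has_derivative frechet_derivative f (at x)) (at x)"
    using assms frechet_derivative_works by blast
  then have lin: "linear (frechet_derivative f (at x))"
    using has_derivative_linear by blast
  have "frechet_derivative f (at x) h = grad f x \<bullet> h" for h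
  proof -
    have "frechet_derivative f (at x) h = frechet_derivative f (at x) (\<Sum>j\<in>UNIV. h $ j *\<^sub>R axis j 1)"
      using basis_expansion[of h] by (simp add: scalar_mult_eq_scaleR)
    also have "\<dots> = (\<Sum>j\<in>UNIV. h $ j * frechet_derivative f (at x) (axis j 1))"
      using lin by (simp add: linear_sum linear_scale)
    also have "\<dots> = grad f x \<bullet> h"
      by (simp add: grad_def inner_vec_def mult.commute)
    finally show ?thesis .
  qed
  then show ?thesis using d by (metis (no_types, lifting) ext)
qed

lemma GD_grad: "GD f G \<Longrightarrow> grad f = G"
  unfolding GD_def using has_derivative_imp_grad by blast

lemma GD_differentiable: "GD f G \<Longrightarrow> f differentiable (at x)"
  unfolding GD_def differentiable_def by blast

lemma GD_const: "GD (\<lambda>_. c) (\<lambda>_. 0)"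
  by (simp add: GD_def)

lemma GD_nth: "GD (\<lambda>x. x $ i) (\<lambda>_. axis i 1)"
proof -
  have "(\<lambda>h. axis i 1 \<bullet> h) = (\<lambda>h::real^'a. h $ i)"
    by (simp add: inner_axis' fun_eq_iff)
  then show ?thesis
    unfolding GD_def by (auto intro!: bounded_linear_imp_has_derivative bounded_linear_vec_nth)
qed

lemma GD_add: "GD f F \<Longrightarrow> GD g G \<Longrightarrow> GD (\<lambda>x. f x + g x) (\<lambda>x. F x + G x)"
  unfolding GD_def by (auto intro!: derivative_eq_intros simp: inner_simps)

lemma GD_diff: "GD f F \<Longrightarrow> GD g G \<Longrightarrow> GD (\<lambda>x. f x - g x) (\<lambda>x. F x - G x)"
  unfolding GD_def by (auto intro!: derivative_eq_intros simp: inner_simps)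

lemma GD_mult: "GD f F \<Longrightarrow> GD g G \<Longrightarrow> GD (\<lambda>x. f x * g x) (\<lambda>x. g x *\<^sub>R F x + f x *\<^sub>R G x)"
  unfolding GD_def by (auto intro!: derivative_eq_intros simp: inner_simps algebra_simps)

lemma GD_cmult: "GD f F \<Longrightarrow> GD (\<lambda>x. c * f x) (\<lambda>x. c *\<^sub>R F x)"
  using GD_mult[OF GD_const] by force

lemma GD_affine:
  assumes "GD f F" shows "GD (\<lambda>y. f ((y - a) /\<^sub>R r)) (\<lambda>y. (1 / r) *\<^sub>R F ((y - a) /\<^sub>R r))"
  unfolding GD_def
proof
  fix x
  have "((\<lambda>y. (y - a) /\<^sub>R r) has_derivative (\<lambda>h. h /\<^sub>R r)) (at x)"
    by (auto intro!: derivative_eq_intros)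
  moreover have "(f has_derivative (\<lambda>h. F ((x - a) /\<^sub>R r) \<bullet> h)) (at ((x - a) /\<^sub>R r))"
    using assms by (simp add: GD_def)
  ultimately have "((\<lambda>y. f ((y - a) /\<^sub>R r)) has_derivative (\<lambda>h. F ((x - a) /\<^sub>R r) \<bullet> (h /\<^sub>R r))) (at x)"
    using has_derivative_compose by blast
  then show "((\<lambda>y. f ((y - a) /\<^sub>R r)) has_derivative (\<lambda>h. (1 / r) *\<^sub>R F ((x - a) /\<^sub>R r) \<bullet> h)) (at x)"
    by (simp add: divide_inverse mult.commute)
qed

text \<open>Composing with 1 - |z|^2 gives radial kernels that are smooth at the origin and vanish
  outside the unit ball. Differentiation only raises the index and multiplies by -2z, so all kernels
  below are polynomials times some \<open>kq j\<close>.\<close>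

definition kq :: "nat \<Rightarrow> real^'n \<Rightarrow> real" where
  "kq j z = kb j (1 - z \<bullet> z)"

lemma GD_kq: "GD (kq j) (\<lambda>z. (-2 * kq (Suc j) z) *\<^sub>R z)"
  unfolding GD_def
proof
  fix z :: "real^'n"
  have "((\<lambda>z. 1 - z \<bullet> z) has_derivative (\<lambda>h. -2 * (z \<bullet> h))) (at z)"
    by (auto intro!: derivative_eq_intros simp: inner_commute)
  moreover have "(kb j has_derivative (\<lambda>h. kb (Suc j) (1 - z \<bullet> z) * h)) (at (1 - z \<bullet> z))"
    using kb_deriv[of j] by (simp add: has_field_derivative_def)
  ultimately have "((\<lambda>z. kb j (1 - z \<bullet> z)) has_derivative (\<lambda>h. kb (Suc j) (1 - z \<bullet> z) * (-2 * (z \<bullet> h)))) (at z)"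
    by (rule has_derivative_compose)
  then show "(kq j has_derivative (\<lambda>h. (-2 * kq (Suc j) z) *\<^sub>R z \<bullet> h)) (at z)"
    unfolding kq_def[abs_def] by (simp add: mult_ac)
qed

lemma kq_out: "1 \<le> norm z \<Longrightarrow> kq j z = 0"
  by (simp add: kq_def dot_square_norm)

lemma kq_continuous: "continuous_on A (kq j)"
  unfolding kq_def by (intro continuous_on_compose2[OF kb_continuous[of UNIV]] continuous_intros) auto

lemma kq_bounded: "\<exists>B>0. \<forall>z::real^'n. \<bar>kq j z\<bar> \<le> B"
  using kb_bounded[of j] by (auto simp: kq_def)

text \<open>Lets the inductions on k run on an explicit gradient field instead of the abstract
  \<open>grad\<close>.\<close>

lemma Ck_Suc_GD: "GD f F \<Longrightarrow> Ck (Suc k) f \<longleftrightarrow> (\<forall>j. Ck k (\<lambda>x. F x $ j))"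
  using GD_grad[of f F] GD_differentiable[of f F] by auto

lemma Ck_SucD: "Ck (Suc k) f \<Longrightarrow> Ck k f"
proof (induction k arbitrary: f)
  case 0
  then show ?case by (auto intro!: continuous_at_imp_continuous_on differentiable_imp_continuous_within)
next
  case (Suc k)
  show ?case
    unfolding Ck.simps(2)[of k]
    using Suc.prems Suc.IH unfolding Ck.simps(2)[of "Suc k"] by blast
qed

lemma Ck_Suc_imp_GD: "Ck (Suc k) f \<Longrightarrow> GD f (grad f)"
  unfolding GD_def using differentiable_imp_grad by auto

lemma Ck_const: "Ck k (\<lambda>_. c)"
  by (induction k arbitrary: c) (auto simp: Ck_Suc_GD[OF GD_const] simp del: Ck.simps(2))

lemma Ck_nth: "Ck k (\<lambda>x. x $ i)"
  by (cases k) (auto simp: Ck_Suc_GD[OF GD_nth] Ck_const simp del: Ck.simps(2) intro!: continuous_intros)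

lemma Ck_add: "Ck k f \<Longrightarrow> Ck k g \<Longrightarrow> Ck k (\<lambda>x. f x + g x)"
proof (induction k arbitrary: f g)
  case (Suc k)
  show ?case
    unfolding Ck_Suc_GD[OF GD_add[OF Ck_Suc_imp_GD[OF Suc.prems(1)] Ck_Suc_imp_GD[OF Suc.prems(2)]]]
    using Suc by simp
qed (auto intro: continuous_intros)

lemma Ck_mult: "Ck k f \<Longrightarrow> Ck k g \<Longrightarrow> Ck k (\<lambda>x. f x * g x)"
proof (induction k arbitrary: f g)
  case (Suc k)
  show ?case
    unfolding Ck_Suc_GD[OF GD_mult[OF Ck_Suc_imp_GD[OF Suc.prems(1)] Ck_Suc_imp_GD[OF Suc.prems(2)]]]
    using Suc Ck_SucD[OF Suc.prems(1)] Ck_SucD[OF Suc.prems(2)] by (simp add: Ck_add)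
qed (auto intro: continuous_intros)

lemma Ck_diff: "Ck k f \<Longrightarrow> Ck k g \<Longrightarrow> Ck k (\<lambda>x. f x - g x)"
  using Ck_add[of k f "\<lambda>x. -1 * g x"] Ck_mult[OF Ck_const, of k g "-1"] by simp

lemma Ck_kq: "Ck k (kq j)"
proof (induction k arbitrary: j)
  case (Suc k)
  then show ?case
    using Ck_mult[OF Ck_mult[OF Ck_const[of k "-2"] Suc[of "Suc j"]] Ck_nth[of k]]
    by (simp add: Ck_Suc_GD[OF GD_kq] del: Ck.simps(2))
qed (simp add: kq_continuous)

lemma Ck_affine: "Ck k f \<Longrightarrow> Ck k (\<lambda>y. f ((y - a) /\<^sub>R r))"
proof (induction k arbitrary: f)
  case (Suc k)
  show ?case
    unfolding Ck_Suc_GD[OF GD_affine[OF Ck_Suc_imp_GD[OF Suc.prems]]]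
    using Ck_mult[OF Ck_const[of k "1 / r"] Suc.IH[of "\<lambda>x. grad f x $ j" for j]] Suc.prems by simp
next
  case 0
  then show ?case
    by (auto intro!: continuous_on_compose2[of UNIV f UNIV "\<lambda>y. (y - a) /\<^sub>R r"] continuous_intros)
qed

lemma Ck_grad: "Ck (Suc k) f \<Longrightarrow> Ck k (\<lambda>x. grad f x $ j)"
  by simp

section \<open>Kernels\<close>

definition Lap :: "(real^'n \<Rightarrow> real) \<Rightarrow> real^'n \<Rightarrow> real" where
  "Lap f x = (\<Sum>j\<in>UNIV. grad (\<lambda>y. grad f y $ j) x $ j)"

definition bumpfn :: "(real^'n \<Rightarrow> real) \<Rightarrow> bool" where
  "bumpfn f \<longleftrightarrow> (\<forall>k. Ck k f) \<and> (\<forall>z. 1 \<le> norm z \<longrightarrow> f z = 0)"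

lemma Lap_continuous: "Ck 2 f \<Longrightarrow> continuous_on UNIV (Lap f)"
  unfolding Lap_def[abs_def] by (auto simp: numeral_2_eq_2 intro!: continuous_on_sum)

lemma Lap_add:
  assumes "Ck 2 f" "Ck 2 g" shows "Lap (\<lambda>x. f x + g x) x = Lap f x + Lap g x"
proof -
  have f: "Ck (Suc (Suc 0)) f" "Ck (Suc (Suc 0)) g" using assms by (simp_all only: numeral_2_eq_2)
  have 1: "grad (\<lambda>x. f x + g x) = (\<lambda>x. grad f x + grad g x)"
    using f by (intro GD_grad GD_add Ck_Suc_imp_GD)
  have "grad (\<lambda>y. grad f y $ j + grad g y $ j) x = grad (\<lambda>y. grad f y $ j) x + grad (\<lambda>y. grad g y $ j) x" for j
    using GD_grad[OF GD_add[OF Ck_Suc_imp_GD[OF Ck_grad[OF f(1), of j]] Ck_Suc_imp_GD[OF Ck_grad[OF f(2), of j]]]]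
    by simp
  then show ?thesis by (simp add: Lap_def 1 sum.distrib)
qed

lemma GD_mult_kq:
  assumes "GD P G"
  shows "GD (\<lambda>z. P z * kq j z) (\<lambda>z. kq j z *\<^sub>R G z - (2 * P z * kq (Suc j) z) *\<^sub>R z)"
  using GD_mult[OF assms GD_kq[of j]] by (simp add: mult_ac)

text \<open>The product rule with the gradient of \<open>kq j\<close> equal to -2z
  \<open>kq (Suc j)\<close>; the cross term 2 grad P . grad K becomes - 4 (z . grad P)
  \<open>kq (Suc j)\<close>. In every use P is a polynomial of degree at most 2, so its Laplacian is
  a constant D.\<close>

lemma Lap_mult_kq:
  fixes P :: "real^'n \<Rightarrow> real"
  assumes P: "GD P G" and G: "\<And>l. GD (\<lambda>z. G z $ l) (G2 l)" and D: "\<And>z. (\<Sum>l\<in>UNIV. G2 l z $ l) = D"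
  shows "Lap (\<lambda>z. P z * kq j z) z = D * kq j z - 4 * kq (Suc j) z * (z \<bullet> G z)
     + P z * (4 * (z \<bullet> z) * kq (Suc (Suc j)) z - 2 * CARD('n) * kq (Suc j) z)"
proof -
  define k where "k i = kq (j + i) z" for i
  have 1: "grad (\<lambda>z. P z * kq j z) = (\<lambda>z. kq j z *\<^sub>R G z - (2 * P z * kq (Suc j) z) *\<^sub>R z)"
    by (rule GD_grad[OF GD_mult_kq[OF P]])
  have 2: "grad (\<lambda>z. kq j z * G z $ l - 2 * (P z * kq (Suc j) z) * z $ l) z $ l
     = k 0 * G2 l z $ l - 4 * k 1 * (z $ l * G z $ l) + P z * (4 * k 2 * (z $ l * z $ l) - 2 * k 1)" for l
  proof -
    have "GD (\<lambda>z. kq j z * G z $ l - 2 * (P z * kq (Suc j) z) * z $ l)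
      (\<lambda>z. (G z $ l *\<^sub>R ((-2 * kq (Suc j) z) *\<^sub>R z) + kq j z *\<^sub>R G2 l z) -
        (z $ l *\<^sub>R (2 *\<^sub>R (kq (Suc j) z *\<^sub>R G z - (2 * P z * kq (Suc (Suc j)) z) *\<^sub>R z))
         + (2 * (P z * kq (Suc j) z)) *\<^sub>R axis l 1))"
      by (intro GD_diff GD_mult GD_kq GD_mult_kq GD_cmult GD_nth P G)
    from GD_grad[OF this] show ?thesis
      by (simp add: k_def axis_def algebra_simps)
  qed
  have "Lap (\<lambda>z. P z * kq j z) z =
     (\<Sum>l\<in>UNIV. k 0 * G2 l z $ l - 4 * k 1 * (z $ l * G z $ l) + P z * (4 * k 2 * (z $ l * z $ l) - 2 * k 1))"
    unfolding Lap_def 1 using 2 by (simp add: mult.assoc)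
  also have "\<dots> = k 0 * (\<Sum>l\<in>UNIV. G2 l z $ l) - 4 * k 1 * (z \<bullet> G z)
     + P z * (4 * k 2 * (z \<bullet> z) - 2 * CARD('n) * k 1)"
    by (simp add: sum.distrib sum_subtractf sum_distrib_left[symmetric] inner_vec_def)
  finally show ?thesis by (simp add: D k_def algebra_simps)
qed

text \<open>\<open>zeta\<close> and \<open>eta\<close> are related by \<open>\<nabla>zeta = - z eta\<close>; the remaining kernels are the partial derivatives
  \<open>\<partial>\<^sub>i\<close> and \<open>\<partial>\<^sub>i\<partial>\<^sub>j\<close> of these two.\<close>

definition zeta :: "real^'n \<Rightarrow> real" where "zeta z = 1/2 * kq 0 z"
definition eta :: "real^'n \<Rightarrow> real" where "eta z = kq 1 z"
definition zeta1 :: "'n \<Rightarrow> real^'n \<Rightarrow> real" where "zeta1 i z = - z $ i * kq 1 z"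
definition eta1 :: "'n \<Rightarrow> real^'n \<Rightarrow> real" where "eta1 i z = - 2 * z $ i * kq 2 z"
definition zeta2 :: "'n \<Rightarrow> 'n \<Rightarrow> real^'n \<Rightarrow> real" where
  "zeta2 i j z = - of_bool (i = j) * kq 1 z + 2 * (z $ i * z $ j) * kq 2 z"
definition eta2 :: "'n \<Rightarrow> 'n \<Rightarrow> real^'n \<Rightarrow> real" where
  "eta2 i j z = - 2 * of_bool (i = j) * kq 2 z + 4 * (z $ i * z $ j) * kq 3 z"

lemma bumpfn_zeta: "bumpfn zeta" and bumpfn_eta: "bumpfn eta" and bumpfn_zeta1: "bumpfn (zeta1 i)"
  and bumpfn_eta1: "bumpfn (eta1 i)" and bumpfn_zeta2: "bumpfn (zeta2 i j)" and bumpfn_eta2: "bumpfn (eta2 i j)"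
proof -
  note C = Ck_mult Ck_add Ck_diff Ck_const Ck_nth Ck_kq
  have neg: "(\<lambda>z. - z $ i * kq 1 z) = (\<lambda>z. (-1 * z $ i) * kq 1 z)" by auto
  show "bumpfn zeta" "bumpfn eta" "bumpfn (zeta1 i)" "bumpfn (eta1 i)" "bumpfn (zeta2 i j)" "bumpfn (eta2 i j)"
    unfolding bumpfn_def zeta_def[abs_def] eta_def[abs_def] zeta1_def[abs_def] neg eta1_def[abs_def] zeta2_def[abs_def] eta2_def[abs_def]
    by (intro conjI allI impI C; simp add: kq_out)+
qed

text \<open>The divergence of grad zeta = - z eta. The bracket is n eta + z . grad eta, that is,
  minus the derivative at s = 1 of the rescaling s^(-n) eta(z/s): changing the scale of
  \<open>eta\<close> amounts to adding a Laplacian.\<close>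

lemma Lap_zeta: "Lap zeta z = - (CARD('n) * eta z - 2 * (z \<bullet> z) * kq 2 (z::real^'n))"
proof -
  have "Lap zeta z = 0 * kq 0 z - 4 * kq (Suc 0) z * (z \<bullet> 0)
     + 1 / 2 * (4 * (z \<bullet> z) * kq (Suc (Suc 0)) z - 2 * CARD('n) * kq (Suc 0) z)"
    unfolding zeta_def[abs_def] by (rule Lap_mult_kq[where ?G2.0="\<lambda>_ _. 0"]) (auto simp: GD_const)
  then show ?thesis by (simp add: eta_def numeral_2_eq_2)
qed

text \<open>Differentiating the previous identity once or twice adds 1 or 2 to the factor n in front
  of the eta kernel. These are the cases j = 1 and j = 2 of the hypothesis \<open>eq\<close> in
  \<open>conv_scale_deriv\<close>.\<close>

lemma Lap_zeta1: "Lap (zeta1 i) z = 2 * (CARD('n) + 2) * z $ i * kq 2 z - 4 * (z \<bullet> z) * (z $ i) * kq 3 (z::real^'n)"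
proof -
  have 1: "GD (\<lambda>z. - z $ i) (\<lambda>_. - axis i (1::real))"
    using GD_cmult[OF GD_nth[of i], of "-1"] by simp
  have "Lap (zeta1 i) z = 0 * kq 1 z - 4 * kq (Suc 1) z * (z \<bullet> - axis i 1)
     + - z $ i * (4 * (z \<bullet> z) * kq (Suc (Suc 1)) z - 2 * CARD('n) * kq (Suc 1) z)"
    unfolding zeta1_def[abs_def] by (rule Lap_mult_kq[where ?G2.0="\<lambda>_ _. 0"]) (auto intro: GD_const 1)
  then show ?thesis by (simp add: numeral_2_eq_2 numeral_3_eq_3 inner_axis algebra_simps)
qed

lemma Lap_zeta2: "Lap (zeta2 i j) z = 2 * (CARD('n) + 2) * of_bool (i = j) * kq 2 z
   - 4 * (of_bool (i = j) * (z \<bullet> z) + (CARD('n) + 4) * (z $ i * z $ j)) * kq 3 z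
   + 8 * (z \<bullet> z) * (z $ i * z $ j) * kq 4 (z::real^'n)"
proof -
  let ?d = "of_bool (i = j) :: real"
  have "Lap (\<lambda>z. - ?d * kq 1 z) z = 0 * kq 1 z - 4 * kq (Suc 1) z * (z \<bullet> 0)
     + - ?d * (4 * (z \<bullet> z) * kq (Suc (Suc 1)) z - 2 * CARD('n) * kq (Suc 1) z)"
    by (rule Lap_mult_kq[where ?G2.0="\<lambda>_ _. 0"]) (auto simp: GD_const)
  moreover have "Lap (\<lambda>z. 2 * (z $ i * z $ j) * kq 2 z) z = 4 * ?d * kq 2 z
     - 4 * kq (Suc 2) z * (z \<bullet> (2 *\<^sub>R (z $ j *\<^sub>R axis i 1 + z $ i *\<^sub>R axis j 1)))
     + 2 * (z $ i * z $ j) * (4 * (z \<bullet> z) * kq (Suc (Suc 2)) z - 2 * CARD('n) * kq (Suc 2) z)"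
  proof (rule Lap_mult_kq[where ?G2.0="\<lambda>l _. 2 *\<^sub>R (axis i 1 $ l *\<^sub>R axis j 1 + axis j 1 $ l *\<^sub>R axis i 1)"])
    show "GD (\<lambda>z. 2 * (z $ i * z $ j)) (\<lambda>z. 2 *\<^sub>R (z $ j *\<^sub>R axis i 1 + z $ i *\<^sub>R axis j 1))"
      by (intro GD_cmult GD_mult GD_nth)
    show "GD (\<lambda>z. (2 *\<^sub>R (z $ j *\<^sub>R axis i 1 + z $ i *\<^sub>R axis j 1)) $ l)
       (\<lambda>_. 2 *\<^sub>R (axis i 1 $ l *\<^sub>R axis j 1 + axis j 1 $ l *\<^sub>R axis i 1))" for l
      using GD_cmult[OF GD_add[OF GD_cmult[OF GD_nth[of j], of "axis i 1 $ l"] GD_cmult[OF GD_nth[of i], of "axis j 1 $ l"]], of 2]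
      by (simp add: mult.commute)
    show "(\<Sum>l\<in>UNIV. (2 *\<^sub>R (axis i (1::real) $ l *\<^sub>R axis j 1 + axis j 1 $ l *\<^sub>R axis i 1)) $ l) = 4 * ?d"
    proof -
      have "(\<Sum>l\<in>UNIV. axis i (1::real) $ l * axis j 1 $ l) = ?d"
        using inner_vec_def[of "axis i (1::real)" "axis j 1"] by (simp add: inner_axis_axis split: if_splits)
      then show ?thesis
        by (simp add: algebra_simps sum.distrib sum_distrib_left[symmetric])
    qed
  qed
  moreover have "Lap (zeta2 i j) z = Lap (\<lambda>z. - ?d * kq 1 z) z + Lap (\<lambda>z. 2 * (z $ i * z $ j) * kq 2 z) z"
    unfolding zeta2_def[abs_def] by (intro Lap_add Ck_mult Ck_const Ck_nth Ck_kq)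
  moreover have "Suc 1 = 2" "Suc (Suc 1) = 3" "Suc 2 = 3" "Suc (Suc 2) = 4" by simp_all
  ultimately show ?thesis
    by (simp only:) (simp add: inner_axis inner_add_right algebra_simps)
qed

lemma bumpfn_out: "bumpfn f \<Longrightarrow> 1 \<le> norm z \<Longrightarrow> f z = 0"
  by (simp add: bumpfn_def)

lemma bumpfn_continuous: "bumpfn f \<Longrightarrow> continuous_on A f"
  unfolding bumpfn_def using Ck.simps(1) continuous_on_subset by blast

lemma bumpfn_bounded: 
  assumes "bumpfn f" shows "\<exists>B>0. \<forall>z. \<bar>f z\<bar> \<le> B"
proof -
  have "bounded (f ` cball 0 1)"
    by (intro compact_imp_bounded compact_continuous_image bumpfn_continuous assms compact_cball)
  then obtain B where B: "B > 0" "\<forall>x\<in>f ` cball 0 1. norm x \<le> B"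
    unfolding bounded_pos by (elim exE conjE)
  have "\<bar>f z\<bar> \<le> B" for z
  proof (cases "norm z \<le> 1")
    case True
    then have "f z \<in> f ` cball 0 1" by simp
    from B(2)[rule_format, OF this] show ?thesis by simp
  qed (use B assms bumpfn_out[of f z] in auto)
  with B show ?thesis by blast
qed

section \<open>Integrals against rescaled kernels\<close>

text \<open>The correlation of f with the kernel s^(-n) K((y - x)/s), pulled back to the unit ball.
  It is not a convolution with K: moving the centre by s w replaces K(z) by K(z - w), so odd
  derivatives in the centre carry a minus sign.\<close>

definition conv :: "(real^'n \<Rightarrow> real) \<Rightarrow> (real^'n \<Rightarrow> real) \<Rightarrow> real^'n \<Rightarrow> real \<Rightarrow> real" where
  "conv f K x s = (LINT z|lborel. f (x + s *\<^sub>R z) * K z)"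

lemma lborel_integral_affine:
  fixes f :: "real^'n \<Rightarrow> real"
  assumes [measurable]: "f \<in> borel_measurable borel" and s: "s > 0"
  shows "(LINT z|lborel. f (x + s *\<^sub>R z)) = (LINT y|lborel. f y) / s ^ CARD('n)"
proof -
  have "(LINT y|lborel. f y) = (LINT y|density (distr lborel borel (\<lambda>z. x + s *\<^sub>R z)) (\<lambda>_. \<bar>s\<bar> ^ DIM(real^'n)). f y)"
    using lborel_affine[of s x] s by simp
  also have "\<dots> = s ^ CARD('n) * (LINT z|lborel. f (x + s *\<^sub>R z))"
    using s by (simp add: integral_density integral_distr)
  finally show ?thesis using s by (simp add: field_simps)
qed

lemma lborel_integrable_affine:
  fixes f :: "real^'n \<Rightarrow> real"
  assumes f: "integrable lborel f" and s: "s > 0"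
  shows "integrable lborel (\<lambda>z. f (x + s *\<^sub>R z))"
proof -
  have [measurable]: "f \<in> borel_measurable borel" using f by auto
  have "integrable (density (distr lborel borel (\<lambda>z. x + s *\<^sub>R z)) (\<lambda>_. \<bar>s\<bar> ^ DIM(real^'n))) f"
    using lborel_affine[of s x] s f by simp
  then have "integrable lborel (\<lambda>z. s ^ CARD('n) * f (x + s *\<^sub>R z))"
    using s by (simp add: integrable_density integrable_distr_eq)
  then show ?thesis using s by simp
qed

definition unit_vol :: "'n::finite itself \<Rightarrow> real" where
  "unit_vol _ = measure lborel (cball (0::real^'n) 1)"

lemma unit_vol_pos: "unit_vol TYPE('n::finite) > 0"
  unfolding unit_vol_def using content_cball_pos[of 1 "0::real^'n"] by simp

lemma measure_unit_cball: "measure lborel (cball (w::real^'n) 1) = unit_vol TYPE('n)"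
proof -
  have "indicat_real (cball w 1) (w + 1 *\<^sub>R z) = indicator (cball 0 1) z" for z
    by (simp add: indicator_def dist_norm)
  then show ?thesis
    using lborel_integral_affine[of "indicat_real (cball w 1)" 1 w]
    by (simp add: unit_vol_def borel_measurable_indicator)
qed

lemma integrable_cball [simp]: "integrable lborel (indicat_real (cball (w::real^'n) r))"
  by (intro integrable_real_indicator) (use emeasure_compact_finite[OF compact_cball] in auto)

lemma bounded_supp_integrable:
  fixes h :: "real^'n \<Rightarrow> real"
  assumes [measurable]: "h \<in> borel_measurable borel"
    and le: "\<And>z. \<bar>h z\<bar> \<le> B * indicator (cball 0 1) z"
  shows "integrable lborel h" "\<bar>LINT z|lborel. h z\<bar> \<le> B * unit_vol TYPE('n)"
proof -
  have int: "integrable lborel (\<lambda>z. B * indicator (cball (0::real^'n) 1) z)" by simp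
  show h: "integrable lborel h"
    by (rule Bochner_Integration.integrable_bound[OF int])
       (auto intro!: AE_I2 order_trans[OF le])
  have "\<bar>LINT z|lborel. h z\<bar> \<le> (LINT z|lborel. B * indicator (cball (0::real^'n) 1) z)"
    using Bochner_Integration.integral_norm_bound_integral[OF h int] le by simp
  then show "\<bar>LINT z|lborel. h z\<bar> \<le> B * unit_vol TYPE('n)"
    by (simp add: measure_unit_cball)
qed

text \<open>Differences between a kernel and its translate by w live on two unit balls, and the
  bound must not depend on w.\<close>

lemma two_balls_bound:
  fixes h :: "real^'n \<Rightarrow> real"
  assumes [measurable]: "h \<in> borel_measurable borel"
    and le: "\<And>z. \<bar>h z\<bar> \<le> B * (indicator (cball 0 1) z + indicator (cball w 1) z)"
  shows "integrable lborel h" "\<bar>LINT z|lborel. h z\<bar> \<le> 2 * B * unit_vol TYPE('n)"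
proof -
  have int: "integrable lborel (\<lambda>z. B * (indicator (cball (0::real^'n) 1) z + indicator (cball w 1) z))" by simp
  show h: "integrable lborel h"
    by (rule Bochner_Integration.integrable_bound[OF int])
       (auto intro!: AE_I2 order_trans[OF le])
  have "\<bar>LINT z|lborel. h z\<bar> \<le> (LINT z|lborel. B * (indicator (cball (0::real^'n) 1) z + indicator (cball w 1) z))"
    using Bochner_Integration.integral_norm_bound_integral[OF h int] le by simp
  then show "\<bar>LINT z|lborel. h z\<bar> \<le> 2 * B * unit_vol TYPE('n)"
    by (simp add: measure_unit_cball)
qed

lemma bumpfn_measurable: "bumpfn f \<Longrightarrow> f \<in> borel_measurable borel"
  by (rule borel_measurable_continuous_onI[OF bumpfn_continuous])

lemma conv_integrable:
  fixes f :: "real^'n \<Rightarrow> real"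
  assumes f[measurable]: "f \<in> borel_measurable borel" and K[measurable]: "K \<in> borel_measurable borel"
    and M: "\<And>y. y \<in> cball x s \<Longrightarrow> \<bar>f y\<bar> \<le> M" and B: "\<And>z. \<bar>K z\<bar> \<le> B"
    and out: "\<And>z. 1 \<le> norm z \<Longrightarrow> K z = 0" and s: "0 \<le> s"
  shows "integrable lborel (\<lambda>z. f (x + s *\<^sub>R z) * K z)" "\<bar>conv f K x s\<bar> \<le> M * B * unit_vol TYPE('n)"
proof -
  have M0: "0 \<le> M" using M[of x] s by (auto intro: order_trans[OF abs_ge_zero])
  have le: "\<bar>f (x + s *\<^sub>R z) * K z\<bar> \<le> M * B * indicator (cball 0 1) z" for z
  proof (cases "norm z \<le> 1")
    case True
    then have "x + s *\<^sub>R z \<in> cball x s" using s by (simp add: dist_norm mult_left_le)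
    with True show ?thesis using M B[of z] M0 by (simp add: abs_mult mult_mono)
  qed (simp add: out)
  show "integrable lborel (\<lambda>z. f (x + s *\<^sub>R z) * K z)" "\<bar>conv f K x s\<bar> \<le> M * B * unit_vol TYPE('n)"
    unfolding conv_def by (rule bounded_supp_integrable[OF _ le]; simp)+
qed

text \<open>Turns the average into an integral over a box that does not move with s, with a globally
  continuous U in place of f. This is the form to which differentiation under the integral
  applies.\<close>

lemma conv_eq_integral_cbox:
  fixes f U :: "real^'n \<Rightarrow> real"
  assumes f[measurable]: "f \<in> borel_measurable borel" and K: "continuous_on UNIV K"
    and out: "\<And>z. 1 \<le> norm z \<Longrightarrow> K z = 0" and s: "0 < s"
    and U: "continuous_on UNIV U" "\<And>y. y \<in> cball x s \<Longrightarrow> U y = f y" and box: "cball x s \<subseteq> cbox a b"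
  shows "conv f K x s = integral (cbox a b) (\<lambda>y. U y * K ((y - x) /\<^sub>R s)) / s ^ CARD('n)"
proof -
  have [measurable]: "K \<in> borel_measurable borel" by (rule borel_measurable_continuous_onI[OF K])
  define F where "F y = f y * K ((y - x) /\<^sub>R s)" for y
  have [measurable]: "F \<in> borel_measurable borel" unfolding F_def by measurable
  have "conv f K x s = (LINT z|lborel. F (x + s *\<^sub>R z))"
    using s by (simp add: conv_def F_def)
  also have "\<dots> = (LINT y|lborel. F y) / s ^ CARD('n)"
    by (rule lborel_integral_affine) (use s in auto)
  also have "(LINT y|lborel. F y) = (LINT y|lborel. indicator (cbox a b) y *\<^sub>R (U y * K ((y - x) /\<^sub>R s)))"
  proof (rule Bochner_Integration.integral_cong[OF refl])
    fix y show "F y = indicator (cbox a b) y *\<^sub>R (U y * K ((y - x) /\<^sub>R s))"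
    proof (cases "y \<in> cball x s")
      case True with box U(2) show ?thesis by (auto simp: F_def)
    next
      case False
      then have "s \<le> norm (y - x)" by (simp add: dist_norm norm_minus_commute)
      then have "1 \<le> norm ((y - x) /\<^sub>R s)" using s by (simp add: divide_simps del: scaleR_diff_right)
      from out[OF this] show ?thesis by (simp add: F_def)
    qed
  qed
  also have "\<dots> = integral (cbox a b) (\<lambda>y. U y * K ((y - x) /\<^sub>R s))"
  proof -
    have "set_integrable lborel (cbox a b) (\<lambda>y. U y * K ((y - x) /\<^sub>R s))"
      unfolding set_integrable_def
      by (intro borel_integrable_compact compact_cbox continuous_intros continuous_on_compose2[OF K]
          continuous_on_subset[OF U(1)]) auto
    from set_borel_integral_eq_integral(2)[OF this] show ?thesis
      by (simp add: set_lebesgue_integral_def)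
  qed
  finally show ?thesis .
qed

section \<open>The Poisson equation tested with rescaled kernels\<close>

text \<open>Encodes that the Laplacian of u is g in the unit ball, tested only with rescaled bumps;
  the factor s^2 compensates for the two derivatives falling on K((y - x)/s). Both functions live on
  the whole space so that \<open>conv\<close> can integrate over \<open>lborel\<close>.\<close>

definition poisson :: "(real^'n \<Rightarrow> real) \<Rightarrow> (real^'n \<Rightarrow> real) \<Rightarrow> real \<Rightarrow> bool" where
  "poisson u g G \<longleftrightarrow> u \<in> borel_measurable borel \<and> continuous_on (ball 0 1) u \<and>
     g \<in> borel_measurable borel \<and> (\<forall>x. \<bar>g x\<bar> \<le> G) \<and>
     (\<forall>x s K. 0 < s \<longrightarrow> cball x s \<subseteq> ball 0 1 \<longrightarrow> bumpfn K \<longrightarrow> conv u (Lap K) x s = s\<^sup>2 * conv g K x s)"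

text \<open>Differentiating a rescaled kernel in the scale produces the divergence of \<open>z \<Theta>(z)\<close>; when this
  is a Laplacian, the equation turns the scale derivative into an integral of the right-hand side.
  This replaces the fundamental solution.\<close>

lemma conv_scale_deriv:
  fixes u g \<Theta> :: "real^'n \<Rightarrow> real"
  assumes po: "poisson u g G" and K: "bumpfn K" and T: "GD \<Theta> T"
    and out: "\<And>z. 1 \<le> norm z \<Longrightarrow> \<Theta> z = 0" "\<And>z. 1 \<le> norm z \<Longrightarrow> Lap K z = 0"
    and eq: "\<And>z. (CARD('n) + j) * \<Theta> z + z \<bullet> T z = - Lap K z"
    and s: "0 < s" "cball x s \<subseteq> ball 0 1"
  shows "((\<lambda>s. conv u \<Theta> x s / s ^ j) has_real_derivative (s * conv g K x s / s ^ j)) (at s)"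
proof -
  define N where "N = CARD('n) + j"
  have u: "u \<in> borel_measurable borel" "continuous_on (ball 0 1) u" using po by (auto simp: poisson_def)
  have c\<Theta>: "continuous_on UNIV \<Theta>"
    using GD_differentiable[OF T] by (auto intro!: continuous_at_imp_continuous_on differentiable_imp_continuous_within)
  have cL: "continuous_on UNIV (Lap K)" using K by (intro Lap_continuous) (simp add: bumpfn_def)
  have ns: "norm x + s < 1" using s by (simp add: cball_subset_ball_iff)
  \<comment> \<open>The midpoint of s and 1 - |x|: an open interval of scales around s whose balls
    all stay in the unit ball.\<close>
  define R where "R = 1 - norm x - (1 - norm x - s) / 2"
  have R: "s < R" "norm x + R < 1" using ns by (auto simp: R_def field_simps)
  have sub: "cball x R \<subseteq> ball 0 1" using R by (simp add: cball_subset_ball_iff)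
  \<comment> \<open>Outside the ball u need not be continuous. The Tietze extension is invisible in
    the result because the kernel vanishes outside \<open>cball x t\<close> for every t < R.\<close>
  obtain U where U: "continuous_on UNIV U" "\<And>y. y \<in> cball x R \<Longrightarrow> U y = u y"
    using Tietze_unbounded[of "cball x R" u UNIV] continuous_on_subset[OF u(2) sub]
    by (metis closed_cball closed_closedin subtopology_UNIV)
  obtain a where "cball x R \<subseteq> cbox (- a) a"
    using bounded_subset_cbox_symmetric[OF bounded_cball] by blast
  then obtain a b where ab: "cball x R \<subseteq> cbox a b" by blast
  have rep: "conv u L x t = integral (cbox a b) (\<lambda>y. U y * L ((y - x) /\<^sub>R t)) / t ^ CARD('n)"
    if "continuous_on UNIV L" "\<And>z. 1 \<le> norm z \<Longrightarrow> L z = 0" "0 < t" "t < R" for L t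
    using that ab U by (intro conv_eq_integral_cbox u) auto
  \<comment> \<open>The exponent N = n + j collects the Jacobian t^n of the change of variables and
    the divisor t^j of the claim.\<close>
  define F where "F t y = U y * \<Theta> ((y - x) /\<^sub>R t) / t ^ N" for t y
  define F' where "F' t y = U y * Lap K ((y - x) /\<^sub>R t) / t ^ Suc N" for t y
  have "((\<lambda>t. integral (cbox a b) (F t)) has_field_derivative integral (cbox a b) (F' s)) (at s within {0<..<R})"
  proof (rule leibniz_rule_field_derivative)
    fix t y assume t: "t \<in> {0<..<R}"
    define z where "z = (y - x) /\<^sub>R t"
    have "((\<lambda>t. (y - x) /\<^sub>R t) has_derivative (\<lambda>h. - (h / t) *\<^sub>R z)) (at t)"
    proof -
      have "((\<lambda>t. inverse t) has_derivative (\<lambda>h. - (inverse t * h * inverse t))) (at t)"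
        using t has_derivative_inverse'[of t UNIV] by simp
      from has_derivative_scaleR_left[OF this, of "y - x"]
      have "((\<lambda>t. (y - x) /\<^sub>R t) has_derivative (\<lambda>h. - (inverse t * h * inverse t) *\<^sub>R (y - x))) (at t)" .
      moreover have "- (inverse t * h * inverse t) *\<^sub>R (y - x) = - (h / t) *\<^sub>R z" for h
        by (simp only: z_def scaleR_scaleR) (simp add: divide_inverse mult_ac)
      ultimately show ?thesis by simp
    qed
    moreover have "(\<Theta> has_derivative (\<lambda>h. T z \<bullet> h)) (at ((y - x) /\<^sub>R t))"
      using T by (simp add: GD_def z_def)
    ultimately have "((\<lambda>t. \<Theta> ((y - x) /\<^sub>R t)) has_derivative (\<lambda>h. T z \<bullet> (- (h / t) *\<^sub>R z))) (at t)"
      by (rule has_derivative_compose)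
    then have "((\<lambda>t. \<Theta> ((y - x) /\<^sub>R t)) has_real_derivative (- (z \<bullet> T z) / t)) (at t)"
      by (rule has_derivative_imp_has_field_derivative) (simp add: inner_commute mult.commute)
    then have "((\<lambda>t. U y * \<Theta> ((y - x) /\<^sub>R t) / t ^ N) has_real_derivative
       ((U y * (- (z \<bullet> T z) / t)) * t ^ N - (U y * \<Theta> z) * (real N * t ^ (N - 1))) / (t ^ N * t ^ N)) (at t)"
      using t by (auto intro!: derivative_eq_intros simp: z_def)
    also have "((U y * (- (z \<bullet> T z) / t)) * t ^ N - (U y * \<Theta> z) * (real N * t ^ (N - 1))) / (t ^ N * t ^ N)
       = F' t y"
    proof -
      have N: "t ^ N = t * t ^ (N - 1)"
        using power_minus_mult[of N t] by (simp add: N_def mult.commute)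
      have "F' t y = U y * (- (N * \<Theta> z + z \<bullet> T z)) / t ^ Suc N"
        using eq[of z] by (simp add: F'_def z_def N_def)
      also have "\<dots> = ((U y * (- (z \<bullet> T z) / t)) * t ^ N - (U y * \<Theta> z) * (real N * t ^ (N - 1))) / (t ^ N * t ^ N)"
        using t unfolding power_Suc N by (simp add: field_simps)
      finally show ?thesis by simp
    qed
    finally show "((\<lambda>t. F t y) has_real_derivative F' t y) (at t within {0<..<R})"
      unfolding F_def by (rule has_field_derivative_at_within)
  next
    fix t assume "t \<in> {0<..<R}"
    show "F t integrable_on cbox a b"
      unfolding F_def divide_inverse
      by (intro integrable_continuous continuous_intros continuous_on_compose2[OF c\<Theta>]
          continuous_on_subset[OF U(1)]) auto
  next
    show "continuous_on ({0<..<R} \<times> cbox a b) (\<lambda>(t, y). F' t y)"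
      unfolding F'_def split_beta
      by (intro continuous_intros continuous_on_compose2[OF cL] continuous_on_compose2[OF U(1)]) auto
  qed (use s R in auto)
  then have "((\<lambda>t. integral (cbox a b) (F t)) has_real_derivative integral (cbox a b) (F' s)) (at s)"
    using at_within_open[of s "{0<..<R}"] s(1) R(1) by simp
  also have "integral (cbox a b) (F' s) = s * conv g K x s / s ^ j"
  proof -
    have "integral (cbox a b) (F' s) = integral (cbox a b) (\<lambda>y. U y * Lap K ((y - x) /\<^sub>R s)) / s ^ Suc N"
      unfolding F'_def divide_inverse by simp
    also have "\<dots> = conv u (Lap K) x s / s ^ Suc j"
      using s R by (simp add: rep[OF cL out(2)] N_def power_add)
    also have "conv u (Lap K) x s = s\<^sup>2 * conv g K x s"
      using po s K by (simp add: poisson_def)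
    finally show ?thesis using s by (simp add: power2_eq_square)
  qed
  finally show ?thesis
  proof (rule has_field_derivative_transform_within_open[where S = "{0<..<R}"])
    fix t assume t: "t \<in> {0<..<R}"
    have "integral (cbox a b) (F t) = integral (cbox a b) (\<lambda>y. U y * \<Theta> ((y - x) /\<^sub>R t)) / t ^ N"
      unfolding F_def divide_inverse by simp
    then show "integral (cbox a b) (F t) = conv u \<Theta> x t / t ^ j"
      using t by (simp add: rep[OF c\<Theta> out(1)] N_def power_add)
  qed (use s R in auto)
qed

lemma deriv_eta:
  assumes "poisson u g G" "0 < s" "cball x s \<subseteq> ball 0 1"
  shows "((\<lambda>s. conv u eta x s) has_real_derivative s * conv g zeta x s) (at s)"
proof -
  have T: "GD eta (\<lambda>z. (-2 * kq 2 z) *\<^sub>R z)"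
    using GD_kq[of 1] by (simp add: eta_def[abs_def] numeral_2_eq_2)
  have out: "1 \<le> norm z \<Longrightarrow> Lap zeta z = 0" for z :: "real^'a"
    by (simp add: Lap_zeta eta_def kq_out)
  have "((\<lambda>s. conv u eta x s / s ^ 0) has_real_derivative s * conv g zeta x s / s ^ 0) (at s)"
    by (rule conv_scale_deriv[OF assms(1) bumpfn_zeta T bumpfn_out[OF bumpfn_eta] out _ assms(2,3)])
       (auto simp: Lap_zeta)
  then show ?thesis by simp
qed

lemma deriv_eta1:
  assumes "poisson u g G" "0 < s" "cball x s \<subseteq> ball 0 1"
  shows "((\<lambda>s. conv u (eta1 i) x s / s) has_real_derivative conv g (zeta1 i) x s) (at s)"
proof -
  have T: "GD (eta1 i) (\<lambda>z. kq 2 z *\<^sub>R (-2 *\<^sub>R axis i 1) - (2 * (-2 * z $ i) * kq (Suc 2) z) *\<^sub>R z)"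
    unfolding eta1_def[abs_def] by (intro GD_mult_kq GD_cmult GD_nth)
  have out: "1 \<le> norm z \<Longrightarrow> Lap (zeta1 i) z = 0" for z :: "real^'a"
    by (simp add: Lap_zeta1 kq_out)
  have "((\<lambda>s. conv u (eta1 i) x s / s ^ 1) has_real_derivative s * conv g (zeta1 i) x s / s ^ 1) (at s)"
    by (rule conv_scale_deriv[OF assms(1) bumpfn_zeta1 T bumpfn_out[OF bumpfn_eta1] out _ assms(2,3)])
       (auto simp: Lap_zeta1 eta1_def inner_diff_right inner_axis algebra_simps numeral_3_eq_3 numeral_2_eq_2)
  then show ?thesis using assms(2) by simp
qed

text \<open>For the average and the first moment the corresponding derivative is bounded near s = 0.
  Here a bounded quantity is divided by s, which is the source of the possible logarithm.\<close>

lemma deriv_eta2: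
  assumes "poisson u g G" "0 < s" "cball x s \<subseteq> ball 0 1"
  shows "((\<lambda>s. conv u (eta2 i j) x s / s\<^sup>2) has_real_derivative conv g (zeta2 i j) x s / s) (at s)"
proof -
  let ?d = "of_bool (i = j) :: real"
  define T where "T z = (kq 2 z *\<^sub>R 0 - (2 * (-2 * ?d) * kq (Suc 2) z) *\<^sub>R z)
     + (kq 3 z *\<^sub>R (4 *\<^sub>R (z $ j *\<^sub>R axis i 1 + z $ i *\<^sub>R axis j 1)) - (2 * (4 * (z $ i * z $ j)) * kq (Suc 3) z) *\<^sub>R z)"
    for z :: "real^'a"
  have T: "GD (eta2 i j) T"
    unfolding eta2_def[abs_def] T_def[abs_def] by (intro GD_add GD_mult_kq GD_const GD_cmult GD_mult GD_nth)
  have out: "1 \<le> norm z \<Longrightarrow> Lap (zeta2 i j) z = 0" for z :: "real^'a"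
    by (simp add: Lap_zeta2 kq_out)
  have eq: "(CARD('a) + 2) * eta2 i j z + z \<bullet> T z = - Lap (zeta2 i j) z" for z
  proof -
    have "Suc 2 = 3" "Suc 3 = 4" by simp_all
    then have "z \<bullet> T z = 4 * ?d * kq 3 z * (z \<bullet> z) + 8 * kq 3 z * (z $ i * z $ j) - 8 * (z $ i * z $ j) * kq 4 z * (z \<bullet> z)"
      unfolding T_def by (simp add: inner_add_right inner_diff_right inner_axis algebra_simps)
    then show ?thesis
      unfolding Lap_zeta2 eta2_def by (simp add: algebra_simps del: of_bool_eq_0_iff of_bool_eq_1_iff)
  qed
  have "((\<lambda>s. conv u (eta2 i j) x s / s ^ 2) has_real_derivative s * conv g (zeta2 i j) x s / s ^ 2) (at s)"
    by (rule conv_scale_deriv[OF assms(1) bumpfn_zeta2 T bumpfn_out[OF bumpfn_eta2] out _ assms(2,3)])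
       (use eq in auto)
  then show ?thesis using assms(2) by (simp add: power2_eq_square)
qed

section \<open>Comparing two scales by monotonicity\<close>

lemma deriv_bound_diff:
  fixes I I' B B' :: "real \<Rightarrow> real"
  assumes "r \<le> R" and I: "\<And>t. r \<le> t \<Longrightarrow> t \<le> R \<Longrightarrow> (I has_real_derivative I' t) (at t)"
    and B: "\<And>t. r \<le> t \<Longrightarrow> t \<le> R \<Longrightarrow> (B has_real_derivative B' t) (at t)"
    and le: "\<And>t. r \<le> t \<Longrightarrow> t \<le> R \<Longrightarrow> \<bar>I' t\<bar> \<le> B' t"
  shows "\<bar>I R - I r\<bar> \<le> B R - B r"
proof -
  have "B r - I r \<le> B R - I R"
  proof (rule DERIV_nonneg_imp_nondecreasing[OF assms(1)])
    fix t assume "r \<le> t" "t \<le> R"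
    then show "\<exists>y. ((\<lambda>t. B t - I t) has_real_derivative y) (at t) \<and> 0 \<le> y"
      using DERIV_diff[OF B I, of t] le[of t] by (intro exI[of _ "B' t - I' t"]) auto
  qed
  moreover have "B r + I r \<le> B R + I R"
  proof (rule DERIV_nonneg_imp_nondecreasing[OF assms(1)])
    fix t assume "r \<le> t" "t \<le> R"
    then show "\<exists>y. ((\<lambda>t. B t + I t) has_real_derivative y) (at t) \<and> 0 \<le> y"
      using DERIV_add[OF B I, of t] le[of t] by (intro exI[of _ "B' t + I' t"]) auto
  qed
  ultimately show ?thesis by linarith
qed

text \<open>The case where the majorant vanishes at scale 0: the quantity at scale R is compared
  with its limit, typically a value at the centre.\<close>

lemma deriv_bound_diff_0:
  fixes I I' B B' :: "real \<Rightarrow> real"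
  assumes R: "0 < R" and I: "\<And>t. 0 < t \<Longrightarrow> t \<le> R \<Longrightarrow> (I has_real_derivative I' t) (at t)"
    and B: "\<And>t. 0 < t \<Longrightarrow> t \<le> R \<Longrightarrow> (B has_real_derivative B' t) (at t)"
    and le: "\<And>t. 0 < t \<Longrightarrow> t \<le> R \<Longrightarrow> \<bar>I' t\<bar> \<le> B' t"
    and lim: "(I \<longlongrightarrow> L) (at_right 0)" "(B \<longlongrightarrow> 0) (at_right 0)"
  shows "\<bar>I R - L\<bar> \<le> B R"
proof -
  have "((\<lambda>r. \<bar>I R - I r\<bar>) \<longlongrightarrow> \<bar>I R - L\<bar>) (at_right 0)" "((\<lambda>r. B R - B r) \<longlongrightarrow> B R - 0) (at_right 0)"
    by (intro tendsto_intros lim)+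
  moreover have "\<forall>\<^sub>F r in at_right 0. \<bar>I R - I r\<bar> \<le> B R - B r"
    unfolding eventually_at_right_field
    by (intro exI[of _ R] conjI R allI impI deriv_bound_diff[where I' = I' and B' = B'] I B le) auto
  ultimately show ?thesis
    using tendsto_le[OF trivial_limit_at_right_real] by fastforce
qed

section \<open>Taylor expansion of the kernels under translation\<close>

lemma kq_line_deriv:
  "((\<lambda>t. kq j (z - t *\<^sub>R w)) has_real_derivative 2 * ((z - t *\<^sub>R w) \<bullet> w) * kq (Suc j) (z - t *\<^sub>R w)) (at t)"
proof -
  have "((\<lambda>t. z - t *\<^sub>R w) has_derivative (\<lambda>h. - h *\<^sub>R w)) (at t)"
    by (auto intro!: derivative_eq_intros)
  moreover have "(kq j has_derivative (\<lambda>h. (-2 * kq (Suc j) (z - t *\<^sub>R w)) *\<^sub>R (z - t *\<^sub>R w) \<bullet> h)) (at (z - t *\<^sub>R w))"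
    using GD_kq[of j] unfolding GD_def by blast
  ultimately have "((\<lambda>t. kq j (z - t *\<^sub>R w)) has_derivative
     (\<lambda>h. (-2 * kq (Suc j) (z - t *\<^sub>R w)) *\<^sub>R (z - t *\<^sub>R w) \<bullet> (- h *\<^sub>R w))) (at t)"
    by (rule has_derivative_compose)
  then show ?thesis
    by (rule has_derivative_imp_has_field_derivative) simp
qed

text \<open>The remainder of the second order Taylor expansion of \<open>kq j (z - w)\<close> in \<open>w\<close>.\<close>

definition kq_rem :: "nat \<Rightarrow> real^'n \<Rightarrow> real^'n \<Rightarrow> real" where
  "kq_rem j w z = kq j (z - w) - (kq j z + 2 * (z \<bullet> w) * kq (Suc j) z
     + (2 * (z \<bullet> w)\<^sup>2 * kq (Suc (Suc j)) z - (w \<bullet> w) * kq (Suc j) z))"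

text \<open>Taylor's formula with Lagrange remainder along the segment z - t w. Off the support the
  third derivative vanishes; on it |z - t w| < 1, so its inner product with w is at most |w|. Hence
  the cubic bound holds for large w as well. Cubic order is what makes the later integral over
  scales converge to O(R^2).\<close>

lemma kq_rem_bound:
  "\<exists>C>0. \<forall>w z::real^'n. \<bar>kq_rem j w z\<bar> \<le> C * norm w ^ 3 * (indicator (cball 0 1) z + indicator (cball w 1) z)"
proof -
  obtain B2 B3 where B: "B2 > 0" "B3 > 0" "\<And>z::real^'n. \<bar>kq (j+2) z\<bar> \<le> B2" "\<And>z::real^'n. \<bar>kq (j+3) z\<bar> \<le> B3"
    using kq_bounded[of "j+2"] kq_bounded[of "j+3"] by metis
  define C where "C = 12 * B2 + 8 * B3"
  have C: "C > 0" using B by (simp add: C_def)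
  have "\<bar>kq_rem j w z\<bar> \<le> C * norm w ^ 3 * (indicator (cball 0 1) z + indicator (cball w 1) z)" for w z :: "real^'n"
  proof (cases "z \<in> cball 0 1 \<or> z \<in> cball w 1")
    case False
    then have "1 \<le> norm z" "1 \<le> norm (z - w)" by (auto simp: dist_norm norm_minus_commute)
    then show ?thesis using C by (simp add: kq_rem_def kq_out)
  next
    case True
    then have one: "1 \<le> indicat_real (cball 0 1) z + indicator (cball w 1) z" by (auto simp: indicator_def)
    define p where "p t = (z - t *\<^sub>R w) \<bullet> w" for t
    define k where "k i t = kq (j + i) (z - t *\<^sub>R w)" for i t
    have dp: "(p has_real_derivative - (w \<bullet> w)) (at t)" for t
      unfolding p_def[abs_def] by (auto intro!: derivative_eq_intros simp: inner_diff_left)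
    have dk: "(k i has_real_derivative 2 * p t * k (Suc i) t) (at t)" for i t
      using kq_line_deriv[of "j+i" z w t] by (simp add: k_def[abs_def] p_def)
    \<comment> \<open>The derivatives in t of orders 0 to 3, computed from p' = - |w|^2 and k_i' = 2
      p k_(i+1); the order 3 formula also yields the constants 8 and 12 in C.\<close>
    define D where "D m = (if m = 0 then k 0 else if m = 1 then (\<lambda>t. 2 * p t * k 1 t)
       else if m = 2 then (\<lambda>t. 4 * (p t)\<^sup>2 * k 2 t - 2 * (w \<bullet> w) * k 1 t)
       else (\<lambda>t. 8 * p t ^ 3 * k 3 t - 12 * (w \<bullet> w) * p t * k 2 t))" for m :: nat
    have D: "(D m has_real_derivative D (Suc m) t) (at t)" if m: "m < 3" for m t
    proof -
      consider "m = 0" | "m = 1" | "m = 2" using m by linarith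
      then show ?thesis
      proof cases
        case 1 then show ?thesis using dk[of 0 t] by (simp add: D_def)
      next
        case 2
        have "((\<lambda>t. 2 * p t * k 1 t) has_real_derivative (2 * p t) * (2 * p t * k (Suc 1) t) + (2 * - (w \<bullet> w)) * k 1 t) (at t)"
          by (rule DERIV_mult'[OF DERIV_cmult[OF dp] dk])
        moreover have "(2 * p t) * (2 * p t * k (Suc 1) t) + (2 * - (w \<bullet> w)) * k 1 t = D (Suc m) t"
          using 2 by (simp add: D_def power2_eq_square numeral_2_eq_2)
        ultimately show ?thesis using 2 by (simp add: D_def mult.assoc)
      next
        case 3
        have "((\<lambda>t. 4 * (p t)\<^sup>2 * k 2 t - 2 * (w \<bullet> w) * k 1 t) has_real_derivative
           ((4 * (p t)\<^sup>2) * (2 * p t * k (Suc 2) t) + (4 * (2 * (- (w \<bullet> w) * p t ^ (2 - Suc 0)))) * k 2 t)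
             - (2 * (w \<bullet> w)) * (2 * p t * k (Suc 1) t)) (at t)"
          by (rule DERIV_diff[OF DERIV_mult'[OF DERIV_cmult[OF _] dk] DERIV_cmult[OF dk]])
             (use DERIV_power[OF dp[of t], of 2] in simp)
        also have "((4 * (p t)\<^sup>2) * (2 * p t * k (Suc 2) t) + (4 * (2 * (- (w \<bullet> w) * p t ^ (2 - Suc 0)))) * k 2 t)
             - (2 * (w \<bullet> w)) * (2 * p t * k (Suc 1) t) = 8 * p t ^ 3 * k 3 t - 12 * (w \<bullet> w) * p t * k 2 t"
        proof -
          have "Suc 2 = 3" "Suc 1 = 2" "2 - Suc 0 = 1" by simp_all
          then show ?thesis
            by (simp only:) (simp add: power2_eq_square power3_eq_cube algebra_simps)
        qed
        finally show ?thesis using 3 by (simp add: D_def)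
      qed
    qed
    have "\<exists>t>0. t < 1 \<and> k 0 1 = (\<Sum>m<3. D m 0 / fact m * 1 ^ m) + D 3 t / fact 3 * 1 ^ 3"
      by (rule Maclaurin) (use D in \<open>auto simp: D_def\<close>)
    then obtain t where "0 < t" "t < 1" and t: "k 0 1 = (\<Sum>m<3. D m 0 / fact m) + D 3 t / 6"
      by (auto simp: fact_numeral)
    have "(\<Sum>m<3. D m 0 / fact m) = D 0 0 + D 1 0 + D 2 0 / 2"
      by (simp add: numeral_3_eq_3 numeral_2_eq_2)
    then have rem: "kq_rem j w z = D 3 t / 6"
      using t by (simp add: D_def k_def p_def kq_rem_def field_simps)
    have "\<bar>D 3 t\<bar> \<le> C * norm w ^ 3"
    proof (cases "1 \<le> norm (z - t *\<^sub>R w)")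
      case True
      then show ?thesis using C by (simp add: D_def k_def kq_out)
    next
      case False
      have "\<bar>p t\<bar> \<le> norm (z - t *\<^sub>R w) * norm w" unfolding p_def by (rule Cauchy_Schwarz_ineq2)
      also have "\<dots> \<le> 1 * norm w" using False by (intro mult_right_mono) auto
      finally have p: "\<bar>p t\<bar> \<le> norm w" by simp
      have "\<bar>D 3 t\<bar> \<le> \<bar>8 * p t ^ 3 * k 3 t\<bar> + \<bar>12 * (w \<bullet> w) * p t * k 2 t\<bar>"
        by (simp add: D_def)
      also have "\<dots> = 8 * \<bar>p t\<bar> ^ 3 * \<bar>k 3 t\<bar> + 12 * (norm w)\<^sup>2 * \<bar>p t\<bar> * \<bar>k 2 t\<bar>"
        by (simp add: abs_mult power_abs power2_norm_eq_inner)
      also have "\<dots> \<le> 8 * norm w ^ 3 * B3 + 12 * (norm w)\<^sup>2 * norm w * B2"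
        using p B(3,4) B(1,2) by (intro add_mono mult_mono power_mono) (auto simp: k_def)
      also have "\<dots> = C * norm w ^ 3"
        by (simp add: C_def power2_eq_square power3_eq_cube algebra_simps)
      finally show ?thesis .
    qed
    then have "\<bar>kq_rem j w z\<bar> \<le> C * norm w ^ 3 * 1"
      using C by (simp add: rem)
    also have "\<dots> \<le> C * norm w ^ 3 * (indicat_real (cball 0 1) z + indicator (cball w 1) z)"
      using C one by (intro mult_left_mono) auto
    finally show ?thesis .
  qed
  with C show ?thesis by blast
qed

lemma kq_lipschitz_bound:
  "\<exists>C>0. \<forall>w z::real^'n. \<bar>kq j (z - w) - kq j z\<bar> \<le> C * norm w * (indicator (cball 0 1) z + indicator (cball w 1) z)"
proof -
  obtain B where B: "B > 0" "\<And>z::real^'n. \<bar>kq (Suc j) z\<bar> \<le> B"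
    using kq_bounded[of "Suc j"] by metis
  have "\<bar>kq j (z - w) - kq j z\<bar> \<le> 2 * B * norm w * (indicator (cball 0 1) z + indicator (cball w 1) z)" for w z :: "real^'n"
  proof (cases "z \<in> cball 0 1 \<or> z \<in> cball w 1")
    case False
    then have "1 \<le> norm z" "1 \<le> norm (z - w)" by (auto simp: dist_norm norm_minus_commute)
    then show ?thesis using B by (simp add: kq_out)
  next
    case True
    then have one: "1 \<le> indicat_real (cball 0 1) z + indicator (cball w 1) z" by (auto simp: indicator_def)
    obtain t where t: "kq j (z - 1 *\<^sub>R w) - kq j (z - 0 *\<^sub>R w)
        = (1 - 0) * (2 * ((z - t *\<^sub>R w) \<bullet> w) * kq (Suc j) (z - t *\<^sub>R w))"
      using MVT2[of 0 1 "\<lambda>t. kq j (z - t *\<^sub>R w)", OF _ kq_line_deriv] by auto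
    have "\<bar>((z - t *\<^sub>R w) \<bullet> w) * kq (Suc j) (z - t *\<^sub>R w)\<bar> \<le> norm w * B"
    proof (cases "1 \<le> norm (z - t *\<^sub>R w)")
      case True
      then show ?thesis using B by (simp add: kq_out)
    next
      case False
      have "\<bar>(z - t *\<^sub>R w) \<bullet> w\<bar> \<le> norm (z - t *\<^sub>R w) * norm w" by (rule Cauchy_Schwarz_ineq2)
      also have "\<dots> \<le> 1 * norm w" using False by (intro mult_right_mono) auto
      finally show ?thesis using B by (simp add: abs_mult mult_mono)
    qed
    then have "\<bar>kq j (z - w) - kq j z\<bar> \<le> 2 * B * norm w * 1"
      using t by (simp add: abs_mult mult.commute mult.left_commute)
    also have "\<dots> \<le> 2 * B * norm w * (indicat_real (cball 0 1) z + indicator (cball w 1) z)"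
      using B one by (intro mult_left_mono) auto
    finally show ?thesis .
  qed
  with B show ?thesis by (intro exI[of _ "2 * B"]) auto
qed

lemma integral_pos_of_continuous:
  fixes h :: "real^'n \<Rightarrow> real"
  assumes int: "integrable lborel h" and cont: "continuous_on UNIV h" and nonneg: "\<And>z. 0 \<le> h z" and pos: "0 < h a"
  shows "0 < (LINT z|lborel. h z)"
proof -
  have "isCont h a" using cont by (simp add: continuous_on_eq_continuous_at)
  then obtain r where r: "r > 0" "\<And>z. dist z a < r \<Longrightarrow> dist (h z) (h a) < h a / 2"
    using pos unfolding continuous_at_eps_delta by (metis half_gt_zero)
  have le: "h a / 2 * indicator (ball a r) z \<le> h z" for z
  proof (cases "z \<in> ball a r")
    case True
    then have "dist (h z) (h a) < h a / 2" by (intro r) (simp add: dist_commute)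
    with True show ?thesis by (simp add: dist_real_def abs_if split: if_splits)
  qed (use nonneg in auto)
  have "integrable lborel (indicat_real (ball a r))"
    by (intro integrable_real_indicator) (use emeasure_bounded_finite[OF bounded_ball] in auto)
  then have "(LINT z|lborel. h a / 2 * indicator (ball a r) z) \<le> (LINT z|lborel. h z)"
    by (intro Bochner_Integration.integral_mono int le) auto
  moreover have "0 < h a / 2 * measure lborel (ball a r)"
    using pos content_ball_pos[OF r(1), of a] by simp
  ultimately show ?thesis by simp
qed

section \<open>Averages at a given scale and interior bounds\<close>

definition mass :: "'n::finite itself \<Rightarrow> real" where
  "mass _ = (LINT z|lborel. eta (z::real^'n))"

lemma bumpfn_abs_le:
  fixes K :: "real^'n \<Rightarrow> real"
  assumes "bumpfn K" "\<And>z. \<bar>K z\<bar> \<le> B" shows "\<bar>K z\<bar> \<le> B * indicator (cball 0 1) z"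
  using assms(2)[of z] bumpfn_out[OF assms(1), of z] by (cases "norm z \<le> 1") auto

lemma bumpfn_integrable:
  fixes K :: "real^'n \<Rightarrow> real"
  assumes K: "bumpfn K" shows "integrable lborel K"
proof -
  obtain B where "\<And>z. \<bar>K z\<bar> \<le> B" using bumpfn_bounded[OF K] by blast
  from bounded_supp_integrable(1)[OF bumpfn_measurable[OF K] bumpfn_abs_le[OF K this]] show ?thesis .
qed

lemma mass_pos: "0 < mass TYPE('n::finite)"
  unfolding mass_def
proof (rule integral_pos_of_continuous[where a = 0])
  show "integrable lborel (eta :: real^'n \<Rightarrow> real)" by (rule bumpfn_integrable[OF bumpfn_eta])
  show "continuous_on UNIV (eta :: real^'n \<Rightarrow> real)" by (rule bumpfn_continuous[OF bumpfn_eta])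
  show "0 \<le> eta z" for z :: "real^'n" unfolding eta_def kq_def by (rule kb1_nonneg)
  show "0 < eta (0 :: real^'n)" unfolding eta_def kq_def by (rule kb1_pos) simp
qed

lemma conv_bump:
  fixes f K :: "real^'n \<Rightarrow> real"
  assumes f: "f \<in> borel_measurable borel" and K: "bumpfn K" and M: "\<And>y. y \<in> cball x s \<Longrightarrow> \<bar>f y\<bar> \<le> M" and s: "0 \<le> s"
  shows "has_bochner_integral lborel (\<lambda>z. f (x + s *\<^sub>R z) * K z) (conv f K x s)"
    and "(\<And>z. \<bar>K z\<bar> \<le> B) \<Longrightarrow> \<bar>conv f K x s\<bar> \<le> M * B * unit_vol TYPE('n)"
proof -
  obtain B0 where "\<And>z. \<bar>K z\<bar> \<le> B0" using bumpfn_bounded[OF K] by blast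
  from conv_integrable(1)[OF f bumpfn_measurable[OF K] M this bumpfn_out[OF K] s]
  show "has_bochner_integral lborel (\<lambda>z. f (x + s *\<^sub>R z) * K z) (conv f K x s)"
    unfolding conv_def by (rule has_bochner_integral_integrable)
  show "\<bar>conv f K x s\<bar> \<le> M * B * unit_vol TYPE('n)" if "\<And>z. \<bar>K z\<bar> \<le> B"
    by (rule conv_integrable(2)[OF f bumpfn_measurable[OF K] M that bumpfn_out[OF K] s])
qed

lemma conv_bump_shift:
  fixes f K :: "real^'n \<Rightarrow> real"
  assumes f[measurable]: "f \<in> borel_measurable borel" and K: "bumpfn K"
    and M: "\<And>y. y \<in> cball (x + s *\<^sub>R w) s \<Longrightarrow> \<bar>f y\<bar> \<le> M" and s: "0 \<le> s"
  shows "has_bochner_integral lborel (\<lambda>z. f (x + s *\<^sub>R z) * K (z - w)) (conv f K (x + s *\<^sub>R w) s)"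
proof -
  have [measurable]: "K \<in> borel_measurable borel" by (rule bumpfn_measurable[OF K])
  define F where "F z = f (x + s *\<^sub>R z) * K (z - w)" for z
  have [measurable]: "F \<in> borel_measurable borel" unfolding F_def by measurable
  have F: "F (w + 1 *\<^sub>R z) = f ((x + s *\<^sub>R w) + s *\<^sub>R z) * K z" for z
    by (simp add: F_def scaleR_add_right add.assoc)
  note h = conv_bump(1)[OF f K M s]
  have "integrable lborel (\<lambda>z. F (w + 1 *\<^sub>R z))"
    using h unfolding F has_bochner_integral_iff by simp
  from lborel_integrable_affine[OF this, of 1 "- w"] have "integrable lborel F" by simp
  moreover have "(LINT z|lborel. F z) = conv f K (x + s *\<^sub>R w) s"
    using lborel_integral_affine[of F 1 w] unfolding F conv_def by simp
  ultimately show ?thesis unfolding F_def has_bochner_integral_iff by simp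
qed

lemma conv_two_balls:
  fixes f K :: "real^'n \<Rightarrow> real"
  assumes f[measurable]: "f \<in> borel_measurable borel" and K[measurable]: "K \<in> borel_measurable borel"
    and M: "\<And>y. y \<in> cball x s \<union> cball (x + s *\<^sub>R w) s \<Longrightarrow> \<bar>f y\<bar> \<le> M" and s: "0 \<le> s" and B0: "0 \<le> B"
    and B: "\<And>z. \<bar>K z\<bar> \<le> B * (indicator (cball 0 1) z + indicator (cball w 1) z)"
  shows "\<bar>conv f K x s\<bar> \<le> 2 * (M * B) * unit_vol TYPE('n)"
  unfolding conv_def
proof (rule two_balls_bound(2))
  have M0: "0 \<le> M" using M[of x] s by (auto intro: order_trans[OF abs_ge_zero])
  fix z
  show "\<bar>f (x + s *\<^sub>R z) * K z\<bar> \<le> M * B * (indicator (cball 0 1) z + indicator (cball w 1) z)"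
  proof (cases "z \<in> cball 0 1 \<union> cball w 1")
    case True
    then have "x + s *\<^sub>R z \<in> cball x s \<union> cball (x + s *\<^sub>R w) s"
    proof
      assume "z \<in> cball 0 1" then show ?thesis using s by (simp add: dist_norm mult_left_le)
    next
      assume "z \<in> cball w 1"
      moreover have "norm (x + s *\<^sub>R w - (x + s *\<^sub>R z)) = s * norm (w - z)"
        using s by (simp add: scaleR_diff_right[symmetric])
      ultimately show ?thesis using s by (simp add: dist_norm mult_left_le)
    qed
    then have "\<bar>f (x + s *\<^sub>R z)\<bar> \<le> M" by (rule M)
    then show ?thesis using B[of z] M0 by (simp add: abs_mult mult_mono mult.assoc)
  next
    case False
    then have "K z = 0" using B[of z] by simp
    then show ?thesis using M0 B0 by simp
  qed
qed measurable

lemma poisson_bounded: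
  assumes "poisson u g G" "cball x s \<subseteq> ball 0 1"
  obtains M where "\<And>y. y \<in> cball x s \<Longrightarrow> \<bar>u y\<bar> \<le> M"
proof -
  have "bounded (u ` cball x s)"
    using assms by (intro compact_imp_bounded compact_continuous_image) (auto simp: poisson_def intro: continuous_on_subset)
  then obtain M where "\<forall>x\<in>u ` cball x s. norm x \<le> M" unfolding bounded_iff by (elim exE)
  then show ?thesis using that[of M] by auto
qed

lemma conv_eta_tendsto:
  fixes u g :: "real^'n \<Rightarrow> real"
  assumes po: "poisson u g G" and x: "x \<in> ball 0 1"
  shows "((\<lambda>s. conv u eta x s) \<longlongrightarrow> mass TYPE('n) * u x) (at_right 0)"
proof (rule tendstoI)
  fix e :: real assume e: "e > 0"
  obtain B where B: "B > 0" "\<And>z::real^'n. \<bar>eta z\<bar> \<le> B" using bumpfn_bounded[OF bumpfn_eta] by blast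
  define e' where "e' = e / (2 * B * unit_vol TYPE('n))"
  have vp: "0 < unit_vol TYPE('n)" by (rule unit_vol_pos)
  have e': "e' > 0" using e B vp by (simp add: e'_def)
  have u: "u \<in> borel_measurable borel" "continuous_on (ball 0 1) u" using po by (auto simp: poisson_def)
  then have "isCont u x" using x continuous_on_eq_continuous_at[OF open_ball] by blast
  then obtain d where d: "d > 0" "\<And>y. dist y x < d \<Longrightarrow> dist (u y) (u x) < e'"
    using e' unfolding continuous_at_eps_delta by metis
  show "\<forall>\<^sub>F s in at_right 0. dist (conv u eta x s) (mass TYPE('n) * u x) < e"
    unfolding eventually_at_right_field
  proof (intro exI[of _ d] conjI allI impI d(1))
    fix s assume s: "0 < s" "s < d"
    have le: "\<bar>u y - u x\<bar> \<le> e'" if "y \<in> cball x s" for y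
      using d(2)[of y] that s by (auto simp: dist_real_def dist_commute)
    have le': "\<bar>u y\<bar> \<le> e' + \<bar>u x\<bar>" if "y \<in> cball x s" for y
      using le[OF that] by linarith
    have "has_bochner_integral lborel (\<lambda>z. u (x + s *\<^sub>R z) * eta z - u x * eta z) (conv u eta x s - u x * mass TYPE('n))"
      unfolding mass_def
      by (intro has_bochner_integral_diff conv_bump(1)[OF u(1) bumpfn_eta le']
          has_bochner_integral_mult_right has_bochner_integral_integrable bumpfn_integrable bumpfn_eta)
         (use s in auto)
    then have "conv u eta x s - u x * mass TYPE('n) = conv (\<lambda>y. u y - u x) eta x s"
      unfolding conv_def[of "\<lambda>y. u y - u x"] has_bochner_integral_iff by (simp add: left_diff_distrib)
    moreover have "\<bar>conv (\<lambda>y. u y - u x) eta x s\<bar> \<le> e' * B * unit_vol TYPE('n)"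
      by (rule conv_bump(2)[OF _ bumpfn_eta le]) (use u s B in auto)
    moreover have "e' * B * unit_vol TYPE('n) < e"
      using e B vp by (simp add: e'_def)
    ultimately show "dist (conv u eta x s) (mass TYPE('n) * u x) < e"
      by (simp add: dist_real_def mult.commute)
  qed
qed

text \<open>Vanishing of u and its derivative at x gives u(y) = o(|y - x|). This supplies the zero
  starting value when the first moments are integrated in the scale.\<close>

lemma conv_bump_over_scale_tendsto_0:
  fixes u K :: "real^'n \<Rightarrow> real"
  assumes u: "u \<in> borel_measurable borel" and K: "bumpfn K" and u0: "u x = 0" and D: "(u has_derivative (\<lambda>_. 0)) (at x)"
  shows "((\<lambda>s. conv u K x s / s) \<longlongrightarrow> 0) (at_right 0)"
proof (rule tendstoI)
  fix e :: real assume e: "e > 0"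
  obtain B where B: "B > 0" "\<And>z::real^'n. \<bar>K z\<bar> \<le> B" using bumpfn_bounded[OF K] by blast
  define e' where "e' = e / (2 * B * unit_vol TYPE('n))"
  have vp: "0 < unit_vol TYPE('n)" by (rule unit_vol_pos)
  have e': "e' > 0" using e B vp by (simp add: e'_def)
  obtain d where d: "d > 0" "\<And>y. norm (y - x) < d \<Longrightarrow> \<bar>u y\<bar> \<le> e' * norm (y - x)"
    using D e' u0 unfolding has_derivative_at_alt by auto
  show "\<forall>\<^sub>F s in at_right 0. dist (conv u K x s / s) 0 < e"
    unfolding eventually_at_right_field
  proof (intro exI[of _ d] conjI allI impI d(1))
    fix s assume s: "0 < s" "s < d"
    have le: "\<bar>u y\<bar> \<le> e' * s" if "y \<in> cball x s" for y
    proof -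
      have y: "norm (y - x) \<le> s" using that by (simp add: dist_norm norm_minus_commute)
      then have "\<bar>u y\<bar> \<le> e' * norm (y - x)" using s by (intro d) simp
      also have "\<dots> \<le> e' * s" using y e' by simp
      finally show ?thesis .
    qed
    have "\<bar>conv u K x s\<bar> \<le> e' * s * B * unit_vol TYPE('n)"
      by (rule conv_bump(2)[OF u K le]) (use s B in auto)
    moreover have "e' * s * B * unit_vol TYPE('n) = e / 2 * s"
      using B vp by (simp add: e'_def)
    ultimately have "\<bar>conv u K x s\<bar> \<le> e / 2 * s" by simp
    then have "\<bar>conv u K x s / s\<bar> \<le> e / 2" using s by (simp add: abs_divide pos_divide_le_eq)
    then show "dist (conv u K x s / s) 0 < e" using e unfolding dist_real_def by linarith
  qed
qed

text \<open>A mean value formula with error: the scale derivative is t times an average of g, at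
  most a constant times G t, and the average tends to \<open>mass\<close> times u(x) at scale
  0.\<close>

lemma eta_average_bound:
  "\<exists>C>0. \<forall>(u::real^'n \<Rightarrow> real) g G x R. poisson u g G \<longrightarrow> 0 < R \<longrightarrow> cball x R \<subseteq> ball 0 1 \<longrightarrow>
     \<bar>conv u eta x R - mass TYPE('n) * u x\<bar> \<le> C * G * R\<^sup>2"
proof -
  obtain B where B: "B > 0" "\<And>z::real^'n. \<bar>zeta z\<bar> \<le> B" using bumpfn_bounded[OF bumpfn_zeta] by blast
  define C where "C = B * unit_vol TYPE('n) / 2"
  have "\<bar>conv u eta x R - mass TYPE('n) * u x\<bar> \<le> C * G * R\<^sup>2"
    if po: "poisson u g G" and R: "0 < R" "cball x R \<subseteq> ball 0 1" for u g :: "real^'n \<Rightarrow> real" and G x R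
  proof (rule deriv_bound_diff_0[where I = "conv u eta x" and B = "\<lambda>t. C * G * t\<^sup>2", OF R(1)])
    fix t assume t: "0 < t" "t \<le> R"
    then have sub: "cball x t \<subseteq> ball 0 1" using R by auto
    show "(conv u eta x has_real_derivative t * conv g zeta x t) (at t)"
      using deriv_eta[OF po t(1) sub] .
    show "((\<lambda>t. C * G * t\<^sup>2) has_real_derivative C * G * (2 * t)) (at t)"
      by (auto intro!: derivative_eq_intros)
    have g: "g \<in> borel_measurable borel" "\<And>y. \<bar>g y\<bar> \<le> G" using po by (auto simp: poisson_def)
    have "\<bar>conv g zeta x t\<bar> \<le> G * B * unit_vol TYPE('n)"
      by (rule conv_bump(2)[OF g(1) bumpfn_zeta g(2)]) (use t B in auto)
    then have "t * \<bar>conv g zeta x t\<bar> \<le> t * (G * B * unit_vol TYPE('n))"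
      using t by (intro mult_left_mono) auto
    then show "\<bar>t * conv g zeta x t\<bar> \<le> C * G * (2 * t)"
      using t by (simp add: C_def abs_mult algebra_simps)
  next
    show "(conv u eta x \<longlongrightarrow> mass TYPE('n) * u x) (at_right 0)"
      using R by (intro conv_eta_tendsto[OF po]) (meson centre_in_cball less_imp_le subsetD)
    have "((\<lambda>t. C * G * t\<^sup>2) \<longlongrightarrow> C * G * 0\<^sup>2) (at_right 0)" by (intro tendsto_intros)
    then show "((\<lambda>t. C * G * t\<^sup>2) \<longlongrightarrow> 0) (at_right 0)" by simp
  qed
  moreover have "C > 0" using B unit_vol_pos[where 'n='n] by (simp add: C_def)
  ultimately show ?thesis by blast
qed

lemma poisson_G_nonneg: "poisson u g G \<Longrightarrow> 0 \<le> G"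
  unfolding poisson_def by (metis abs_ge_zero order_trans)

text \<open>The average over a ball of radius R is at most sup eta times the L1 norm divided by R^n,
  and replacing it by the value at the centre costs G R^2.\<close>

lemma poisson_sup_bound:
  "\<exists>C>0. \<forall>(u::real^'n \<Rightarrow> real) g G x R. poisson u g G \<longrightarrow> integrable lborel u \<longrightarrow> 0 < R \<longrightarrow> cball x R \<subseteq> ball 0 1 \<longrightarrow>
     \<bar>u x\<bar> \<le> C * ((LINT y|lborel. \<bar>u y\<bar>) / R ^ CARD('n) + G * R\<^sup>2)"
proof -
  obtain C where C: "C > 0" "\<And>(u::real^'n \<Rightarrow> real) g G x R. poisson u g G \<Longrightarrow> 0 < R \<Longrightarrow> cball x R \<subseteq> ball 0 1 \<Longrightarrow>
     \<bar>conv u eta x R - mass TYPE('n) * u x\<bar> \<le> C * G * R\<^sup>2"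
    using eta_average_bound by blast
  obtain B where B: "B > 0" "\<And>z::real^'n. \<bar>eta z\<bar> \<le> B" using bumpfn_bounded[OF bumpfn_eta] by blast
  define K where "K = (B + C) / mass TYPE('n)"
  have "\<bar>u x\<bar> \<le> K * ((LINT y|lborel. \<bar>u y\<bar>) / R ^ CARD('n) + G * R\<^sup>2)"
    if po: "poisson u g G" and int: "integrable lborel u" and R: "0 < R" "cball x R \<subseteq> ball 0 1"
    for u g :: "real^'n \<Rightarrow> real" and G x R
  proof -
    define L where "L = (LINT y|lborel. \<bar>u y\<bar>) / R ^ CARD('n)"
    obtain M where M: "\<And>y. y \<in> cball x R \<Longrightarrow> \<bar>u y\<bar> \<le> M" using poisson_bounded[OF po R(2)] by blast
    have [measurable]: "u \<in> borel_measurable borel" using po by (simp add: poisson_def)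
    have int1: "integrable lborel (\<lambda>z. \<bar>u (x + R *\<^sub>R z)\<bar>)"
      using lborel_integrable_affine[OF int R(1)] by simp
    have "norm (conv u eta x R) \<le> (LINT z|lborel. B * \<bar>u (x + R *\<^sub>R z)\<bar>)"
      unfolding conv_def
    proof (rule Bochner_Integration.integral_norm_bound_integral)
      have "has_bochner_integral lborel (\<lambda>z. u (x + R *\<^sub>R z) * eta z) (conv u eta x R)"
        by (rule conv_bump(1)[OF _ bumpfn_eta M]) (use R in auto)
      then show "integrable lborel (\<lambda>z. u (x + R *\<^sub>R z) * eta z)" by (simp add: has_bochner_integral_iff)
      show "integrable lborel (\<lambda>z. B * \<bar>u (x + R *\<^sub>R z)\<bar>)" using int1 by simp
      show "norm (u (x + R *\<^sub>R z) * eta z) \<le> B * \<bar>u (x + R *\<^sub>R z)\<bar>" for z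
        using mult_left_mono[OF B(2)[of z], of "\<bar>u (x + R *\<^sub>R z)\<bar>"] by (simp add: abs_mult mult.commute)
    qed
    also have "\<dots> = B * L"
      using lborel_integral_affine[of "\<lambda>y. \<bar>u y\<bar>" R x] R by (simp add: L_def)
    finally have "\<bar>conv u eta x R\<bar> \<le> B * L" by simp
    then have "mass TYPE('n) * \<bar>u x\<bar> \<le> B * L + C * (G * R\<^sup>2)"
      using C(2)[OF po R] mass_pos[where 'n='n] by (simp add: abs_mult[symmetric] mult.assoc)
    also have "\<dots> \<le> (B + C) * (L + G * R\<^sup>2)"
    proof -
      have "0 \<le> C * L" "0 \<le> B * (G * R\<^sup>2)"
        using B C poisson_G_nonneg[OF po] R by (simp_all add: L_def)
      then show ?thesis by (simp add: distrib_left distrib_right)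
    qed
    finally show ?thesis
      using mass_pos[where 'n='n] by (simp add: K_def L_def field_simps)
  qed
  moreover have "K > 0" using B C mass_pos[where 'n='n] by (simp add: K_def)
  ultimately show ?thesis by blast
qed

lemma cball_shift_subset: "norm h \<le> R \<Longrightarrow> t \<le> R \<Longrightarrow> cball (x + h) t \<subseteq> cball x (2 * R)"
  for x h :: "'a::real_normed_vector"
proof
  fix y assume h: "norm h \<le> R" "t \<le> R" and "y \<in> cball (x + h) t"
  moreover have "dist x y \<le> dist x (x + h) + dist (x + h) y" by (rule dist_triangle)
  ultimately show "y \<in> cball x (2 * R)" by (simp add: dist_norm)
qed

lemma conv_translate_diff:
  fixes f K :: "real^'n \<Rightarrow> real"
  assumes f: "f \<in> borel_measurable borel" and K: "bumpfn K" and s: "0 < s"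
    and M: "\<And>y. y \<in> cball x s \<Longrightarrow> \<bar>f y\<bar> \<le> M" "\<And>y. y \<in> cball (x + h) s \<Longrightarrow> \<bar>f y\<bar> \<le> M"
  shows "conv f K (x + h) s - conv f K x s = conv f (\<lambda>z. K (z - h /\<^sub>R s) - K z) x s"
proof -
  have xh: "x + s *\<^sub>R (h /\<^sub>R s) = x + h" using s by simp
  have "has_bochner_integral lborel (\<lambda>z. f (x + s *\<^sub>R z) * K (z - h /\<^sub>R s) - f (x + s *\<^sub>R z) * K z)
      (conv f K (x + s *\<^sub>R (h /\<^sub>R s)) s - conv f K x s)"
    by (rule has_bochner_integral_diff[OF conv_bump_shift[OF f K] conv_bump(1)[OF f K]]) (use s M xh in auto)
  then show ?thesis
    unfolding xh conv_def[of f "\<lambda>z. K (z - h /\<^sub>R s) - K z"] has_bochner_integral_iff by (simp add: right_diff_distrib)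
qed

lemma kernel_diff_bound:
  "\<exists>C>0. \<forall>w z::real^'n. \<bar>eta (z - w) - eta z\<bar> \<le> C * norm w * (indicator (cball 0 1) z + indicator (cball w 1) z)
     \<and> \<bar>zeta (z - w) - zeta z\<bar> \<le> C * norm w * (indicator (cball 0 1) z + indicator (cball w 1) z)"
proof -
  obtain C0 where C0: "C0 > 0" "\<And>w z::real^'n. \<bar>kq 0 (z - w) - kq 0 z\<bar> \<le> C0 * norm w * (indicator (cball 0 1) z + indicator (cball w 1) z)"
    using kq_lipschitz_bound by blast
  obtain C1 where C1: "C1 > 0" "\<And>w z::real^'n. \<bar>kq 1 (z - w) - kq 1 z\<bar> \<le> C1 * norm w * (indicator (cball 0 1) z + indicator (cball w 1) z)"
    using kq_lipschitz_bound by blast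
  have "\<bar>eta (z - w) - eta z\<bar> \<le> (C0 + C1) * norm w * (indicator (cball 0 1) z + indicator (cball w 1) z)
     \<and> \<bar>zeta (z - w) - zeta z\<bar> \<le> (C0 + C1) * norm w * (indicator (cball 0 1) z + indicator (cball w 1) z)" for w z :: "real^'n"
  proof -
    define X where "X = norm w * (indicat_real (cball 0 1) z + indicator (cball w 1) z)"
    have X: "0 \<le> C0 * X" "0 \<le> C1 * X" using C0(1) C1(1) by (simp_all add: X_def)
    have "\<bar>kq 0 (z - w) - kq 0 z\<bar> \<le> C0 * X" "\<bar>kq 1 (z - w) - kq 1 z\<bar> \<le> C1 * X"
      using C0(2)[of z w] C1(2)[of z w] by (simp_all add: X_def mult.assoc)
    moreover have "\<bar>zeta (z - w) - zeta z\<bar> = \<bar>kq 0 (z - w) - kq 0 z\<bar> / 2" by (simp add: zeta_def abs_if field_simps)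
    ultimately have "\<bar>eta (z - w) - eta z\<bar> \<le> C1 * X" "\<bar>zeta (z - w) - zeta z\<bar> \<le> C0 * X"
      using X unfolding eta_def by auto
    then have "\<bar>eta (z - w) - eta z\<bar> \<le> C0 * X + C1 * X \<and> \<bar>zeta (z - w) - zeta z\<bar> \<le> C0 * X + C1 * X"
      using X by auto
    then show ?thesis by (simp add: X_def algebra_simps)
  qed
  with C0 C1 show ?thesis by (intro exI[of _ "C0 + C1"]) auto
qed

lemma kernel_measurable [measurable]:
  "(eta :: real^'n \<Rightarrow> real) \<in> borel_measurable borel" "(zeta :: real^'n \<Rightarrow> real) \<in> borel_measurable borel"
  "(kq j :: real^'n \<Rightarrow> real) \<in> borel_measurable borel"
  by (auto intro: bumpfn_measurable bumpfn_eta bumpfn_zeta borel_measurable_continuous_onI kq_continuous)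

text \<open>The averages at x + h and at x are compared at the same scale. Shifting the kernel costs
  |h|/t, which cancels the factor t in the scale derivative; the latter is thus at most a constant
  times G |h|, integrable down to 0. At the top scale R the same shift is paid with the bound S on
  u.\<close>

lemma poisson_lipschitz_bound:
  "\<exists>C>0. \<forall>(u::real^'n \<Rightarrow> real) g G S x h R. poisson u g G \<longrightarrow> 0 < R \<longrightarrow> cball x (2 * R) \<subseteq> ball 0 1 \<longrightarrow>
     (\<forall>y\<in>cball x (2 * R). \<bar>u y\<bar> \<le> S) \<longrightarrow> norm h \<le> R \<longrightarrow>
     \<bar>u (x + h) - u x\<bar> \<le> C * norm h * (S / R + G * R)"
proof -
  obtain C where C: "C > 0"
    "\<And>w z::real^'n. \<bar>eta (z - w) - eta z\<bar> \<le> C * norm w * (indicator (cball 0 1) z + indicator (cball w 1) z)"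
    "\<And>w z::real^'n. \<bar>zeta (z - w) - zeta z\<bar> \<le> C * norm w * (indicator (cball 0 1) z + indicator (cball w 1) z)"
    using kernel_diff_bound by blast
  define V where "V = unit_vol TYPE('n)"
  have V: "V > 0" unfolding V_def by (rule unit_vol_pos)
  define m where "m = mass TYPE('n)"
  have m: "m > 0" unfolding m_def by (rule mass_pos)
  have "\<bar>u (x + h) - u x\<bar> \<le> 2 * C * V / m * norm h * (S / R + G * R)"
    if po: "poisson u g G" and R: "0 < R" and sub: "cball x (2 * R) \<subseteq> ball 0 1"
      and S: "\<And>y. y \<in> cball x (2 * R) \<Longrightarrow> \<bar>u y\<bar> \<le> S" and h: "norm h \<le> R"
    for u g :: "real^'n \<Rightarrow> real" and G S x h R
  proof -
    have g: "g \<in> borel_measurable borel" "\<And>y. \<bar>g y\<bar> \<le> G" and u: "u \<in> borel_measurable borel"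
      using po by (auto simp: poisson_def)
    have sub1: "cball x t \<subseteq> cball x (2 * R)" and sub2: "cball (x + h) t \<subseteq> cball x (2 * R)" if "t \<le> R" for t
      using that R cball_shift_subset[OF h that] by auto
    define I where "I t = conv u eta (x + h) t - conv u eta x t" for t
    define I' where "I' t = t * conv g zeta (x + h) t - t * conv g zeta x t" for t
    have est: "\<bar>conv f K (x + h) t - conv f K x t\<bar> \<le> 2 * (M * (C * norm (h /\<^sub>R t))) * V"
      if t: "0 < t" and f: "f \<in> borel_measurable borel" and K: "bumpfn K"
        and M: "\<And>y. y \<in> cball x t \<Longrightarrow> \<bar>f y\<bar> \<le> M" "\<And>y. y \<in> cball (x + h) t \<Longrightarrow> \<bar>f y\<bar> \<le> M"
        and b: "\<And>w z. \<bar>K (z - w) - K z\<bar> \<le> C * norm w * (indicator (cball 0 1) z + indicator (cball w 1) z)"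
      for f K :: "real^'n \<Rightarrow> real" and t M
    proof -
      have [measurable]: "K \<in> borel_measurable borel" by (rule bumpfn_measurable[OF K])
      have "\<bar>conv f (\<lambda>z. K (z - h /\<^sub>R t) - K z) x t\<bar> \<le> 2 * (M * (C * norm (h /\<^sub>R t))) * V"
        unfolding V_def
      proof (rule conv_two_balls[where w = "h /\<^sub>R t", OF f])
        show "\<bar>f y\<bar> \<le> M" if "y \<in> cball x t \<union> cball (x + t *\<^sub>R (h /\<^sub>R t)) t" for y
          using that t M by auto
        show "\<bar>K (z - h /\<^sub>R t) - K z\<bar> \<le> C * norm (h /\<^sub>R t) * (indicator (cball 0 1) z + indicator (cball (h /\<^sub>R t) 1) z)" for z
          by (rule b)
      qed (use t C in auto)
      then show ?thesis using conv_translate_diff[OF f K t M] by simp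
    qed
    have "\<bar>I R - m * (u (x + h) - u x)\<bar> \<le> 2 * G * C * norm h * V * R"
    proof (rule deriv_bound_diff_0[where I' = I' and B = "\<lambda>t. 2 * G * C * norm h * V * t", OF R])
      fix t assume t: "0 < t" "t \<le> R"
      show "(I has_real_derivative I' t) (at t)"
        unfolding I_def[abs_def] I'_def
        by (intro DERIV_diff deriv_eta[OF po t(1)]) (use sub sub1[OF t(2)] sub2[OF t(2)] in auto)
      show "((\<lambda>t. 2 * G * C * norm h * V * t) has_real_derivative 2 * G * C * norm h * V) (at t)"
        by (auto intro!: derivative_eq_intros)
      have "\<bar>I' t\<bar> = t * \<bar>conv g zeta (x + h) t - conv g zeta x t\<bar>"
        using t by (simp add: I'_def right_diff_distrib[symmetric] abs_mult)
      also have "\<dots> \<le> t * (2 * (G * (C * norm (h /\<^sub>R t))) * V)"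
        using t by (intro mult_left_mono est g bumpfn_zeta C) auto
      also have "\<dots> = 2 * G * C * norm h * V" using t by simp
      finally show "\<bar>I' t\<bar> \<le> 2 * G * C * norm h * V" .
    next
      have inb: "x \<in> ball 0 1" "x + h \<in> ball 0 1" using subsetD[OF sub, of x] subsetD[OF sub, of "x + h"] h R by (simp_all add: dist_norm)
      have "(I \<longlongrightarrow> m * u (x + h) - m * u x) (at_right 0)"
        unfolding I_def[abs_def] m_def by (intro tendsto_diff conv_eta_tendsto[OF po] inb)
      then show "(I \<longlongrightarrow> m * (u (x + h) - u x)) (at_right 0)" by (simp add: right_diff_distrib)
      have "((\<lambda>t. 2 * G * C * norm h * V * t) \<longlongrightarrow> 2 * G * C * norm h * V * 0) (at_right 0)"
        by (intro tendsto_intros)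
      then show "((\<lambda>t. 2 * G * C * norm h * V * t) \<longlongrightarrow> 0) (at_right 0)" by simp
    qed
    moreover have "\<bar>I R\<bar> \<le> 2 * (S * (C * norm (h /\<^sub>R R))) * V"
      unfolding I_def using sub1[of R] sub2[of R] S by (intro est[OF R u bumpfn_eta] C) auto
    moreover have "2 * (S * (C * norm (h /\<^sub>R R))) * V = 2 * C * V * norm h * (S / R)"
      using R by (simp add: field_simps)
    ultimately have "\<bar>m * (u (x + h) - u x)\<bar> \<le> 2 * C * V * norm h * (S / R) + 2 * G * C * norm h * V * R"
      by linarith
    also have "\<dots> = 2 * C * V * norm h * (S / R + G * R)" by (simp add: algebra_simps)
    finally have "\<bar>u (x + h) - u x\<bar> * m \<le> 2 * C * V * norm h * (S / R + G * R)"
      using m by (simp only: abs_mult abs_of_pos mult.commute[of m])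
    then have "\<bar>u (x + h) - u x\<bar> \<le> 2 * C * V * norm h * (S / R + G * R) / m"
      using m by (simp only: pos_le_divide_eq)
    then show ?thesis by simp
  qed
  moreover have "2 * C * V / m > 0" using C V m by simp
  ultimately show ?thesis by blast
qed

section \<open>Second-order approximation by the averaged Hessian\<close>

lemma bumpfn_family_bounded:
  fixes K :: "'i::finite \<Rightarrow> real^'n \<Rightarrow> real"
  assumes "\<And>i. bumpfn (K i)"
  shows "\<exists>B>0. \<forall>i z. \<bar>K i z\<bar> \<le> B"
proof -
  have "\<forall>i. \<exists>B>0. \<forall>z. \<bar>K i z\<bar> \<le> B" using bumpfn_bounded[OF assms] by blast
  then obtain b where b: "\<And>i. b i > 0" "\<And>i z. \<bar>K i z\<bar> \<le> b i" by metis
  have "\<bar>K i z\<bar> \<le> (\<Sum>i\<in>UNIV. b i)" for i z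
    using b(2)[of i z] member_le_sum[of i UNIV b] b(1) by (auto intro: order_trans less_imp_le)
  moreover have "0 < (\<Sum>i\<in>UNIV. b i)" using b(1) by (intro sum_pos) auto
  ultimately show ?thesis by blast
qed

text \<open>Stated for abstract kernels because it is needed twice: for u with the eta kernels and
  for g with the zeta kernels. The linear term is negative since the kernel is translated to K(z -
  w).\<close>

lemma conv_taylor:
  fixes f K0 :: "real^'n \<Rightarrow> real" and K1 K2
  assumes f: "f \<in> borel_measurable borel" and K: "bumpfn K0" "\<And>i. bumpfn (K1 i)" "\<And>i j. bumpfn (K2 i j)" and s: "0 < s"
    and M: "\<And>y. y \<in> cball x s \<Longrightarrow> \<bar>f y\<bar> \<le> M" "\<And>y. y \<in> cball (x + s *\<^sub>R w) s \<Longrightarrow> \<bar>f y\<bar> \<le> M"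
    and rem: "\<And>z. K z = K0 (z - w) - (K0 z - (\<Sum>i\<in>UNIV. w $ i * K1 i z) + 1/2 * (\<Sum>i\<in>UNIV. \<Sum>j\<in>UNIV. w $ i * w $ j * K2 i j z))"
  shows "conv f K0 (x + s *\<^sub>R w) s - (conv f K0 x s - (\<Sum>i\<in>UNIV. w $ i * conv f (K1 i) x s)
      + 1/2 * (\<Sum>i\<in>UNIV. \<Sum>j\<in>UNIV. w $ i * w $ j * conv f (K2 i j) x s)) = conv f K x s"
proof -
  let ?f = "\<lambda>z. f (x + s *\<^sub>R z)"
  have s': "0 \<le> s" using s by simp
  have "has_bochner_integral lborel (\<lambda>z. ?f z * K0 (z - w) - (?f z * K0 z - (\<Sum>i\<in>UNIV. w $ i * (?f z * K1 i z))
      + 1/2 * (\<Sum>i\<in>UNIV. \<Sum>j\<in>UNIV. w $ i * w $ j * (?f z * K2 i j z))))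
     (conv f K0 (x + s *\<^sub>R w) s - (conv f K0 x s - (\<Sum>i\<in>UNIV. w $ i * conv f (K1 i) x s)
      + 1/2 * (\<Sum>i\<in>UNIV. \<Sum>j\<in>UNIV. w $ i * w $ j * conv f (K2 i j) x s)))"
    by (intro has_bochner_integral_diff has_bochner_integral_add has_bochner_integral_sum has_bochner_integral_mult_right
         conv_bump_shift[OF f K(1) M(2) s'] conv_bump(1)[OF f K(1) M(1) s'] conv_bump(1)[OF f K(2) M(1) s'] conv_bump(1)[OF f K(3) M(1) s'])
  then have "conv f K0 (x + s *\<^sub>R w) s - (conv f K0 x s - (\<Sum>i\<in>UNIV. w $ i * conv f (K1 i) x s)
      + 1/2 * (\<Sum>i\<in>UNIV. \<Sum>j\<in>UNIV. w $ i * w $ j * conv f (K2 i j) x s))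
     = (LINT z|lborel. ?f z * K0 (z - w) - (?f z * K0 z - (\<Sum>i\<in>UNIV. w $ i * (?f z * K1 i z))
      + 1/2 * (\<Sum>i\<in>UNIV. \<Sum>j\<in>UNIV. w $ i * w $ j * (?f z * K2 i j z))))"
    by (simp only: has_bochner_integral_iff)
  also have "\<dots> = conv f K x s"
    unfolding conv_def
    by (intro Bochner_Integration.integral_cong refl)
       (simp add: rem right_diff_distrib distrib_left sum_distrib_left mult_ac)
  finally show ?thesis .
qed

lemma quadratic_sums:
  fixes w z :: "real^'n"
  shows "(\<Sum>i\<in>UNIV. \<Sum>j\<in>UNIV. w $ i * w $ j * (a * of_bool (i = j) + b * (z $ i * z $ j)))
     = a * (w \<bullet> w) + b * (z \<bullet> w)\<^sup>2"
proof -
  have 1: "(\<Sum>i\<in>UNIV. \<Sum>j\<in>UNIV. w $ i * w $ j * (a * of_bool (i = j))) = a * (w \<bullet> w)"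
  proof -
    have "(\<Sum>j\<in>UNIV. w $ i * w $ j * (a * of_bool (i = j))) = a * (w $ i * w $ i)" for i
      by (subst sum.remove[of _ i]) (auto intro!: sum.neutral)
    then show ?thesis by (simp add: inner_vec_def sum_distrib_left)
  qed
  have 2: "(\<Sum>i\<in>UNIV. \<Sum>j\<in>UNIV. w $ i * w $ j * (b * (z $ i * z $ j))) = b * (z \<bullet> w)\<^sup>2"
    by (simp add: inner_vec_def power2_eq_square sum_product sum_distrib_left mult_ac)
  show ?thesis unfolding distrib_left sum.distrib 1 2 ..
qed

lemma kq_rem_eta:
  "kq_rem 1 w z = eta (z - w) - (eta z - (\<Sum>i\<in>UNIV. w $ i * eta1 i z) + 1/2 * (\<Sum>i\<in>UNIV. \<Sum>j\<in>UNIV. w $ i * w $ j * eta2 i j z))"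
proof -
  have "(\<Sum>i\<in>UNIV. w $ i * eta1 i z) = - 2 * kq 2 z * (z \<bullet> w)"
    by (simp add: eta1_def inner_vec_def sum_distrib_left sum_distrib_right sum_negf mult_ac)
  moreover have "(\<Sum>i\<in>UNIV. \<Sum>j\<in>UNIV. w $ i * w $ j * eta2 i j z) = - 2 * kq 2 z * (w \<bullet> w) + 4 * kq 3 z * (z \<bullet> w)\<^sup>2"
    using quadratic_sums[of w "- 2 * kq 2 z" "4 * kq 3 z" z] by (simp add: eta2_def mult_ac)
  moreover have "Suc 1 = 2" "Suc (Suc 1) = 3" "Suc 2 = 3" by simp_all
  ultimately show ?thesis unfolding kq_rem_def eta_def by (simp only:) (simp add: field_simps)
qed

lemma kq_rem_zeta:
  "1/2 * kq_rem 0 w z = zeta (z - w) - (zeta z - (\<Sum>i\<in>UNIV. w $ i * zeta1 i z) + 1/2 * (\<Sum>i\<in>UNIV. \<Sum>j\<in>UNIV. w $ i * w $ j * zeta2 i j z))"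
proof -
  have "(\<Sum>i\<in>UNIV. w $ i * zeta1 i z) = - kq 1 z * (z \<bullet> w)"
    by (simp add: zeta1_def inner_vec_def sum_distrib_left sum_distrib_right sum_negf mult_ac)
  moreover have "(\<Sum>i\<in>UNIV. \<Sum>j\<in>UNIV. w $ i * w $ j * zeta2 i j z) = - kq 1 z * (w \<bullet> w) + 2 * kq 2 z * (z \<bullet> w)\<^sup>2"
    using quadratic_sums[of w "- kq 1 z" "2 * kq 2 z" z] by (simp add: zeta2_def mult_ac)
  moreover have "kq_rem 0 w z = kq 0 (z - w) - (kq 0 z + 2 * (z \<bullet> w) * kq 1 z
     + (2 * (z \<bullet> w)\<^sup>2 * kq 2 z - (w \<bullet> w) * kq 1 z))"
    by (simp add: kq_rem_def numeral_2_eq_2)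
  ultimately show ?thesis unfolding zeta_def by (simp add: field_simps)
qed

lemma kq_rem_measurable [measurable]: "kq_rem j w \<in> borel_measurable borel"
proof -
  have "kq_rem j w = (\<lambda>z. kq j (z - w) - (kq j z + 2 * (z \<bullet> w) * kq (Suc j) z
     + (2 * (z \<bullet> w)\<^sup>2 * kq (Suc (Suc j)) z - (w \<bullet> w) * kq (Suc j) z)))"
    by (simp add: kq_rem_def fun_eq_iff)
  then show ?thesis by (simp only:) measurable
qed

text \<open>The Hessian in the centre of the average of u at scale R, with both derivatives moved
  onto the kernel. It is not divided by \<open>mass\<close>, whence the factor 2 \<open>mass\<close>
  in front of u in the approximation results.\<close>

definition hess :: "(real^'n \<Rightarrow> real) \<Rightarrow> real^'n \<Rightarrow> real \<Rightarrow> real^'n^'n" where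
  "hess u x R = (\<chi> i j. conv u (eta2 i j) x R / R\<^sup>2)"

definition qform :: "real^'n^'n \<Rightarrow> real^'n \<Rightarrow> real" where
  "qform H h = (\<Sum>i\<in>UNIV. \<Sum>j\<in>UNIV. h $ i * h $ j * H $ i $ j)"

lemma first_moment_bound:
  "\<exists>C>0. \<forall>(u::real^'n \<Rightarrow> real) g G x R i. poisson u g G \<longrightarrow> 0 < R \<longrightarrow> cball x R \<subseteq> ball 0 1 \<longrightarrow>
     u x = 0 \<longrightarrow> (u has_derivative (\<lambda>_. 0)) (at x) \<longrightarrow> \<bar>conv u (eta1 i) x R / R\<bar> \<le> C * G * R"
proof -
  obtain B where B: "B > 0" "\<And>i (z::real^'n). \<bar>zeta1 i z\<bar> \<le> B"
    using bumpfn_family_bounded[of zeta1, OF bumpfn_zeta1] by blast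
  define C where "C = B * unit_vol TYPE('n)"
  have "\<bar>conv u (eta1 i) x R / R - 0\<bar> \<le> C * G * R"
    if po: "poisson u g G" and R: "0 < R" "cball x R \<subseteq> ball 0 1" and u: "u x = 0" "(u has_derivative (\<lambda>_. 0)) (at x)"
    for u g :: "real^'n \<Rightarrow> real" and G x R i
  proof (rule deriv_bound_diff_0[where I = "\<lambda>t. conv u (eta1 i) x t / t" and B = "\<lambda>t. C * G * t", OF R(1)])
    fix t assume t: "0 < t" "t \<le> R"
    then have sub: "cball x t \<subseteq> ball 0 1" using R by auto
    show "((\<lambda>t. conv u (eta1 i) x t / t) has_real_derivative conv g (zeta1 i) x t) (at t)"
      using deriv_eta1[OF po t(1) sub] .
    show "((\<lambda>t. C * G * t) has_real_derivative C * G) (at t)"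
      by (auto intro!: derivative_eq_intros)
    have g: "g \<in> borel_measurable borel" "\<And>y. \<bar>g y\<bar> \<le> G" using po by (auto simp: poisson_def)
    have "\<bar>conv g (zeta1 i) x t\<bar> \<le> G * B * unit_vol TYPE('n)"
      by (rule conv_bump(2)[OF g(1) bumpfn_zeta1 g(2)]) (use t B in auto)
    then show "\<bar>conv g (zeta1 i) x t\<bar> \<le> C * G" by (simp add: C_def mult_ac)
  next
    have "u \<in> borel_measurable borel" using po by (simp add: poisson_def)
    then show "((\<lambda>t. conv u (eta1 i) x t / t) \<longlongrightarrow> 0) (at_right 0)"
      by (rule conv_bump_over_scale_tendsto_0[OF _ bumpfn_eta1 u])
    have "((\<lambda>t. C * G * t) \<longlongrightarrow> C * G * 0) (at_right 0)" by (intro tendsto_intros)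
    then show "((\<lambda>t. C * G * t) \<longlongrightarrow> 0) (at_right 0)" by simp
  qed
  moreover have "C > 0" using B unit_vol_pos[where 'n='n] by (simp add: C_def)
  ultimately show ?thesis by (intro exI[of _ C]) simp
qed

text \<open>For fixed h, the Taylor remainder I(t) of the average at scale t has as derivative the
  analogous remainder for g. That is t times O((|h|/t)^3), hence O(|h|^3/t^2), and its integral from
  R to R0 is at most a multiple of |h|^3/R, so of R^2. At scale R0 the remainder is estimated
  directly from S. The scale 0, where a logarithm could enter, is never reached.\<close>

lemma taylor_scale_bound:
  "\<exists>C>0. \<forall>(u::real^'n \<Rightarrow> real) g G S x h R R0. poisson u g G \<longrightarrow> 0 < R \<longrightarrow> R \<le> R0 \<longrightarrow> cball x (2 * R0) \<subseteq> ball 0 1 \<longrightarrow>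
     (\<forall>y\<in>cball x (2 * R0). \<bar>u y\<bar> \<le> S) \<longrightarrow> norm h \<le> R \<longrightarrow>
     \<bar>conv u eta (x + h) R - (conv u eta x R - (\<Sum>i\<in>UNIV. h $ i * (conv u (eta1 i) x R / R)) + 1/2 * qform (hess u x R) h)\<bar>
       \<le> C * (G + S / R0\<^sup>2) * R\<^sup>2"
proof -
  obtain C0 where C0: "C0 > 0" "\<And>w z::real^'n. \<bar>kq_rem 0 w z\<bar> \<le> C0 * norm w ^ 3 * (indicator (cball 0 1) z + indicator (cball w 1) z)"
    using kq_rem_bound by blast
  obtain C1 where C1: "C1 > 0" "\<And>w z::real^'n. \<bar>kq_rem 1 w z\<bar> \<le> C1 * norm w ^ 3 * (indicator (cball 0 1) z + indicator (cball w 1) z)"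
    using kq_rem_bound by blast
  define V where "V = unit_vol TYPE('n)"
  have V: "V > 0" unfolding V_def by (rule unit_vol_pos)
  define C where "C = 2 * (C0 + C1) * V"
  have "\<bar>conv u eta (x + h) R - (conv u eta x R - (\<Sum>i\<in>UNIV. h $ i * (conv u (eta1 i) x R / R)) + 1/2 * qform (hess u x R) h)\<bar>
       \<le> C * (G + S / R0\<^sup>2) * R\<^sup>2"
    if po: "poisson u g G" and R: "0 < R" "R \<le> R0" and sub: "cball x (2 * R0) \<subseteq> ball 0 1"
      and S: "\<And>y. y \<in> cball x (2 * R0) \<Longrightarrow> \<bar>u y\<bar> \<le> S" and h: "norm h \<le> R"
    for u g :: "real^'n \<Rightarrow> real" and G S x h R R0
  proof -
    have g: "g \<in> borel_measurable borel" "\<And>y. \<bar>g y\<bar> \<le> G" and u: "u \<in> borel_measurable borel"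
      using po by (auto simp: poisson_def)
    have G: "0 \<le> G" by (rule poisson_G_nonneg[OF po])
    have S0: "0 \<le> S" using S[of x] R by (auto intro: order_trans[OF abs_ge_zero])
    have h0: "norm h \<le> R0" using h R by simp
    have sub1: "cball x t \<subseteq> cball x (2 * R0)" and sub2: "cball (x + h) t \<subseteq> cball x (2 * R0)" if "t \<le> R0" for t
      using that R cball_shift_subset[OF h0 that] by auto
    define I where "I t = conv u eta (x + h) t - (conv u eta x t - (\<Sum>i\<in>UNIV. h $ i * (conv u (eta1 i) x t / t))
       + 1/2 * (\<Sum>i\<in>UNIV. \<Sum>j\<in>UNIV. h $ i * h $ j * (conv u (eta2 i j) x t / t\<^sup>2)))" for t
    define I' where "I' t = t * conv g zeta (x + h) t - (t * conv g zeta x t - (\<Sum>i\<in>UNIV. h $ i * conv g (zeta1 i) x t)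
       + 1/2 * (\<Sum>i\<in>UNIV. \<Sum>j\<in>UNIV. h $ i * h $ j * (conv g (zeta2 i j) x t / t)))" for t
    have est: "\<bar>conv f K x t\<bar> \<le> 2 * (M * (D * norm (h /\<^sub>R t) ^ 3)) * V"
      if t: "0 < t" and f: "f \<in> borel_measurable borel" and K: "K \<in> borel_measurable borel" and D: "0 < D"
        and M: "\<And>y. y \<in> cball x t \<Longrightarrow> \<bar>f y\<bar> \<le> M" "\<And>y. y \<in> cball (x + h) t \<Longrightarrow> \<bar>f y\<bar> \<le> M"
        and b: "\<And>z. \<bar>K z\<bar> \<le> D * norm (h /\<^sub>R t) ^ 3 * (indicator (cball 0 1) z + indicator (cball (h /\<^sub>R t) 1) z)"
      for f K :: "real^'n \<Rightarrow> real" and t M D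
      unfolding V_def
    proof (rule conv_two_balls[where w = "h /\<^sub>R t", OF f K])
      show "\<bar>f y\<bar> \<le> M" if "y \<in> cball x t \<union> cball (x + t *\<^sub>R (h /\<^sub>R t)) t" for y
        using that t M by auto
      show "\<bar>K z\<bar> \<le> D * norm (h /\<^sub>R t) ^ 3 * (indicator (cball 0 1) z + indicator (cball (h /\<^sub>R t) 1) z)" for z
        by (rule b)
    qed (use t D in auto)
    have I_eq: "I t = conv u (kq_rem 1 (h /\<^sub>R t)) x t" if t: "0 < t" "t \<le> R0" for t
    proof -
      have w: "x + t *\<^sub>R (h /\<^sub>R t) = x + h" using t by simp
      have "conv u eta (x + h) t - (conv u eta x t - (\<Sum>i\<in>UNIV. (h /\<^sub>R t) $ i * conv u (eta1 i) x t)
        + 1/2 * (\<Sum>i\<in>UNIV. \<Sum>j\<in>UNIV. (h /\<^sub>R t) $ i * (h /\<^sub>R t) $ j * conv u (eta2 i j) x t)) = conv u (kq_rem 1 (h /\<^sub>R t)) x t"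
      proof (rule conv_taylor[OF u bumpfn_eta bumpfn_eta1 bumpfn_eta2 t(1), where w = "h /\<^sub>R t" and x = x, unfolded w])
        show "\<bar>u y\<bar> \<le> S" if "y \<in> cball x t" for y using that S sub1[OF t(2)] by blast
        show "\<bar>u y\<bar> \<le> S" if "y \<in> cball (x + h) t" for y using that S sub2[OF t(2)] by blast
      qed (rule kq_rem_eta)
      moreover have "I t = conv u eta (x + h) t - (conv u eta x t - (\<Sum>i\<in>UNIV. (h /\<^sub>R t) $ i * conv u (eta1 i) x t)
        + 1/2 * (\<Sum>i\<in>UNIV. \<Sum>j\<in>UNIV. (h /\<^sub>R t) $ i * (h /\<^sub>R t) $ j * conv u (eta2 i j) x t))"
      proof -
        have "(h /\<^sub>R t) $ i * X = h $ i * (X / t)" "(h /\<^sub>R t) $ i * (h /\<^sub>R t) $ j * X = h $ i * h $ j * (X / t\<^sup>2)" for i j X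
          by (simp_all add: field_simps power2_eq_square)
        then show ?thesis unfolding I_def by (simp only:)
      qed
      ultimately show ?thesis by (simp only:)
    qed
    have I'_eq: "I' t = t * conv g (\<lambda>z. 1/2 * kq_rem 0 (h /\<^sub>R t) z) x t" if t: "0 < t" "t \<le> R0" for t
    proof -
      have w: "x + t *\<^sub>R (h /\<^sub>R t) = x + h" using t by simp
      have "conv g zeta (x + h) t - (conv g zeta x t - (\<Sum>i\<in>UNIV. (h /\<^sub>R t) $ i * conv g (zeta1 i) x t)
        + 1/2 * (\<Sum>i\<in>UNIV. \<Sum>j\<in>UNIV. (h /\<^sub>R t) $ i * (h /\<^sub>R t) $ j * conv g (zeta2 i j) x t)) = conv g (\<lambda>z. 1/2 * kq_rem 0 (h /\<^sub>R t) z) x t"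
        by (rule conv_taylor[OF g(1) bumpfn_zeta bumpfn_zeta1 bumpfn_zeta2 t(1), where w = "h /\<^sub>R t" and x = x, unfolded w])
           (rule g(2) kq_rem_zeta)+
      moreover have "I' t = t * (conv g zeta (x + h) t - (conv g zeta x t - (\<Sum>i\<in>UNIV. (h /\<^sub>R t) $ i * conv g (zeta1 i) x t)
        + 1/2 * (\<Sum>i\<in>UNIV. \<Sum>j\<in>UNIV. (h /\<^sub>R t) $ i * (h /\<^sub>R t) $ j * conv g (zeta2 i j) x t)))"
      proof -
        have "t * ((h /\<^sub>R t) $ i * X) = h $ i * X" "t * (1/2 * ((h /\<^sub>R t) $ i * (h /\<^sub>R t) $ j * X)) = 1/2 * (h $ i * h $ j * (X / t))" for i j X
          using t by (simp_all add: field_simps)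
        then show ?thesis unfolding I'_def right_diff_distrib distrib_left sum_distrib_left by (simp only:)
      qed
      ultimately show ?thesis by (simp only:)
    qed
    define c where "c = 2 * G * C0 * V * norm h ^ 3"
    have c: "0 \<le> c" using G C0 V by (simp add: c_def)
    have "\<bar>I R0 - I R\<bar> \<le> - c / R0 - - c / R"
    proof (rule deriv_bound_diff[where I' = I' and B' = "\<lambda>t. c / t\<^sup>2", OF R(2)])
      fix t assume "R \<le> t" "t \<le> R0"
      then have t: "0 < t" "t \<le> R0" using R by auto
      have b: "cball x t \<subseteq> ball 0 1" "cball (x + h) t \<subseteq> ball 0 1"
        using sub sub1[OF t(2)] sub2[OF t(2)] by auto
      show "(I has_real_derivative I' t) (at t)"
        unfolding I_def[abs_def] I'_def
        by (intro DERIV_diff DERIV_add DERIV_sum DERIV_cmult deriv_eta[OF po t(1)] deriv_eta1[OF po t(1)] deriv_eta2[OF po t(1)] b)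
      show "((\<lambda>t. - c / t) has_real_derivative c / t\<^sup>2) (at t)"
        using t by (auto intro!: derivative_eq_intros simp: power2_eq_square)
      have "\<bar>conv g (\<lambda>z. 1/2 * kq_rem 0 (h /\<^sub>R t) z) x t\<bar> \<le> 2 * (G * (C0 * norm (h /\<^sub>R t) ^ 3)) * V"
      proof (rule est[OF t(1) g(1) _ C0(1) g(2) g(2)])
        show "\<bar>1/2 * kq_rem 0 (h /\<^sub>R t) z\<bar> \<le> C0 * norm (h /\<^sub>R t) ^ 3 * (indicator (cball 0 1) z + indicator (cball (h /\<^sub>R t) 1) z)" for z
          using C0(2)[of "h /\<^sub>R t" z] by (simp add: abs_mult)
      qed measurable
      then have "\<bar>I' t\<bar> \<le> t * (2 * (G * (C0 * norm (h /\<^sub>R t) ^ 3)) * V)"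
        using t by (simp add: I'_eq abs_mult)
      also have "\<dots> = c / t\<^sup>2"
        using t by (simp add: c_def field_simps power2_eq_square power3_eq_cube)
      finally show "\<bar>I' t\<bar> \<le> c / t\<^sup>2" .
    qed
    also have "\<dots> \<le> c / R" using c R by simp
    also have "\<dots> \<le> 2 * C0 * V * G * R\<^sup>2"
    proof -
      have "norm h ^ 3 \<le> R ^ 3" using h by (intro power_mono) auto
      then have "c \<le> 2 * G * C0 * V * R ^ 3" unfolding c_def using G C0 V by (intro mult_left_mono) auto
      then show ?thesis using R by (simp add: field_simps power2_eq_square power3_eq_cube)
    qed
    finally have 1: "\<bar>I R0 - I R\<bar> \<le> 2 * C0 * V * G * R\<^sup>2" .
    have R0: "0 < R0" using R by simp
    have "\<bar>I R0\<bar> \<le> 2 * (S * (C1 * norm (h /\<^sub>R R0) ^ 3)) * V"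
      unfolding I_eq[OF R0 order_refl]
    proof (rule est[OF R0 u kq_rem_measurable C1(1)])
      show "\<bar>u y\<bar> \<le> S" if "y \<in> cball x R0" for y using that S sub1[of R0] by blast
      show "\<bar>u y\<bar> \<le> S" if "y \<in> cball (x + h) R0" for y using that S sub2[of R0] by blast
    qed (rule C1(2))
    also have "\<dots> \<le> 2 * (S * (C1 * (R / R0)\<^sup>2)) * V"
    \<comment> \<open>One power of R/R0 \<le> 1 is given up, so that the contribution of the top
      scale also has the form of a constant times R^2.\<close>
    proof -
      have "norm (h /\<^sub>R R0) ^ 3 \<le> (R / R0) ^ 3" using h R0 by (intro power_mono) (auto simp: field_simps)
      also have "\<dots> \<le> (R / R0)\<^sup>2" using R R0 by (intro power_decreasing) auto
      finally show ?thesis using S0 C1 V by (intro mult_right_mono mult_left_mono) auto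
    qed
    finally have "\<bar>I R0\<bar> \<le> 2 * (S * (C1 * (R / R0)\<^sup>2)) * V" .
    then have 2: "\<bar>I R0\<bar> \<le> 2 * C1 * V * (S / R0\<^sup>2) * R\<^sup>2" by (simp add: power_divide mult_ac)
    have "0 \<le> 2 * C0 * V * (S / R0\<^sup>2) * R\<^sup>2" "0 \<le> 2 * C1 * V * G * R\<^sup>2" using S0 G C0 C1 V by auto
    moreover have "2 * C0 * V * G * r + 2 * C1 * V * q * r \<le> C * (G + q) * r"
      if "0 \<le> 2 * C0 * V * q * r" "0 \<le> 2 * C1 * V * G * r" for q r
      using that unfolding C_def by (simp add: distrib_left distrib_right)
    ultimately have "2 * C0 * V * G * R\<^sup>2 + 2 * C1 * V * (S / R0\<^sup>2) * R\<^sup>2 \<le> C * (G + S / R0\<^sup>2) * R\<^sup>2"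
      by blast
    moreover have "I R = conv u eta (x + h) R - (conv u eta x R - (\<Sum>i\<in>UNIV. h $ i * (conv u (eta1 i) x R / R)) + 1/2 * qform (hess u x R) h)"
      by (simp add: I_def qform_def hess_def)
    ultimately show ?thesis using 1 2 by linarith
  qed
  moreover have "C > 0" using C0 C1 V by (simp add: C_def)
  ultimately show ?thesis by blast
qed

lemma abs_combine:
  fixes a b s q mu e1 e2 e3 e4 :: real
  assumes "\<bar>a - mu\<bar> \<le> e1" "\<bar>b\<bar> \<le> e2" "\<bar>s\<bar> \<le> e3" "\<bar>a - (b - s + q / 2)\<bar> \<le> e4"
  shows "\<bar>2 * mu - q\<bar> \<le> 2 * (e1 + e2 + e3 + e4)"
  using assms by argo

text \<open>At x the zeroth and first order terms of the Taylor polynomial are O(R^2) because u and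
  its derivative vanish there, and at x + h the average is within O(R^2) of \<open>mass\<close>
  times u. The constant is uniform in R: all possible growth sits in \<open>hess\<close>.\<close>

lemma poisson_quadratic_approx:
  "\<exists>C>0. \<forall>(u::real^'n \<Rightarrow> real) g G S x h R R0. poisson u g G \<longrightarrow> 0 < R \<longrightarrow> R \<le> R0 \<longrightarrow> cball x (2 * R0) \<subseteq> ball 0 1 \<longrightarrow>
     (\<forall>y\<in>cball x (2 * R0). \<bar>u y\<bar> \<le> S) \<longrightarrow> u x = 0 \<longrightarrow> (u has_derivative (\<lambda>_. 0)) (at x) \<longrightarrow> norm h \<le> R \<longrightarrow>
     \<bar>2 * mass TYPE('n) * u (x + h) - qform (hess u x R) h\<bar> \<le> C * (G + S / R0\<^sup>2) * R\<^sup>2"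
proof -
  obtain C1 where C1: "C1 > 0" "\<And>(u::real^'n \<Rightarrow> real) g G x R. poisson u g G \<Longrightarrow> 0 < R \<Longrightarrow> cball x R \<subseteq> ball 0 1 \<Longrightarrow>
     \<bar>conv u eta x R - mass TYPE('n) * u x\<bar> \<le> C1 * G * R\<^sup>2"
    using eta_average_bound by blast
  obtain C2 where C2: "C2 > 0" "\<And>(u::real^'n \<Rightarrow> real) g G x R i. poisson u g G \<Longrightarrow> 0 < R \<Longrightarrow> cball x R \<subseteq> ball 0 1 \<Longrightarrow>
     u x = 0 \<Longrightarrow> (u has_derivative (\<lambda>_. 0)) (at x) \<Longrightarrow> \<bar>conv u (eta1 i) x R / R\<bar> \<le> C2 * G * R"
    using first_moment_bound by blast
  obtain C3 where C3: "C3 > 0" "\<And>(u::real^'n \<Rightarrow> real) g G S x h R R0. poisson u g G \<Longrightarrow> 0 < R \<Longrightarrow> R \<le> R0 \<Longrightarrow> cball x (2 * R0) \<subseteq> ball 0 1 \<Longrightarrow>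
     \<forall>y\<in>cball x (2 * R0). \<bar>u y\<bar> \<le> S \<Longrightarrow> norm h \<le> R \<Longrightarrow>
     \<bar>conv u eta (x + h) R - (conv u eta x R - (\<Sum>i\<in>UNIV. h $ i * (conv u (eta1 i) x R / R)) + 1/2 * qform (hess u x R) h)\<bar>
       \<le> C3 * (G + S / R0\<^sup>2) * R\<^sup>2"
    using taylor_scale_bound by blast
  \<comment> \<open>C1 occurs twice, for the averages at x + h and at x; C2 is counted once per
    coordinate of h; C3 is the Taylor remainder. The factor 2 clears the 1/2 in front of the
    quadratic form.\<close>
  define C where "C = 2 * (C1 + C1 + CARD('n) * C2 + C3)"
  have "\<bar>2 * mass TYPE('n) * u (x + h) - qform (hess u x R) h\<bar> \<le> C * (G + S / R0\<^sup>2) * R\<^sup>2"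
    if po: "poisson u g G" and R: "0 < R" "R \<le> R0" and sub: "cball x (2 * R0) \<subseteq> ball 0 1"
      and S: "\<forall>y\<in>cball x (2 * R0). \<bar>u y\<bar> \<le> S" and u: "u x = 0" "(u has_derivative (\<lambda>_. 0)) (at x)" and h: "norm h \<le> R"
    for u g :: "real^'n \<Rightarrow> real" and G S x h R R0
  proof -
    have G: "0 \<le> G" by (rule poisson_G_nonneg[OF po])
    have "0 \<le> S" using S[rule_format, of x] R by (auto intro: order_trans[OF abs_ge_zero])
    then have S0: "0 \<le> S / R0\<^sup>2" by simp
    have b: "cball x R \<subseteq> ball 0 1" "cball (x + h) R \<subseteq> ball 0 1"
      using sub R cball_shift_subset[of h R0 R x] h by auto
    define s where "s = (\<Sum>i\<in>UNIV. h $ i * (conv u (eta1 i) x R / R))"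
    have "\<bar>s\<bar> \<le> (\<Sum>i\<in>(UNIV::'n set). R * (C2 * G * R))"
      unfolding s_def
    proof (rule order_trans[OF sum_abs], rule sum_mono)
      fix i
      have "\<bar>h $ i\<bar> \<le> R" using component_le_norm_cart[of h i] h by simp
      then show "\<bar>h $ i * (conv u (eta1 i) x R / R)\<bar> \<le> R * (C2 * G * R)"
        unfolding abs_mult by (intro mult_mono C2(2)[OF po R(1) b(1) u]) (use R in auto)
    qed
    then have s: "\<bar>s\<bar> \<le> CARD('n) * C2 * G * R\<^sup>2" by (simp add: power2_eq_square mult_ac)
    have 1: "\<bar>conv u eta (x + h) R - mass TYPE('n) * u (x + h)\<bar> \<le> C1 * G * R\<^sup>2"
      by (rule C1(2)[OF po R(1) b(2)])
    have 2: "\<bar>conv u eta x R\<bar> \<le> C1 * G * R\<^sup>2"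
      using C1(2)[OF po R(1) b(1)] u by simp
    have 3: "\<bar>conv u eta (x + h) R - (conv u eta x R - s + 1/2 * qform (hess u x R) h)\<bar> \<le> C3 * (G + S / R0\<^sup>2) * R\<^sup>2"
      unfolding s_def by (rule C3(2)[OF po R sub S h])
    have "\<bar>2 * mass TYPE('n) * u (x + h) - qform (hess u x R) h\<bar>
        \<le> 2 * (C1 * G * R\<^sup>2 + C1 * G * R\<^sup>2 + CARD('n) * C2 * G * R\<^sup>2 + C3 * (G + S / R0\<^sup>2) * R\<^sup>2)"
    proof -
      have "\<bar>conv u eta (x + h) R - (conv u eta x R - s + qform (hess u x R) h / 2)\<bar> \<le> C3 * (G + S / R0\<^sup>2) * R\<^sup>2"
        using 3 by simp
      from abs_combine[OF 1 2 s this] show ?thesis by (simp only: mult.assoc)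
    qed
    also have "\<dots> \<le> C * (G + S / R0\<^sup>2) * R\<^sup>2"
    proof -
      have "2 * (C1 * G * r + C1 * G * r + CARD('n) * C2 * G * r + C3 * (G + q) * r) \<le> C * (G + q) * r"
        if "0 \<le> C1 * q * r" "0 \<le> CARD('n) * C2 * q * r" for q r
        using that unfolding C_def by (simp add: distrib_left distrib_right)
      moreover have "0 \<le> C1 * (S / R0\<^sup>2) * R\<^sup>2" "0 \<le> CARD('n) * C2 * (S / R0\<^sup>2) * R\<^sup>2"
        using C1 C2 S0 by (intro mult_nonneg_nonneg; simp)+
      ultimately show ?thesis by blast
    qed
    finally show ?thesis .
  qed
  moreover have "C > 0" using C1 C2 C3 by (auto simp: C_def intro!: add_pos_nonneg mult_nonneg_nonneg)
  ultimately show ?thesis by blast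
qed

section \<open>Quadratic forms and their moments\<close>

lemma qform_inner: "qform H h = H \<bullet> (\<chi> i. h $ i *\<^sub>R h)"
  by (simp add: qform_def inner_vec_def sum_distrib_left mult_ac)

lemma norm_outer: "norm (\<chi> i. h $ i *\<^sub>R h) = (norm h)\<^sup>2" for h :: "real^'n"
proof -
  have "(norm (\<chi> i. h $ i *\<^sub>R h))\<^sup>2 = (\<Sum>i\<in>UNIV. (h $ i)\<^sup>2 * (h \<bullet> h))"
    unfolding power2_norm_eq_inner by (simp add: inner_vec_def[of "\<chi> i. h $ i *\<^sub>R h"] power2_eq_square mult_ac)
  also have "\<dots> = ((norm h)\<^sup>2)\<^sup>2"
  proof -
    have "(\<Sum>i\<in>UNIV. (h $ i)\<^sup>2) = (norm h)\<^sup>2"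
      unfolding power2_norm_eq_inner by (simp add: inner_vec_def power2_eq_square)
    then show ?thesis
      unfolding sum_distrib_right[symmetric] power2_norm_eq_inner[symmetric] by (simp add: power2_eq_square)
  qed
  finally show ?thesis by (rule power2_eq_imp_eq) simp_all
qed

lemma abs_qform_le: "\<bar>qform H h\<bar> \<le> norm H * (norm h)\<^sup>2"
  unfolding qform_inner using Cauchy_Schwarz_ineq2[of H "\<chi> i. h $ i *\<^sub>R h"] by (simp add: norm_outer)

lemma qform_scaleR: "qform H (r *\<^sub>R h) = r\<^sup>2 * qform H h"
  by (simp add: qform_def sum_distrib_left power2_eq_square mult_ac)

lemma qform_sum: "qform (\<Sum>k\<in>A. a k *\<^sub>R H k) h = (\<Sum>k\<in>A. a k * qform (H k) h)"
  by (simp add: qform_inner inner_sum_left)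

lemma qform_continuous: "continuous_on A (qform H)"
  unfolding qform_def[abs_def] by (intro continuous_intros)

lemma qform_eq_0_imp:
  assumes sym: "\<And>i j. H $ i $ j = H $ j $ i" and 0: "\<And>h. qform H h = 0"
  shows "H = 0"
proof -
  have q: "qform H h = (\<Sum>i\<in>UNIV. h $ i * (\<Sum>j\<in>UNIV. h $ j * H $ i $ j))" for h
    by (simp add: qform_def sum_distrib_left mult_ac)
  have ax: "(\<Sum>j\<in>UNIV. axis i 1 $ j * f j) = f i" for i :: 'a and f :: "'a \<Rightarrow> real"
    by (subst sum.remove[of _ i]) (auto simp: axis_def intro!: sum.neutral)
  have d: "H $ i $ i = 0" for i using 0[of "axis i 1"] by (simp add: q ax)
  have "H $ i $ j = 0" for i j
  proof -
    have "qform H (axis i 1 + axis j 1) = H $ i $ i + H $ i $ j + (H $ j $ i + H $ j $ j)"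
      by (simp add: q distrib_right sum.distrib ax)
    then show ?thesis using 0 d sym[of i j] by simp
  qed
  then show ?thesis by (simp add: vec_eq_iff)
qed

lemma continuous_unit_supp_integrable:
  fixes K :: "real^'n \<Rightarrow> real"
  assumes "continuous_on UNIV K" "\<And>z. 1 \<le> norm z \<Longrightarrow> K z = 0"
  shows "integrable lborel K"
proof -
  have "integrable lborel (\<lambda>z. indicator (cball 0 1) z *\<^sub>R K z)"
    by (intro borel_integrable_compact compact_cball continuous_on_subset[OF assms(1)]) auto
  moreover have "(\<lambda>z. indicator (cball 0 1) z *\<^sub>R K z) = K"
  proof
    fix z show "indicator (cball 0 1) z *\<^sub>R K z = K z"
      using assms(2)[of z] by (auto simp: indicator_def)
  qed
  ultimately show ?thesis by simp
qed

text \<open>The weight \<open>kq 2\<close> is the one that remains when a matrix is contracted with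
  \<open>zeta2\<close>. Being nonnegative and positive for 0 < |z| < 1, it makes this a positive
  definite quadratic form on symmetric matrices.\<close>

definition qmoment :: "real^'n^'n \<Rightarrow> real" where
  "qmoment H = (LINT z|lborel. (qform H z)\<^sup>2 * kq 2 z)"

lemma qmoment_integrable: "integrable lborel (\<lambda>z. (qform H z)\<^sup>2 * kq 2 z)"
  by (rule continuous_unit_supp_integrable) (auto intro!: continuous_intros qform_continuous kq_continuous simp: kq_out)

lemma kq2_nonneg: "0 \<le> kq 2 z"
  unfolding kq_def by (rule kb2_nonneg) simp

lemma qmoment_continuous: "continuous_on A qmoment"
proof -
  define M where "M i j k l = (LINT z|lborel. z $ i * z $ j * z $ k * z $ l * kq 2 (z::real^'a))" for i j k l
  have "qmoment H = (\<Sum>i\<in>UNIV. \<Sum>j\<in>UNIV. \<Sum>k\<in>UNIV. \<Sum>l\<in>UNIV. H $ i $ j * H $ k $ l * M i j k l)" for H :: "real^'a^'a"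
  proof -
    have "has_bochner_integral lborel
       (\<lambda>z. \<Sum>i\<in>UNIV. \<Sum>j\<in>UNIV. \<Sum>k\<in>UNIV. \<Sum>l\<in>UNIV. H $ i $ j * H $ k $ l * (z $ i * z $ j * z $ k * z $ l * kq 2 z))
       (\<Sum>i\<in>UNIV. \<Sum>j\<in>UNIV. \<Sum>k\<in>UNIV. \<Sum>l\<in>UNIV. H $ i $ j * H $ k $ l * M i j k l)"
      unfolding M_def
      by (intro has_bochner_integral_sum has_bochner_integral_mult_right has_bochner_integral_integrable
          continuous_unit_supp_integrable continuous_intros kq_continuous) (simp add: kq_out)
    moreover have "(\<Sum>i\<in>UNIV. \<Sum>j\<in>UNIV. \<Sum>k\<in>UNIV. \<Sum>l\<in>UNIV. H $ i $ j * H $ k $ l * (z $ i * z $ j * z $ k * z $ l * kq 2 z))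
        = (qform H z)\<^sup>2 * kq 2 z" for z
    proof -
      have "(qform H z)\<^sup>2 * kq 2 z = (\<Sum>i\<in>UNIV. \<Sum>j\<in>UNIV. z $ i * z $ j * H $ i $ j * (qform H z * kq 2 z))"
        unfolding power2_eq_square mult.assoc[of "qform H z"] by (subst qform_def) (simp only: sum_distrib_right)
      also have "\<dots> = (\<Sum>i\<in>UNIV. \<Sum>j\<in>UNIV. \<Sum>k\<in>UNIV. \<Sum>l\<in>UNIV. H $ i $ j * H $ k $ l * (z $ i * z $ j * z $ k * z $ l * kq 2 z))"
        unfolding qform_def by (simp only: sum_distrib_right sum_distrib_left mult_ac)
      finally show ?thesis by simp
    qed
    ultimately show ?thesis unfolding qmoment_def by (simp add: has_bochner_integral_iff)
  qed
  then have eq: "qmoment = (\<lambda>H. \<Sum>i\<in>UNIV. \<Sum>j\<in>UNIV. \<Sum>k\<in>UNIV. \<Sum>l\<in>UNIV. H $ i $ j * H $ k $ l * M i j k l)"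
    by blast
  show ?thesis unfolding eq by (intro continuous_intros)
qed

lemma qmoment_pos:
  assumes sym: "\<And>i j. H $ i $ j = H $ j $ i" and "H \<noteq> 0"
  shows "0 < qmoment H"
proof -
  obtain h where h: "qform H h \<noteq> 0" using qform_eq_0_imp[OF sym] assms(2) by blast
  then have h0: "h \<noteq> 0" by (auto simp: qform_def)
  define a where "a = (1 / (2 * norm h)) *\<^sub>R h"
  have na: "norm a = 1/2" using h0 by (simp add: a_def)
  show ?thesis
    unfolding qmoment_def
  proof (rule integral_pos_of_continuous[where a = a])
    have "0 < kq 2 a"
      unfolding kq_def by (rule kb2_pos) (simp_all add: dot_square_norm na power2_eq_square)
    moreover have "qform H a \<noteq> 0" using h h0 unfolding a_def qform_scaleR by simp
    ultimately show "0 < (qform H a)\<^sup>2 * kq 2 a" by simp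
    show "0 \<le> (qform H z)\<^sup>2 * kq 2 z" for z by (simp add: kq2_nonneg)
  qed (intro qmoment_integrable continuous_intros qform_continuous kq_continuous)+
qed

text \<open>The constant is the minimum over the compact unit sphere of symmetric matrices,
  transferred to all of them by homogeneity of degree 2. Symmetry matters: antisymmetric matrices
  have zero quadratic form.\<close>

lemma qmoment_coercive:
  "\<exists>\<kappa>>0. \<forall>H::real^'n^'n. (\<forall>i j. H $ i $ j = H $ j $ i) \<longrightarrow> \<kappa> * (norm H)\<^sup>2 \<le> qmoment H"
proof -
  define S where "S = sphere 0 1 \<inter> {H::real^'n^'n. \<forall>i j. H $ i $ j = H $ j $ i}"
  have scale: "qmoment (r *\<^sub>R H) = r\<^sup>2 * qmoment H" for r and H :: "real^'n^'n"
  proof -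
    have "(qform (r *\<^sub>R H) z)\<^sup>2 * kq 2 z = r\<^sup>2 * ((qform H z)\<^sup>2 * kq 2 z)" for z
      by (simp add: qform_inner power_mult_distrib mult_ac)
    then show ?thesis unfolding qmoment_def by (simp only: integral_mult_right_zero)
  qed
  have "closed {H::real^'n^'n. \<forall>i j. H $ i $ j = H $ j $ i}"
    by (intro closed_Collect_all closed_Collect_eq continuous_intros)
  then have "compact S" unfolding S_def by (intro compact_Int_closed compact_sphere)
  \<comment> \<open>The normalised identity matrix witnesses that the set S is nonempty.\<close>
  have "(mat (1 / norm (mat 1 :: real^'n^'n)) :: real^'n^'n) = (1 / norm (mat 1 :: real^'n^'n)) *\<^sub>R mat 1"
    by (simp add: mat_def vec_eq_iff)
  moreover have "(mat 1 :: real^'n^'n) \<noteq> 0" by (simp add: mat_def vec_eq_iff exI[of _ undefined])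
  ultimately have "mat (1 / norm (mat 1 :: real^'n^'n)) \<in> S" by (auto simp: S_def mat_def)
  then have "S \<noteq> {}" by blast
  obtain H0 where H0: "H0 \<in> S" "\<And>H. H \<in> S \<Longrightarrow> qmoment H0 \<le> qmoment H"
    using continuous_attains_inf[OF \<open>compact S\<close> \<open>S \<noteq> {}\<close> qmoment_continuous] by blast
  have "0 < qmoment H0" using H0(1) by (intro qmoment_pos) (auto simp: S_def)
  moreover have "qmoment H0 * (norm H)\<^sup>2 \<le> qmoment H" if sym: "\<forall>i j. H $ i $ j = H $ j $ i" for H :: "real^'n^'n"
  proof (cases "H = 0")
    case True
    then show ?thesis using scale[of 0 H] by simp
  next
    case False
    have "(1 / norm H) *\<^sub>R H \<in> S" using False sym by (simp add: S_def)
    from H0(2)[OF this] have "qmoment H0 \<le> (1 / norm H)\<^sup>2 * qmoment H" by (simp only: scale)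
    then show ?thesis using False by (simp add: field_simps)
  qed
  ultimately show ?thesis by blast
qed

section \<open>Vector-valued solutions\<close>

definition comb :: "nat \<Rightarrow> (nat \<Rightarrow> real) \<Rightarrow> (real^'n \<Rightarrow> nat \<Rightarrow> real) \<Rightarrow> real^'n \<Rightarrow> real" where
  "comb m a u x = (\<Sum>i<m. a i * u x i)"

text \<open>Estimates for the scalar functions \<open>comb m a u\<close>, with \<open>a\<close> in the unit ball, give estimates for the
  Euclidean norm of \<open>u\<close> with constants that do not depend on \<open>m\<close>.\<close>

lemma L2_set_le_dual:
  assumes "\<And>a :: nat \<Rightarrow> real. (\<Sum>i<m. (a i)\<^sup>2) \<le> 1 \<Longrightarrow> (\<Sum>i<m. a i * v i) \<le> B"
  shows "L2_set v {..<m} \<le> B"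
proof (cases "L2_set v {..<m} = 0")
  case True
  then show ?thesis using assms[of "\<lambda>_. 0"] by simp
next
  case False
  define l where "l = L2_set v {..<m}"
  have l: "l > 0" using False L2_set_nonneg[of v "{..<m}"] unfolding l_def by linarith
  have sq: "(\<Sum>i<m. (v i)\<^sup>2) = l\<^sup>2" by (simp add: l_def L2_set_def sum_nonneg)
  have "(\<Sum>i<m. (v i / l)\<^sup>2) = (\<Sum>i<m. (v i)\<^sup>2) / l\<^sup>2"
    by (simp add: power_divide sum_divide_distrib)
  then have "(\<Sum>i<m. (v i / l)\<^sup>2) \<le> 1" using l by (simp add: sq)
  from assms[OF this] have "(\<Sum>i<m. v i / l * v i) \<le> B" .
  moreover have "(\<Sum>i<m. v i / l * v i) = (\<Sum>i<m. (v i)\<^sup>2) / l"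
    by (simp add: sum_divide_distrib power2_eq_square)
  moreover have "(\<Sum>i<m. (v i)\<^sup>2) / l = l" unfolding sq using l by (simp add: power2_eq_square)
  ultimately show ?thesis unfolding l_def[symmetric] by linarith
qed

lemma sum_mult_le_L2: "(\<Sum>i<m. a i * v i) \<le> L2_set a {..<m} * L2_set v {..<m}"
  by (rule order_trans[OF sum_mono L2_set_mult_ineq]) (simp add: abs_mult[symmetric])

lemma abs_sum_mult_le_L2: "\<bar>\<Sum>i<m. a i * v i\<bar> \<le> L2_set a {..<m} * L2_set v {..<m}"
  by (rule order_trans[OF sum_abs]) (simp add: abs_mult L2_set_mult_ineq)

lemma L2_set_sum_triangle:
  "finite A \<Longrightarrow> L2_set (\<lambda>k. \<Sum>i\<in>A. f k i) B \<le> (\<Sum>i\<in>A. L2_set (\<lambda>k. f k i) B)"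
proof (induction A rule: finite_induct)
  case (insert i A)
  have "L2_set (\<lambda>k. f k i + (\<Sum>i\<in>A. f k i)) B \<le> L2_set (\<lambda>k. f k i) B + L2_set (\<lambda>k. \<Sum>i\<in>A. f k i) B"
    by (rule L2_set_triangle_ineq)
  then show ?case using insert by simp
qed (simp add: L2_set_def)

lemma comb_le_L2: "(\<Sum>i<m. (a i)\<^sup>2) \<le> 1 \<Longrightarrow> \<bar>comb m a u x\<bar> \<le> L2_set (u x) {..<m}"
proof -
  assume "(\<Sum>i<m. (a i)\<^sup>2) \<le> 1"
  then have "L2_set a {..<m} \<le> 1" by (simp add: L2_set_def)
  then have "L2_set a {..<m} * L2_set (u x) {..<m} \<le> 1 * L2_set (u x) {..<m}"
    by (intro mult_right_mono) auto
  then show ?thesis unfolding comb_def using abs_sum_mult_le_L2[of a "u x" m] by simp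
qed

text \<open>One bound G for all functionals of norm at most 1 is the dual form of a bound on the
  Euclidean norm of g; bounding the components separately would lose a factor depending on
  m.\<close>

definition vpoisson :: "nat \<Rightarrow> (real^'n \<Rightarrow> nat \<Rightarrow> real) \<Rightarrow> (real^'n \<Rightarrow> nat \<Rightarrow> real) \<Rightarrow> real \<Rightarrow> bool" where
  "vpoisson m u g G \<longleftrightarrow> (\<forall>a. (\<Sum>i<m. (a i)\<^sup>2) \<le> 1 \<longrightarrow> poisson (comb m a u) (comb m a g) G)"

lemma comb_unit: "k < m \<Longrightarrow> comb m (\<lambda>i. of_bool (i = k)) u = (\<lambda>x. u x k)"
  unfolding comb_def by (rule ext, subst sum.remove[of _ k]) (auto intro!: sum.neutral)

lemma vpoisson_component:
  assumes "vpoisson m u g G" "k < m" shows "poisson (\<lambda>x. u x k) (\<lambda>x. g x k) G"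
proof -
  have "(\<Sum>i<m. (of_bool (i = k) :: real)\<^sup>2) = 1"
    using assms(2) by (subst sum.remove[of _ k]) (auto intro!: sum.neutral)
  then have "poisson (comb m (\<lambda>i. of_bool (i = k)) u) (comb m (\<lambda>i. of_bool (i = k)) g) G"
    using assms(1) unfolding vpoisson_def by simp
  then show ?thesis unfolding comb_unit[OF assms(2)] .
qed

lemma conv_comb:
  assumes f: "\<And>k. k < m \<Longrightarrow> (\<lambda>x. f x k) \<in> borel_measurable borel" and K: "bumpfn K"
    and M: "\<And>k y. k < m \<Longrightarrow> y \<in> cball x s \<Longrightarrow> \<bar>f y k\<bar> \<le> M k" and s: "0 \<le> s"
  shows "conv (comb m a f) K x s = (\<Sum>k<m. a k * conv (\<lambda>x. f x k) K x s)"
proof -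
  have "has_bochner_integral lborel (\<lambda>z. \<Sum>k<m. a k * (f (x + s *\<^sub>R z) k * K z)) (\<Sum>k<m. a k * conv (\<lambda>x. f x k) K x s)"
    by (intro has_bochner_integral_sum has_bochner_integral_mult_right conv_bump(1)[OF f K M s]) auto
  moreover have "comb m a f (x + s *\<^sub>R z) * K z = (\<Sum>k<m. a k * (f (x + s *\<^sub>R z) k * K z))" for z
    by (simp add: comb_def sum_distrib_right sum_distrib_left mult_ac)
  ultimately show ?thesis unfolding conv_def[of "comb m a f"] by (simp add: has_bochner_integral_iff)
qed

lemma vpoisson_conv_comb:
  assumes vp: "vpoisson m u g G" and K: "bumpfn K" and s: "0 \<le> s"
  shows "conv (comb m a g) K x s = (\<Sum>k<m. a k * conv (\<lambda>x. g x k) K x s)"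
    and "cball x s \<subseteq> ball 0 1 \<Longrightarrow> conv (comb m a u) K x s = (\<Sum>k<m. a k * conv (\<lambda>x. u x k) K x s)"
proof -
  have p: "\<And>k. k < m \<Longrightarrow> poisson (\<lambda>x. u x k) (\<lambda>x. g x k) G" using vpoisson_component[OF vp] .
  show "conv (comb m a g) K x s = (\<Sum>k<m. a k * conv (\<lambda>x. g x k) K x s)"
    by (rule conv_comb[OF _ K _ s, where M = "\<lambda>_. G"]) (use p in \<open>auto simp: poisson_def\<close>)
  assume sub: "cball x s \<subseteq> ball 0 1"
  have "\<exists>M. \<forall>k. k < m \<longrightarrow> (\<forall>y\<in>cball x s. \<bar>u y k\<bar> \<le> M k)"
  proof (intro choice allI)
    fix k show "\<exists>M. k < m \<longrightarrow> (\<forall>y\<in>cball x s. \<bar>u y k\<bar> \<le> M)"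
    proof (cases "k < m")
      case True
      obtain M where "\<And>y. y \<in> cball x s \<Longrightarrow> \<bar>u y k\<bar> \<le> M" using poisson_bounded[OF p[OF True] sub] by blast
      then show ?thesis by blast
    qed blast
  qed
  then obtain M where "\<And>k y. k < m \<Longrightarrow> y \<in> cball x s \<Longrightarrow> \<bar>u y k\<bar> \<le> M k" by blast
  then show "conv (comb m a u) K x s = (\<Sum>k<m. a k * conv (\<lambda>x. u x k) K x s)"
    by (intro conv_comb K s) (use p in \<open>auto simp: poisson_def\<close>)
qed

lemma L2_conv_g_bound:
  "\<exists>B>0. \<forall>m (u::real^'n \<Rightarrow> nat \<Rightarrow> real) g G x s. vpoisson m u g G \<longrightarrow> 0 \<le> s \<longrightarrow>
      L2_set (\<lambda>k. conv (\<lambda>x. g x k) eta x s) {..<m} \<le> G * B"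
proof -
  obtain B where B: "B > 0" "\<And>z::real^'n. \<bar>eta z\<bar> \<le> B" using bumpfn_bounded[OF bumpfn_eta] by blast
  have "L2_set (\<lambda>k. conv (\<lambda>x. g x k) eta x s) {..<m} \<le> G * (B * unit_vol TYPE('n))"
    if vp: "vpoisson m u g G" and s: "0 \<le> s" for m and u g :: "real^'n \<Rightarrow> nat \<Rightarrow> real" and G x s
  proof (rule L2_set_le_dual)
    fix a :: "nat \<Rightarrow> real" assume a: "(\<Sum>i<m. (a i)\<^sup>2) \<le> 1"
    then have p: "poisson (comb m a u) (comb m a g) G" using vp by (simp add: vpoisson_def)
    have "\<bar>conv (comb m a g) eta x s\<bar> \<le> G * B * unit_vol TYPE('n)"
      by (rule conv_bump(2)[OF _ bumpfn_eta]) (use p s B in \<open>auto simp: poisson_def\<close>)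
    then show "(\<Sum>i<m. a i * conv (\<lambda>x. g x i) eta x s) \<le> G * (B * unit_vol TYPE('n))"
      unfolding vpoisson_conv_comb(1)[OF vp bumpfn_eta s, symmetric] by simp
  qed
  moreover have "0 < B * unit_vol TYPE('n)" using B unit_vol_pos[where 'n='n] by simp
  ultimately show ?thesis by blast
qed

lemma hess_comb:
  assumes vp: "vpoisson m u g G" and s: "0 \<le> s" "cball x s \<subseteq> ball 0 1"
  shows "hess (comb m a u) x s = (\<Sum>k<m. a k *\<^sub>R hess (\<lambda>x. u x k) x s)"
  by (simp add: vec_eq_iff hess_def vpoisson_conv_comb(2)[OF vp bumpfn_eta2 s] sum_divide_distrib)

definition hess_norm :: "nat \<Rightarrow> (real^'n \<Rightarrow> nat \<Rightarrow> real) \<Rightarrow> real^'n \<Rightarrow> real \<Rightarrow> real" where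
  "hess_norm m u x R = L2_set (\<lambda>k. norm (hess (\<lambda>x. u x k) x R)) {..<m}"

lemma L2_qform_le: "L2_set (\<lambda>k. qform (hess (\<lambda>x. u x k) x R) h) {..<m} \<le> hess_norm m u x R * (norm h)\<^sup>2"
proof -
  have "L2_set (\<lambda>k. qform (hess (\<lambda>x. u x k) x R) h) {..<m} = L2_set (\<lambda>k. \<bar>qform (hess (\<lambda>x. u x k) x R) h\<bar>) {..<m}"
    by (simp add: L2_set_def)
  also have "\<dots> \<le> L2_set (\<lambda>k. norm (hess (\<lambda>x. u x k) x R) * (norm h)\<^sup>2) {..<m}"
    by (intro L2_set_mono abs_qform_le) auto
  finally show ?thesis by (simp add: hess_norm_def L2_set_left_distrib)
qed

text \<open>The expression under the norm is linear in u, so the scalar result for each combination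
  \<open>comb m a u\<close> bounds its pairing with a, and duality gives the norm with the same
  constant.\<close>

lemma vector_quadratic_approx:
  "\<exists>C>0. \<forall>m (u::real^'n \<Rightarrow> nat \<Rightarrow> real) g G S x h R R0. vpoisson m u g G \<longrightarrow> 0 < R \<longrightarrow> R \<le> R0 \<longrightarrow> cball x (2 * R0) \<subseteq> ball 0 1 \<longrightarrow>
     (\<forall>y\<in>cball x (2 * R0). L2_set (u y) {..<m} \<le> S) \<longrightarrow> (\<forall>k<m. u x k = 0) \<longrightarrow>
     (\<forall>k<m. ((\<lambda>y. u y k) has_derivative (\<lambda>_. 0)) (at x)) \<longrightarrow> norm h \<le> R \<longrightarrow>
     L2_set (\<lambda>k. 2 * mass TYPE('n) * u (x + h) k - qform (hess (\<lambda>x. u x k) x R) h) {..<m} \<le> C * (G + S / R0\<^sup>2) * R\<^sup>2"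
proof -
  obtain C where C: "C > 0" "\<And>(u::real^'n \<Rightarrow> real) g G S x h R R0. poisson u g G \<Longrightarrow> 0 < R \<Longrightarrow> R \<le> R0 \<Longrightarrow> cball x (2 * R0) \<subseteq> ball 0 1 \<Longrightarrow>
     \<forall>y\<in>cball x (2 * R0). \<bar>u y\<bar> \<le> S \<Longrightarrow> u x = 0 \<Longrightarrow> (u has_derivative (\<lambda>_. 0)) (at x) \<Longrightarrow> norm h \<le> R \<Longrightarrow>
     \<bar>2 * mass TYPE('n) * u (x + h) - qform (hess u x R) h\<bar> \<le> C * (G + S / R0\<^sup>2) * R\<^sup>2"
    using poisson_quadratic_approx by blast
  have "L2_set (\<lambda>k. 2 * mass TYPE('n) * u (x + h) k - qform (hess (\<lambda>x. u x k) x R) h) {..<m} \<le> C * (G + S / R0\<^sup>2) * R\<^sup>2"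
    if vp: "vpoisson m u g G" and R: "0 < R" "R \<le> R0" and sub: "cball x (2 * R0) \<subseteq> ball 0 1"
     and S: "\<forall>y\<in>cball x (2 * R0). L2_set (u y) {..<m} \<le> S" and u0: "\<forall>k<m. u x k = 0"
     and D: "\<forall>k<m. ((\<lambda>y. u y k) has_derivative (\<lambda>_. 0)) (at x)" and h: "norm h \<le> R"
    for m and u g :: "real^'n \<Rightarrow> nat \<Rightarrow> real" and G S x h R R0
  proof (rule L2_set_le_dual)
    fix a :: "nat \<Rightarrow> real" assume a: "(\<Sum>i<m. (a i)\<^sup>2) \<le> 1"
    then have p: "poisson (comb m a u) (comb m a g) G" using vp by (simp add: vpoisson_def)
    have "cball x R \<subseteq> ball 0 1" using sub R by auto
    note H = hess_comb[OF vp less_imp_le[OF R(1)] this, of a]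
    have "\<bar>2 * mass TYPE('n) * comb m a u (x + h) - qform (hess (comb m a u) x R) h\<bar> \<le> C * (G + S / R0\<^sup>2) * R\<^sup>2"
    proof (rule C(2)[OF p R sub _ _ _ h])
      show "\<forall>y\<in>cball x (2 * R0). \<bar>comb m a u y\<bar> \<le> S" using S comb_le_L2[OF a, of u] by (meson order_trans)
      show "comb m a u x = 0" using u0 by (simp add: comb_def)
      have "((\<lambda>y. \<Sum>k<m. a k * u y k) has_derivative (\<lambda>h. \<Sum>k<m. a k * 0)) (at x)"
        using D by (intro has_derivative_sum has_derivative_mult_right) auto
      then show "(comb m a u has_derivative (\<lambda>_. 0)) (at x)" by (simp add: comb_def[abs_def])
    qed
    moreover have "2 * mass TYPE('n) * comb m a u (x + h) - qform (hess (comb m a u) x R) h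
        = (\<Sum>k<m. a k * (2 * mass TYPE('n) * u (x + h) k - qform (hess (\<lambda>x. u x k) x R) h))"
      unfolding H qform_sum comb_def by (simp add: right_diff_distrib sum_subtractf sum_distrib_left mult_ac)
    ultimately show "(\<Sum>k<m. a k * (2 * mass TYPE('n) * u (x + h) k - qform (hess (\<lambda>x. u x k) x R) h)) \<le> C * (G + S / R0\<^sup>2) * R\<^sup>2"
      by linarith
  qed
  with C(1) show ?thesis by (intro exI[of _ C]) simp
qed

text \<open>A crude bound by the supremum of u, meant for the fixed top scale, where the descent to
  small scales begins. The triangle inequality is applied over the n^2 matrix entries and duality
  over the m components, which keeps B free of m.\<close>

lemma hess_norm_bound:
  "\<exists>B>0. \<forall>m (u::real^'n \<Rightarrow> nat \<Rightarrow> real) g G S x R. vpoisson m u g G \<longrightarrow> 0 < R \<longrightarrow> cball x R \<subseteq> ball 0 1 \<longrightarrow>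
     (\<forall>y\<in>cball x R. L2_set (u y) {..<m} \<le> S) \<longrightarrow> hess_norm m u x R \<le> B * S / R\<^sup>2"
proof -
  obtain B0 where "\<forall>p z. \<bar>case_prod eta2 p (z::real^'n)\<bar> \<le> B0"
    using bumpfn_family_bounded[of "case_prod eta2 :: 'n \<times> 'n \<Rightarrow> real^'n \<Rightarrow> real"] bumpfn_eta2 by (metis case_prod_unfold)
  then have B0: "\<bar>eta2 i j z\<bar> \<le> B0" for i j and z :: "real^'n" by force
  define V where "V = unit_vol TYPE('n)"
  define B where "B = real CARD('n) * real CARD('n) * ((\<bar>B0\<bar> + 1) * V)"
  have V: "V > 0" unfolding V_def by (rule unit_vol_pos)
  have "hess_norm m u x R \<le> B * S / R\<^sup>2"
    if vp: "vpoisson m u g G" and R: "0 < R" and sub: "cball x R \<subseteq> ball 0 1"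
      and S: "\<forall>y\<in>cball x R. L2_set (u y) {..<m} \<le> S" for m and u g :: "real^'n \<Rightarrow> nat \<Rightarrow> real" and G S x R
  proof -
    have S0: "0 \<le> S" 
    proof -
      have "L2_set (u x) {..<m} \<le> S" using S R by simp
      then show ?thesis using L2_set_nonneg[of "u x" "{..<m}"] by linarith
    qed
    define Hs where "Hs k i j = hess (\<lambda>x. u x k) x R $ i $ j" for k i j
    have comp: "L2_set (\<lambda>k. Hs k i j) {..<m} \<le> S * ((\<bar>B0\<bar> + 1) * V) / R\<^sup>2" for i j
    proof (rule L2_set_le_dual)
      fix a :: "nat \<Rightarrow> real" assume a: "(\<Sum>i<m. (a i)\<^sup>2) \<le> 1"
      then have p: "poisson (comb m a u) (comb m a g) G" using vp by (simp add: vpoisson_def)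
      have "\<bar>conv (comb m a u) (eta2 i j) x R\<bar> \<le> S * (\<bar>B0\<bar> + 1) * unit_vol TYPE('n)"
      proof (rule conv_bump(2)[OF _ bumpfn_eta2])
        show "comb m a u \<in> borel_measurable borel" using p by (simp add: poisson_def)
        show "\<bar>comb m a u y\<bar> \<le> S" if "y \<in> cball x R" for y using S that comb_le_L2[OF a, of u] by (meson order_trans)
        show "\<bar>eta2 i j z\<bar> \<le> \<bar>B0\<bar> + 1" for z using B0[of i j z] by simp
      qed (use R in simp)
      then have "conv (comb m a u) (eta2 i j) x R / R\<^sup>2 \<le> S * ((\<bar>B0\<bar> + 1) * V) / R\<^sup>2"
        using R by (intro divide_right_mono) (auto simp: V_def)
      then show "(\<Sum>k<m. a k * Hs k i j) \<le> S * ((\<bar>B0\<bar> + 1) * V) / R\<^sup>2"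
        using vpoisson_conv_comb(2)[OF vp bumpfn_eta2 less_imp_le[OF R] sub, of a i j]
        by (simp add: Hs_def hess_def sum_divide_distrib)
    qed
    have nle: "norm (hess (\<lambda>x. u x k) x R) \<le> (\<Sum>i\<in>UNIV. \<Sum>j\<in>UNIV. \<bar>Hs k i j\<bar>)" for k
      unfolding Hs_def
      by (rule order_trans[OF L2_set_le_sum_abs[of "\<lambda>i. norm (hess (\<lambda>x. u x k) x R $ i)" UNIV, folded norm_vec_def]])
         (auto intro!: sum_mono norm_le_l1_cart)
    have "hess_norm m u x R \<le> L2_set (\<lambda>k. \<Sum>i\<in>UNIV. \<Sum>j\<in>UNIV. \<bar>Hs k i j\<bar>) {..<m}"
      unfolding hess_norm_def by (rule L2_set_mono) (use nle in auto)
    also have "\<dots> \<le> (\<Sum>i\<in>UNIV. \<Sum>j\<in>UNIV. L2_set (\<lambda>k. \<bar>Hs k i j\<bar>) {..<m})"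
      by (rule order_trans[OF L2_set_sum_triangle sum_mono]) (auto intro: L2_set_sum_triangle)
    also have "\<dots> \<le> (\<Sum>i\<in>(UNIV::'n set). \<Sum>j\<in>(UNIV::'n set). S * ((\<bar>B0\<bar> + 1) * V) / R\<^sup>2)"
      by (intro sum_mono) (use comp in \<open>simp add: L2_set_def\<close>)
    also have "\<dots> = B * S / R\<^sup>2" by (simp add: B_def)
    finally show ?thesis .
  qed
  moreover have "B > 0" using V by (simp add: B_def)
  ultimately show ?thesis by (intro exI[of _ B]) simp
qed

section \<open>The evolution of the quadratic part under change of scale\<close>

lemma Lap_eta: "Lap eta z = (\<Sum>i\<in>UNIV. eta2 i i (z::real^'n))"
proof -
  have "Lap (\<lambda>z. 1 * kq 1 z) z = 0 * kq 1 z - 4 * kq (Suc 1) z * (z \<bullet> 0)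
     + 1 * (4 * (z \<bullet> z) * kq (Suc (Suc 1)) z - 2 * CARD('n) * kq (Suc 1) z)"
    by (rule Lap_mult_kq[where ?G2.0="\<lambda>_ _. 0"]) (auto simp: GD_const)
  moreover have "(\<lambda>z::real^'n. 1 * kq 1 z) = eta" by (simp add: eta_def fun_eq_iff)
  moreover have "(\<Sum>i\<in>UNIV. eta2 i i z) = - 2 * CARD('n) * kq 2 z + 4 * (z \<bullet> z) * kq 3 z"
    by (simp add: eta2_def sum.distrib sum_distrib_left sum_distrib_right inner_vec_def sum_negf sum_subtractf mult_ac)
  ultimately show ?thesis by (simp add: numeral_2_eq_2 numeral_3_eq_3)
qed

text \<open>The trace of the averaged Hessian is the average of the Laplacian. This controls the
  trace term produced by contracting with \<open>zeta2\<close>.\<close>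

lemma hess_trace:
  assumes po: "poisson u g G" and R: "0 < R" "cball x R \<subseteq> ball 0 1"
  shows "(\<Sum>i\<in>UNIV. hess u x R $ i $ i) = conv g eta x R"
proof -
  have u: "u \<in> borel_measurable borel" using po by (simp add: poisson_def)
  obtain M where M: "\<And>y. y \<in> cball x R \<Longrightarrow> \<bar>u y\<bar> \<le> M" using poisson_bounded[OF po R(2)] by blast
  have "has_bochner_integral lborel (\<lambda>z. \<Sum>i\<in>UNIV. u (x + R *\<^sub>R z) * eta2 i i z) (\<Sum>i\<in>UNIV. conv u (eta2 i i) x R)"
    by (intro has_bochner_integral_sum conv_bump(1)[OF u bumpfn_eta2 M]) (use R in auto)
  then have "conv u (Lap eta) x R = (\<Sum>i\<in>UNIV. conv u (eta2 i i) x R)"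
    unfolding conv_def[of u "Lap eta"] Lap_eta by (simp add: has_bochner_integral_iff sum_distrib_left)
  moreover have "conv u (Lap eta) x R = R\<^sup>2 * conv g eta x R"
    using po R unfolding poisson_def by (simp add: bumpfn_eta)
  ultimately have "(\<Sum>i\<in>UNIV. conv u (eta2 i i) x R) = R\<^sup>2 * conv g eta x R" by simp
  then show ?thesis using R(1) by (simp add: hess_def sum_divide_distrib[symmetric])
qed

text \<open>Contracting H with \<open>zeta2\<close> gives 2 \<open>kq 2\<close> times the quadratic
  form minus trace(H) times \<open>kq 1\<close>, and \<open>kq 1\<close> is \<open>eta\<close>.
  Solving for the first term isolates the nonnegative weight.\<close>

lemma conv_zeta2_contract:
  fixes g :: "real^'n \<Rightarrow> real"
  assumes g: "g \<in> borel_measurable borel" "\<And>y. \<bar>g y\<bar> \<le> G" and R: "0 < R"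
  shows "has_bochner_integral lborel (\<lambda>z. g (x + R *\<^sub>R z) * (qform H z * kq 2 z))
     (1/2 * ((\<Sum>i\<in>UNIV. \<Sum>j\<in>UNIV. H $ i $ j * conv g (zeta2 i j) x R) + (\<Sum>i\<in>UNIV. H $ i $ i) * conv g eta x R))"
proof -
  let ?g = "\<lambda>z. g (x + R *\<^sub>R z)"
  have "has_bochner_integral lborel
     (\<lambda>z. 1/2 * ((\<Sum>i\<in>UNIV. \<Sum>j\<in>UNIV. H $ i $ j * (?g z * zeta2 i j z)) + (\<Sum>i\<in>UNIV. H $ i $ i) * (?g z * eta z)))
     (1/2 * ((\<Sum>i\<in>UNIV. \<Sum>j\<in>UNIV. H $ i $ j * conv g (zeta2 i j) x R) + (\<Sum>i\<in>UNIV. H $ i $ i) * conv g eta x R))"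
    by (intro has_bochner_integral_sum has_bochner_integral_add has_bochner_integral_mult_right
        conv_bump(1)[OF g(1) bumpfn_zeta2 g(2)] conv_bump(1)[OF g(1) bumpfn_eta g(2)]) (use R in auto)
  moreover have "1/2 * ((\<Sum>i\<in>UNIV. \<Sum>j\<in>UNIV. H $ i $ j * (c * zeta2 i j z)) + (\<Sum>i\<in>UNIV. H $ i $ i) * (c * eta z))
      = c * (qform H z * kq 2 z)" for c z
  proof -
    have "(\<Sum>j\<in>UNIV. H $ i $ j * zeta2 i j z) = - kq 1 z * H $ i $ i + 2 * kq 2 z * (\<Sum>j\<in>UNIV. z $ i * z $ j * H $ i $ j)" for i
    proof -
      have "(\<Sum>j\<in>UNIV. H $ i $ j * (- of_bool (i = j) * kq 1 z)) = - kq 1 z * H $ i $ i"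
        by (subst sum.remove[of _ i]) (auto intro!: sum.neutral)
      then show ?thesis
        unfolding zeta2_def distrib_left sum.distrib by (simp add: sum_distrib_left mult_ac)
    qed
    then have 1: "(\<Sum>i\<in>UNIV. \<Sum>j\<in>UNIV. H $ i $ j * zeta2 i j z) = - kq 1 z * (\<Sum>i\<in>UNIV. H $ i $ i) + 2 * kq 2 z * qform H z"
      unfolding qform_def by (simp only: sum.distrib sum_distrib_left)
    have 2: "(\<Sum>i\<in>UNIV. \<Sum>j\<in>UNIV. H $ i $ j * (c * zeta2 i j z)) = c * (\<Sum>i\<in>UNIV. \<Sum>j\<in>UNIV. H $ i $ j * zeta2 i j z)"
      by (simp add: sum_distrib_left mult_ac)
    show ?thesis unfolding 2 1 eta_def by (simp add: field_simps)
  qed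
  ultimately show ?thesis by simp
qed

lemma hess_norm_sq: "(hess_norm m u x R)\<^sup>2 = (\<Sum>k<m. \<Sum>i\<in>UNIV. \<Sum>j\<in>UNIV. (hess (\<lambda>x. u x k) x R $ i $ j)\<^sup>2)"
proof -
  have "(norm H)\<^sup>2 = (\<Sum>i\<in>UNIV. \<Sum>j\<in>UNIV. (H $ i $ j)\<^sup>2)" for H :: "real^'a^'a"
    unfolding power2_norm_eq_inner by (simp add: inner_vec_def power2_eq_square)
  then show ?thesis by (simp add: hess_norm_def L2_set_def sum_nonneg)
qed

text \<open>Each squared entry differentiates to 2 H_ij times the average of g against
  \<open>zeta2 i j\<close>, divided by R. After the contraction, the product of trace(H) with the
  eta average of g is a square, by \<open>hess_trace\<close>; it is bounded independently of the
  size of H.\<close>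

lemma hess_norm_deriv:
  assumes vp: "vpoisson m u g G" and R: "0 < R" "cball x R \<subseteq> ball 0 1"
  shows "((\<lambda>R. (hess_norm m u x R)\<^sup>2) has_real_derivative
     2 / R * (2 * (\<Sum>k<m. conv (\<lambda>x. g x k) (\<lambda>z. qform (hess (\<lambda>x. u x k) x R) z * kq 2 z) x R)
       - (\<Sum>k<m. (conv (\<lambda>x. g x k) eta x R)\<^sup>2))) (at R)"
proof -
  define H where "H k = hess (\<lambda>x. u x k) x R" for k
  define gk where "gk k = (\<lambda>x. g x k)" for k
  have p: "poisson (\<lambda>x. u x k) (gk k) G" if "k < m" for k using vpoisson_component[OF vp that] by (simp add: gk_def)
  have D: "((\<lambda>R. (hess (\<lambda>x. u x k) x R $ i $ j)\<^sup>2) has_real_derivative 2 * H k $ i $ j * (conv (gk k) (zeta2 i j) x R / R)) (at R)"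
    if "k < m" for k i j
    using DERIV_power[OF deriv_eta2[OF p[OF that] R, of i j], of 2] by (simp add: hess_def H_def mult_ac)
  have "((\<lambda>R. (hess_norm m u x R)\<^sup>2) has_real_derivative
     (\<Sum>k<m. \<Sum>i\<in>UNIV. \<Sum>j\<in>UNIV. 2 * H k $ i $ j * (conv (gk k) (zeta2 i j) x R / R))) (at R)"
    unfolding hess_norm_sq by (intro DERIV_sum D) auto
  also have "(\<Sum>k<m. \<Sum>i\<in>UNIV. \<Sum>j\<in>UNIV. 2 * H k $ i $ j * (conv (gk k) (zeta2 i j) x R / R))
     = (\<Sum>k<m. 2 / R * (2 * conv (gk k) (\<lambda>z. qform (H k) z * kq 2 z) x R - (conv (gk k) eta x R)\<^sup>2))"
  proof (rule sum.cong[OF refl])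
    fix k assume "k \<in> {..<m}"
    then have k: "k < m" by simp
    have g: "gk k \<in> borel_measurable borel" "\<And>y. \<bar>gk k y\<bar> \<le> G" using p[OF k] by (auto simp: poisson_def)
    have tr: "(\<Sum>i\<in>UNIV. H k $ i $ i) = conv (gk k) eta x R" unfolding H_def by (rule hess_trace[OF p[OF k] R])
    have "conv (gk k) (\<lambda>z. qform (H k) z * kq 2 z) x R =
      1/2 * ((\<Sum>i\<in>UNIV. \<Sum>j\<in>UNIV. H k $ i $ j * conv (gk k) (zeta2 i j) x R) + conv (gk k) eta x R * conv (gk k) eta x R)"
      using conv_zeta2_contract[OF g R(1), of x "H k"] unfolding tr by (simp add: conv_def has_bochner_integral_iff)
    then have "(\<Sum>i\<in>UNIV. \<Sum>j\<in>UNIV. H k $ i $ j * conv (gk k) (zeta2 i j) x R)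
       = 2 * conv (gk k) (\<lambda>z. qform (H k) z * kq 2 z) x R - (conv (gk k) eta x R)\<^sup>2"
      by (simp add: power2_eq_square)
    moreover have "(\<Sum>i\<in>UNIV. \<Sum>j\<in>UNIV. 2 * H k $ i $ j * (conv (gk k) (zeta2 i j) x R / R))
      = 2 / R * (\<Sum>i\<in>UNIV. \<Sum>j\<in>UNIV. H k $ i $ j * conv (gk k) (zeta2 i j) x R)"
      by (simp add: sum_distrib_left mult_ac)
    ultimately show "(\<Sum>i\<in>UNIV. \<Sum>j\<in>UNIV. 2 * H k $ i $ j * (conv (gk k) (zeta2 i j) x R / R))
      = 2 / R * (2 * conv (gk k) (\<lambda>z. qform (H k) z * kq 2 z) x R - (conv (gk k) eta x R)\<^sup>2)" by simp
  qed
  also have "\<dots> = 2 / R * (2 * (\<Sum>k<m. conv (gk k) (\<lambda>z. qform (H k) z * kq 2 z) x R) - (\<Sum>k<m. (conv (gk k) eta x R)\<^sup>2))"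
    unfolding sum_distrib_left[symmetric] sum_subtractf ..
  finally show ?thesis by (simp add: H_def gk_def)
qed

text \<open>R^2 q is M U up to the error e, so R^2 (g . q) is M (g . U) - g . e, and coercivity
  bounds it from below by c R^2 |q| up to O(R^2). Multiplying by s \<ge> |q| turns |q| into |q|^2,
  whose weighted integral is a sum of \<open>qmoment\<close> values.\<close>

lemma coercive_pointwise:
  fixes q e g U :: "nat \<Rightarrow> real"
  assumes R: "0 < R" and M: "0 < M" and c: "0 \<le> c" and K: "0 \<le> K" and s: "0 \<le> s"
    and e: "\<And>k. k < m \<Longrightarrow> e k = M * U k - R\<^sup>2 * q k" and eK: "L2_set e {..<m} \<le> K * R\<^sup>2"
    and g: "L2_set g {..<m} \<le> G" and gU: "c * L2_set U {..<m} \<le> (\<Sum>k<m. g k * U k)"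
    and qs: "L2_set q {..<m} \<le> s"
  shows "c * (\<Sum>k<m. (q k)\<^sup>2) - (c + G) * K * s \<le> s * (\<Sum>k<m. g k * q k)"
proof -
  let ?N = "\<lambda>f. L2_set f {..<m}"
  have G: "0 \<le> G" using g L2_set_nonneg[of g "{..<m}"] by linarith
  have R2: "0 < R\<^sup>2" using R by simp
  have ge: "(\<Sum>k<m. g k * e k) \<le> G * (K * R\<^sup>2)"
    by (rule order_trans[OF sum_mult_le_L2]) (intro mult_mono g eK G L2_set_nonneg)
  have "(\<Sum>k<m. g k * e k) = M * (\<Sum>k<m. g k * U k) - R\<^sup>2 * (\<Sum>k<m. g k * q k)"
    by (simp add: e sum_distrib_left sum_subtractf[symmetric] algebra_simps)
  with ge have 1: "M * (\<Sum>k<m. g k * U k) - G * (K * R\<^sup>2) \<le> R\<^sup>2 * (\<Sum>k<m. g k * q k)" by linarith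
  have "R\<^sup>2 * ?N q = ?N (\<lambda>k. R\<^sup>2 * q k)" by (simp add: L2_set_right_distrib)
  also have "\<dots> = ?N (\<lambda>k. M * U k + - e k)" by (rule L2_set_cong) (auto simp: e)
  also have "\<dots> \<le> ?N (\<lambda>k. M * U k) + ?N (\<lambda>k. - e k)" by (rule L2_set_triangle_ineq)
  also have "\<dots> = M * ?N U + ?N e"
  proof -
    have "?N (\<lambda>k. - e k) = ?N e" by (simp add: L2_set_def)
    then show ?thesis using M L2_set_right_distrib[of M U "{..<m}"] by simp
  qed
  finally have "R\<^sup>2 * ?N q \<le> M * ?N U + K * R\<^sup>2" using eK by linarith
  then have "c * (R\<^sup>2 * ?N q) \<le> c * (M * ?N U + K * R\<^sup>2)" using c by (rule mult_left_mono)
  moreover have "M * (c * ?N U) \<le> M * (\<Sum>k<m. g k * U k)" using gU M by simp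
  ultimately have "c * (R\<^sup>2 * ?N q) - c * (K * R\<^sup>2) - G * (K * R\<^sup>2) \<le> R\<^sup>2 * (\<Sum>k<m. g k * q k)"
    using 1 by (simp add: algebra_simps)
  then have "R\<^sup>2 * (c * ?N q - (c + G) * K) \<le> R\<^sup>2 * (\<Sum>k<m. g k * q k)" by (simp add: algebra_simps)
  then have 2: "c * ?N q - (c + G) * K \<le> (\<Sum>k<m. g k * q k)" using R2 by (simp only: mult_le_cancel_left_pos)
  have "(\<Sum>k<m. (q k)\<^sup>2) = ?N q * ?N q"
    using L2_set_def[of q "{..<m}"] by (simp add: sum_nonneg)
  also have "\<dots> \<le> s * ?N q" by (intro mult_right_mono qs L2_set_nonneg)
  finally have "c * (\<Sum>k<m. (q k)\<^sup>2) \<le> c * (s * ?N q)" using c by (rule mult_left_mono)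
  moreover have "s * (c * ?N q - (c + G) * K) \<le> s * (\<Sum>k<m. g k * q k)" using 2 s by (rule mult_left_mono)
  ultimately show ?thesis by (simp add: algebra_simps)
qed

text \<open>The bound is carried from the larger argument to the smaller one: above the level T the
  function increases, so it cannot start above T at a and be at most T at b.\<close>

lemma barrier:
  fixes f f' :: "real \<Rightarrow> real"
  assumes ab: "a \<le> b" and D: "\<And>t. a \<le> t \<Longrightarrow> t \<le> b \<Longrightarrow> (f has_real_derivative f' t) (at t)"
    and pos: "\<And>t. a \<le> t \<Longrightarrow> t \<le> b \<Longrightarrow> T < f t \<Longrightarrow> 0 < f' t" and fb: "f b \<le> T"
  shows "f a \<le> T"
proof (rule ccontr)
  assume fa: "\<not> f a \<le> T"
  have cont: "continuous_on {a..b} f"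
    using DERIV_isCont[OF D] by (intro continuous_at_imp_continuous_on) simp
  define S where "S = {a..b} \<inter> f -` {..T}"
  have "closed S" unfolding S_def by (intro continuous_closed_preimage cont) auto
  then have "compact S" unfolding S_def using compact_Icc[of a b] by (metis closed_Int_compact Int_left_absorb Int_commute compact_Int_closed)
  moreover have "S \<noteq> {}" using ab fb by (auto simp: S_def)
  ultimately obtain t0 where t0: "t0 \<in> S" "\<And>t. t \<in> S \<Longrightarrow> t0 \<le> t"
    using compact_attains_inf[of S] by blast
  have "a < t0" using t0(1) fa by (cases "a = t0") (auto simp: S_def)
  then obtain \<xi> where \<xi>: "a < \<xi>" "\<xi> < t0" "f t0 - f a = (t0 - a) * f' \<xi>"
    using MVT2[of a t0 f f'] D t0(1) by (auto simp: S_def)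
  then have "\<xi> \<notin> S" using t0(2)[of \<xi>] by auto
  then have "T < f \<xi>" using \<xi> t0(1) by (auto simp: S_def)
  then have "0 < f' \<xi>" using \<xi> t0(1) by (intro pos) (auto simp: S_def)
  then have "f a < f t0" using \<xi> \<open>a < t0\<close> by (metis diff_gt_0_iff_gt mult_pos_pos)
  then show False using fa t0(1) by (auto simp: S_def)
qed

section \<open>Quadratic growth\<close>

definition coercive :: "nat \<Rightarrow> real \<Rightarrow> (real^'n \<Rightarrow> nat \<Rightarrow> real) \<Rightarrow> (real^'n \<Rightarrow> nat \<Rightarrow> real) \<Rightarrow> bool" where
  "coercive m c u g \<longleftrightarrow> (\<forall>y\<in>ball 0 1. c * L2_set (u y) {..<m} \<le> (\<Sum>k<m. g y k * u y k))"

lemma vpoisson_L2_g_le: "vpoisson m u g G \<Longrightarrow> L2_set (g y) {..<m} \<le> G"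
proof (rule L2_set_le_dual)
  fix a :: "nat \<Rightarrow> real" assume "vpoisson m u g G" "(\<Sum>i<m. (a i)\<^sup>2) \<le> 1"
  then have "\<bar>comb m a g y\<bar> \<le> G" by (simp add: vpoisson_def poisson_def)
  then show "(\<Sum>i<m. a i * g y i) \<le> G" by (simp add: comb_def)
qed

lemma kq2_integrable: "integrable lborel (kq 2)"
  by (rule continuous_unit_supp_integrable[OF kq_continuous kq_out])

lemma hess_sym: "hess u x R $ i $ j = hess u x R $ j $ i"
proof -
  have "eta2 i j = eta2 j i" by (auto simp: eta2_def fun_eq_iff mult.commute)
  then show ?thesis by (simp add: hess_def)
qed

text \<open>The pointwise inequality at z, read at x + R z, is multiplied by the weight
  \<open>kq 2\<close> and integrated. Both sides keep the factor \<open>hess_norm\<close> from that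
  inequality; it can be cancelled once it is positive.\<close>

lemma growth_integral_bound:
  fixes u g :: "real^'n \<Rightarrow> nat \<Rightarrow> real"
  assumes vp: "vpoisson m u g G" and co: "coercive m c u g" and c: "0 \<le> c" and K: "0 \<le> K"
    and R: "0 < R" "cball x R \<subseteq> ball 0 1"
    and approx: "\<And>h. norm h \<le> R \<Longrightarrow>
      L2_set (\<lambda>k. 2 * mass TYPE('n) * u (x + h) k - qform (hess (\<lambda>x. u x k) x R) h) {..<m} \<le> K * R\<^sup>2"
    and \<kappa>: "\<And>H::real^'n^'n. (\<And>i j. H $ i $ j = H $ j $ i) \<Longrightarrow> \<kappa> * (norm H)\<^sup>2 \<le> qmoment H"
  shows "c * (\<kappa> * (hess_norm m u x R)\<^sup>2) - (c + G) * K * hess_norm m u x R * (LINT z|lborel. kq 2 (z::real^'n))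
     \<le> hess_norm m u x R * (\<Sum>k<m. conv (\<lambda>x. g x k) (\<lambda>z. qform (hess (\<lambda>x. u x k) x R) z * kq 2 z) x R)"
proof -
  define H where "H k = hess (\<lambda>x. u x k) x R" for k
  define s where "s = hess_norm m u x R"
  have s0: "0 \<le> s" by (simp add: s_def hess_norm_def)
  have s2: "s\<^sup>2 = (\<Sum>k<m. (norm (H k))\<^sup>2)" by (simp add: s_def hess_norm_def L2_set_def sum_nonneg H_def)
  have p: "\<And>k. k < m \<Longrightarrow> poisson (\<lambda>x. u x k) (\<lambda>x. g x k) G" using vpoisson_component[OF vp] .
  have int: "integrable lborel (\<lambda>z. g (x + R *\<^sub>R z) k * (qform (H k) z * kq 2 z))" if "k < m" for k
    using conv_zeta2_contract[of "\<lambda>x. g x k" G R x "H k"] p[OF that] R by (simp add: poisson_def has_bochner_integral_iff)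
  have hb1: "has_bochner_integral lborel (\<lambda>z. s * (\<Sum>k<m. g (x + R *\<^sub>R z) k * (qform (H k) z * kq 2 z)))
     (s * (\<Sum>k<m. conv (\<lambda>x. g x k) (\<lambda>z. qform (H k) z * kq 2 z) x R))"
    unfolding conv_def
    by (intro has_bochner_integral_mult_right has_bochner_integral_sum has_bochner_integral_integrable int) auto
  have hb2: "has_bochner_integral lborel (\<lambda>z. c * (\<Sum>k<m. (qform (H k) z)\<^sup>2 * kq 2 z) - (c + G) * K * s * kq 2 z)
     (c * (\<Sum>k<m. qmoment (H k)) - (c + G) * K * s * (LINT z|lborel. kq 2 (z::real^'n)))"
    unfolding qmoment_def
    by (intro has_bochner_integral_diff has_bochner_integral_mult_right has_bochner_integral_sum
        has_bochner_integral_integrable kq2_integrable qmoment_integrable)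
  have le: "c * (\<Sum>k<m. (qform (H k) z)\<^sup>2 * kq 2 z) - (c + G) * K * s * kq 2 z
      \<le> s * (\<Sum>k<m. g (x + R *\<^sub>R z) k * (qform (H k) z * kq 2 z))" for z
  proof (cases "norm z < 1")
    case False
    then show ?thesis by (simp add: kq_out)
  next
    case True
    define h where "h = R *\<^sub>R z"
    have h: "norm h \<le> R" using True R by (simp add: h_def mult_left_le)
    have xh: "x + h \<in> ball 0 1" using subsetD[OF R(2), of "x + h"] h by (simp add: dist_norm)
    have "c * (\<Sum>k<m. (qform (H k) z)\<^sup>2) - (c + G) * K * s \<le> s * (\<Sum>k<m. g (x + h) k * qform (H k) z)"
    proof (rule coercive_pointwise[where M = "2 * mass TYPE('n)" and U = "u (x + h)" and R = R
          and e = "\<lambda>k. 2 * mass TYPE('n) * u (x + h) k - qform (H k) h"])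
      show "2 * mass TYPE('n) * u (x + h) k - qform (H k) h = 2 * mass TYPE('n) * u (x + h) k - R\<^sup>2 * qform (H k) z" for k
        by (simp add: h_def qform_scaleR)
      show "L2_set (\<lambda>k. 2 * mass TYPE('n) * u (x + h) k - qform (H k) h) {..<m} \<le> K * R\<^sup>2"
        unfolding H_def by (rule approx[OF h])
      show "L2_set (g (x + h)) {..<m} \<le> G" by (rule vpoisson_L2_g_le[OF vp])
      show "c * L2_set (u (x + h)) {..<m} \<le> (\<Sum>k<m. g (x + h) k * u (x + h) k)"
        using co xh unfolding coercive_def by blast
      have "L2_set (\<lambda>k. qform (H k) z) {..<m} \<le> s * (norm z)\<^sup>2" unfolding H_def s_def by (rule L2_qform_le)
      also have "\<dots> \<le> s * 1" using True s0 by (intro mult_left_mono) (auto simp: power_le_one)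
      finally show "L2_set (\<lambda>k. qform (H k) z) {..<m} \<le> s" by simp
    qed (use R c K s0 mass_pos[where 'n='n] in auto)
    then have "(c * (\<Sum>k<m. (qform (H k) z)\<^sup>2) - (c + G) * K * s) * kq 2 z \<le> (s * (\<Sum>k<m. g (x + h) k * qform (H k) z)) * kq 2 z"
      by (rule mult_right_mono[OF _ kq2_nonneg])
    then show ?thesis by (simp add: h_def sum_distrib_right left_diff_distrib mult.assoc)
  qed
  have "c * (\<Sum>k<m. qmoment (H k)) - (c + G) * K * s * (LINT z|lborel. kq 2 (z::real^'n))
     \<le> s * (\<Sum>k<m. conv (\<lambda>x. g x k) (\<lambda>z. qform (H k) z * kq 2 z) x R)"
    using Bochner_Integration.integral_mono[OF integrable.intros[OF hb2] integrable.intros[OF hb1] le]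
    by (simp only: has_bochner_integral_integral_eq[OF hb1] has_bochner_integral_integral_eq[OF hb2])
  moreover have "c * (\<kappa> * s\<^sup>2) \<le> c * (\<Sum>k<m. qmoment (H k))"
    unfolding s2 sum_distrib_left[of \<kappa>] using c
    by (intro mult_left_mono sum_mono \<kappa>) (auto simp: H_def hess_sym)
  ultimately show ?thesis unfolding s_def H_def by linarith
qed

lemma quadratic_growth:
  fixes c G S R0 :: real
  assumes c: "0 < c" and G: "0 \<le> G" and S: "0 \<le> S" and R0: "0 < R0"
  shows "\<exists>C>0. \<forall>m (u::real^'n \<Rightarrow> nat \<Rightarrow> real) g x h R. vpoisson m u g G \<longrightarrow> coercive m c u g \<longrightarrow>
     cball x (2 * R0) \<subseteq> ball 0 1 \<longrightarrow> (\<forall>y\<in>cball x (2 * R0). L2_set (u y) {..<m} \<le> S) \<longrightarrow> (\<forall>k<m. u x k = 0) \<longrightarrow>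
     (\<forall>k<m. ((\<lambda>y. u y k) has_derivative (\<lambda>_. 0)) (at x)) \<longrightarrow> 0 < R \<longrightarrow> R \<le> R0 \<longrightarrow> norm h \<le> R \<longrightarrow>
     L2_set (u (x + h)) {..<m} \<le> C * R\<^sup>2"
proof -
  obtain C1 where C1: "C1 > 0" "\<And>m (u::real^'n \<Rightarrow> nat \<Rightarrow> real) g G S x h R R0. vpoisson m u g G \<Longrightarrow> 0 < R \<Longrightarrow> R \<le> R0 \<Longrightarrow> cball x (2 * R0) \<subseteq> ball 0 1 \<Longrightarrow>
     \<forall>y\<in>cball x (2 * R0). L2_set (u y) {..<m} \<le> S \<Longrightarrow> \<forall>k<m. u x k = 0 \<Longrightarrow>
     \<forall>k<m. ((\<lambda>y. u y k) has_derivative (\<lambda>_. 0)) (at x) \<Longrightarrow> norm h \<le> R \<Longrightarrow>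
     L2_set (\<lambda>k. 2 * mass TYPE('n) * u (x + h) k - qform (hess (\<lambda>x. u x k) x R) h) {..<m} \<le> C1 * (G + S / R0\<^sup>2) * R\<^sup>2"
    using vector_quadratic_approx by blast
  obtain B1 where B1: "B1 > 0" "\<And>m (u::real^'n \<Rightarrow> nat \<Rightarrow> real) g G x s. vpoisson m u g G \<Longrightarrow> 0 \<le> s \<Longrightarrow>
      L2_set (\<lambda>k. conv (\<lambda>x. g x k) eta x s) {..<m} \<le> G * B1"
    using L2_conv_g_bound by blast
  obtain B2 where B2: "B2 > 0" "\<And>m (u::real^'n \<Rightarrow> nat \<Rightarrow> real) g G S x R. vpoisson m u g G \<Longrightarrow> 0 < R \<Longrightarrow> cball x R \<subseteq> ball 0 1 \<Longrightarrow>
     \<forall>y\<in>cball x R. L2_set (u y) {..<m} \<le> S \<Longrightarrow> hess_norm m u x R \<le> B2 * S / R\<^sup>2"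
    using hess_norm_bound by blast
  obtain \<kappa> where \<kappa>: "\<kappa> > 0" "\<And>H::real^'n^'n. (\<And>i j. H $ i $ j = H $ j $ i) \<Longrightarrow> \<kappa> * (norm H)\<^sup>2 \<le> qmoment H"
    using qmoment_coercive by blast
  define W where "W = (LINT z|lborel. kq 2 (z::real^'n))"
  have W: "0 \<le> W" unfolding W_def by (intro integral_nonneg_AE AE_I2 kq2_nonneg)
  define K where "K = C1 * (G + S / R0\<^sup>2)"
  have K: "0 \<le> K" using C1 G S by (simp add: K_def)
  define M where "M = mass TYPE('n)"
  have M: "0 < M" unfolding M_def by (rule mass_pos)
  \<comment> \<open>The threshold for the barrier: it solves 2 c \<kappa> M0 = 2 (c + G) K W + (G
    B1)^2, so the derivative of the squared norm is positive as soon as the norm exceeds M0.\<close>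
  define M0 where "M0 = (2 * ((c + G) * K * W) + (G * B1)\<^sup>2) / (2 * c * \<kappa>)"
  have M0: "0 \<le> M0" using c G K W \<kappa> by (simp add: M0_def)
  \<comment> \<open>The level must also dominate the squared norm at the top scale R0, from which
    the barrier argument descends.\<close>
  define T where "T = max (M0\<^sup>2) ((B2 * S / R0\<^sup>2)\<^sup>2)"
  \<comment> \<open>Dividing 2 M |u| \<le> (K + sqrt T) R^2 by 2 M gives the constant; the summand 1
    ensures that C is positive.\<close>
  define C where "C = (sqrt T + K + 1) / (2 * M)"
  have T0: "0 \<le> T" by (simp add: T_def le_max_iff_disj)
  have "L2_set (u (x + h)) {..<m} \<le> C * R\<^sup>2"
    if vp: "vpoisson m u g G" and co: "coercive m c u g" and sub: "cball x (2 * R0) \<subseteq> ball 0 1"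
      and Sb: "\<forall>y\<in>cball x (2 * R0). L2_set (u y) {..<m} \<le> S" and u0: "\<forall>k<m. u x k = 0"
      and D: "\<forall>k<m. ((\<lambda>y. u y k) has_derivative (\<lambda>_. 0)) (at x)" and R: "0 < R" "R \<le> R0" and h: "norm h \<le> R"
    for m and u g :: "real^'n \<Rightarrow> nat \<Rightarrow> real" and x h R
  proof -
    define s where "s t = hess_norm m u x t" for t
    have s0: "0 \<le> s t" for t by (simp add: s_def hess_norm_def)
    have approx: "L2_set (\<lambda>k. 2 * mass TYPE('n) * u (x + h) k - qform (hess (\<lambda>x. u x k) x t) h) {..<m} \<le> K * t\<^sup>2"
      if "0 < t" "t \<le> R0" "norm h \<le> t" for t h
      unfolding K_def by (rule C1(2)[OF vp that(1,2) sub Sb u0 D that(3)])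
    have "(s R)\<^sup>2 \<le> T"
    proof (rule barrier[where f = "\<lambda>t. (s t)\<^sup>2", OF R(2)])
      fix t assume "R \<le> t" "t \<le> R0"
      then have t: "0 < t" "t \<le> R0" and b: "cball x t \<subseteq> ball 0 1" using R sub by auto
      define X where "X = (\<Sum>k<m. conv (\<lambda>x. g x k) (\<lambda>z. qform (hess (\<lambda>x. u x k) x t) z * kq 2 z) x t)"
      define Y where "Y = (\<Sum>k<m. (conv (\<lambda>x. g x k) eta x t)\<^sup>2)"
      show "((\<lambda>t. (s t)\<^sup>2) has_real_derivative 2 / t * (2 * (\<Sum>k<m. conv (\<lambda>x. g x k) (\<lambda>z. qform (hess (\<lambda>x. u x k) x t) z * kq 2 z) x t)
          - (\<Sum>k<m. (conv (\<lambda>x. g x k) eta x t)\<^sup>2))) (at t)"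
        unfolding s_def by (rule hess_norm_deriv[OF vp t(1) b])
      assume "T < (s t)\<^sup>2"
      then have "M0\<^sup>2 < (s t)\<^sup>2" by (simp add: T_def)
      then have s: "M0 < s t" by (rule power_less_imp_less_base[OF _ s0])
      have "c * (\<kappa> * (s t)\<^sup>2) - (c + G) * K * s t * W \<le> s t * X"
        unfolding s_def W_def X_def
        by (rule growth_integral_bound[OF vp co _ K t(1) b approx[OF t] \<kappa>(2)]) (use c in auto)
      then have "s t * (c * \<kappa> * s t - (c + G) * K * W) \<le> s t * X" by (simp add: algebra_simps power2_eq_square)
      \<comment> \<open>Since M0 \<ge> 0, s t is positive here and can be cancelled.\<close>
      then have X: "c * \<kappa> * s t - (c + G) * K * W \<le> X" using s M0 by simp
      have "Y = (L2_set (\<lambda>k. conv (\<lambda>x. g x k) eta x t) {..<m})\<^sup>2"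
        by (simp add: Y_def L2_set_def sum_nonneg)
      also have "\<dots> \<le> (G * B1)\<^sup>2" using t by (intro power_mono B1(2)[OF vp]) auto
      finally have Y: "Y \<le> (G * B1)\<^sup>2" .
      have "M0 * (2 * c * \<kappa>) < s t * (2 * c * \<kappa>)" using s c \<kappa> by simp
      moreover have "M0 * (2 * c * \<kappa>) = 2 * ((c + G) * K * W) + (G * B1)\<^sup>2"
        using c \<kappa>(1) by (simp add: M0_def)
      moreover have "s t * (2 * c * \<kappa>) = 2 * (c * \<kappa> * s t)" by simp
      ultimately have "2 * ((c + G) * K * W) + (G * B1)\<^sup>2 < 2 * (c * \<kappa> * s t)" by argo
      with X Y have "0 < 2 * X - Y" by argo
      then show "0 < 2 / t * (2 * (\<Sum>k<m. conv (\<lambda>x. g x k) (\<lambda>z. qform (hess (\<lambda>x. u x k) x t) z * kq 2 z) x t)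
          - (\<Sum>k<m. (conv (\<lambda>x. g x k) eta x t)\<^sup>2))"
        unfolding X_def Y_def using t by simp
    next
      have "cball x R0 \<subseteq> cball x (2 * R0)" using R0 by auto
      then have "s R0 \<le> B2 * S / R0\<^sup>2"
        unfolding s_def using sub Sb by (intro B2(2)[OF vp R0]) blast+
      then have "(s R0)\<^sup>2 \<le> (B2 * S / R0\<^sup>2)\<^sup>2" using s0 by (rule power_mono)
      then show "(s R0)\<^sup>2 \<le> T" by (simp add: T_def)
    qed
    then have sT: "s R \<le> sqrt T" by (rule real_le_rsqrt)
    have "L2_set (\<lambda>k. 2 * M * u (x + h) k) {..<m} =
       L2_set (\<lambda>k. (2 * M * u (x + h) k - qform (hess (\<lambda>x. u x k) x R) h) + qform (hess (\<lambda>x. u x k) x R) h) {..<m}"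
      by simp
    also have "\<dots> \<le> L2_set (\<lambda>k. 2 * M * u (x + h) k - qform (hess (\<lambda>x. u x k) x R) h) {..<m}
        + L2_set (\<lambda>k. qform (hess (\<lambda>x. u x k) x R) h) {..<m}"
      by (rule L2_set_triangle_ineq)
    also have "\<dots> \<le> K * R\<^sup>2 + s R * (norm h)\<^sup>2"
      unfolding M_def s_def by (intro add_mono approx R h L2_qform_le)
    also have "s R * (norm h)\<^sup>2 \<le> sqrt T * R\<^sup>2"
      using sT s0 h T0 by (intro mult_mono power_mono) auto
    finally have "L2_set (\<lambda>k. 2 * M * u (x + h) k) {..<m} \<le> K * R\<^sup>2 + sqrt T * R\<^sup>2" by simp
    moreover have "L2_set (\<lambda>k. 2 * M * u (x + h) k) {..<m} = 2 * M * L2_set (u (x + h)) {..<m}"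
      using M by (simp add: L2_set_right_distrib)
    moreover have "K * R\<^sup>2 + sqrt T * R\<^sup>2 \<le> (sqrt T + K + 1) * R\<^sup>2"
      by (simp add: distrib_right)
    ultimately have "2 * M * L2_set (u (x + h)) {..<m} \<le> (sqrt T + K + 1) * R\<^sup>2" by linarith
    then have "L2_set (u (x + h)) {..<m} * (2 * M) \<le> (sqrt T + K + 1) * R\<^sup>2" by (simp only: mult.commute)
    then have "L2_set (u (x + h)) {..<m} \<le> (sqrt T + K + 1) * R\<^sup>2 / (2 * M)"
      using M by (simp add: pos_le_divide_eq)
    then show ?thesis by (simp add: C_def)
  qed
  moreover have "C > 0" using M K T0 by (auto simp: C_def intro!: divide_pos_pos add_nonneg_pos)
  ultimately show ?thesis by (intro exI[of _ C]) simp
qed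

section \<open>From weak solutions to the tested Poisson equation\<close>

lemma closure_grad_supp: "closure {x. grad \<phi> x $ j \<noteq> 0} \<subseteq> closure {x. \<phi> x \<noteq> 0}"
proof (rule closure_minimal)
  show "{x. grad \<phi> x $ j \<noteq> 0} \<subseteq> closure {x. \<phi> x \<noteq> 0}"
  proof (rule ccontr)
    assume "\<not> ?thesis"
    then obtain x where x: "grad \<phi> x $ j \<noteq> 0" "x \<in> - closure {x. \<phi> x \<noteq> 0}" by blast
    have 0: "\<phi> y = 0" if "y \<in> - closure {x. \<phi> x \<noteq> 0}" for y
      using that closure_subset[of "{x. \<phi> x \<noteq> 0}"] by blast
    have "(\<phi> has_derivative (\<lambda>h. 0)) (at x)"
    proof (rule has_derivative_transform_within_open[OF has_derivative_const[of 0] _ x(2)])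
      show "open (- closure {x. \<phi> x \<noteq> 0})" by (rule open_Compl[OF closed_closure])
    qed (rule 0[symmetric])
    then have "grad \<phi> x = 0" using has_derivative_imp_grad[of \<phi> 0 x] by simp
    then show False using x(1) by simp
  qed
qed simp

lemma test_fun_grad: "test_fun \<Omega> \<phi> \<Longrightarrow> test_fun \<Omega> (\<lambda>x. grad \<phi> x $ j)"
proof -
  assume t: "test_fun \<Omega> \<phi>"
  have "Ck k (\<lambda>x. grad \<phi> x $ j)" for k
    using t Ck_grad[of k \<phi> j] unfolding test_fun_def by blast
  moreover have "compact (closure {x. grad \<phi> x $ j \<noteq> 0})"
    using t closure_grad_supp[of \<phi> j] closed_closure compact_Int_closed[of "closure {x. \<phi> x \<noteq> 0}" "closure {x. grad \<phi> x $ j \<noteq> 0}"]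
    unfolding test_fun_def by (simp add: inf.absorb2)
  ultimately show ?thesis
    using t closure_grad_supp[of \<phi> j] unfolding test_fun_def by blast
qed

lemma test_fun_continuous: "test_fun \<Omega> \<phi> \<Longrightarrow> continuous_on UNIV \<phi>"
  unfolding test_fun_def using Ck.simps(1) by blast

lemma test_fun_bounded:
  assumes "test_fun \<Omega> \<phi>" obtains B where "B > 0" "\<And>x. \<bar>\<phi> x\<bar> \<le> B"
proof -
  have "bounded (\<phi> ` closure {x. \<phi> x \<noteq> 0})"
    using assms by (intro compact_imp_bounded compact_continuous_image continuous_on_subset[OF test_fun_continuous])
      (auto simp: test_fun_def)
  then obtain B where B: "B > 0" "\<forall>x\<in>\<phi> ` closure {x. \<phi> x \<noteq> 0}. norm x \<le> B"
    unfolding bounded_pos by (elim exE conjE)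
  have "\<bar>\<phi> x\<bar> \<le> B" for x
  proof (cases "\<phi> x = 0")
    case False
    then have "\<phi> x \<in> \<phi> ` closure {x. \<phi> x \<noteq> 0}" using closure_subset[of "{x. \<phi> x \<noteq> 0}"] by blast
    from B(2)[rule_format, OF this] show ?thesis by simp
  qed (use B in simp)
  then show ?thesis using that B(1) by blast
qed

lemma finite_measure_ball: "finite_measure (lebesgue_on (ball (0::real^'n) 1))"
  by (rule finite_measure_lebesgue_on) (simp add: lmeasurable_ball)

lemma test_fun_measurable: "test_fun \<Omega> \<phi> \<Longrightarrow> \<phi> \<in> borel_measurable (lebesgue_on S)"
  by (intro measurable_restrict_space1 measurable_completion) (simp add: borel_measurable_continuous_onI test_fun_continuous)

lemma L2_mult_test_integrable:
  fixes w \<phi> :: "real^'n \<Rightarrow> real"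
  assumes w: "L2_on (ball 0 1) w" and t: "test_fun \<Omega> \<phi>"
  shows "integrable (lebesgue_on (ball 0 1)) (\<lambda>x. w x * \<phi> x)"
proof -
  interpret finite_measure "lebesgue_on (ball (0::real^'n) 1)" by (rule finite_measure_ball)
  obtain B where B: "B > 0" "\<And>x. \<bar>\<phi> x\<bar> \<le> B" using test_fun_bounded[OF t] by blast
  have [measurable]: "w \<in> borel_measurable (lebesgue_on (ball 0 1))" using w by (simp add: L2_on_def)
  have [measurable]: "\<phi> \<in> borel_measurable (lebesgue_on (ball 0 1))" by (rule test_fun_measurable[OF t])
  have "integrable (lebesgue_on (ball 0 1)) (\<lambda>x. (1 + (norm (w x))\<^sup>2) * B)"
    using w by (simp add: L2_on_def)
  then show ?thesis
  proof (rule Bochner_Integration.integrable_bound)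
    have "\<bar>w x\<bar> \<le> 1 + (norm (w x))\<^sup>2" for x
      using sum_squares_bound[of "\<bar>w x\<bar>" 1] by (simp add: power2_eq_square)
    then have "\<bar>w x\<bar> * \<bar>\<phi> x\<bar> \<le> (1 + (norm (w x))\<^sup>2) * B" for x
      using B by (intro mult_mono) auto
    then show "AE x in lebesgue_on (ball 0 1). norm (w x * \<phi> x) \<le> norm ((1 + (norm (w x))\<^sup>2) * B)"
      using B by (auto simp: abs_mult)
  qed measurable
qed

lemma L2_on_component:
  fixes G :: "real^'n \<Rightarrow> real^'n"
  assumes "L2_on \<Omega> G" shows "L2_on \<Omega> (\<lambda>x. G x $ j)"
  unfolding L2_on_def
proof
  have G: "G \<in> borel_measurable (lebesgue_on \<Omega>)" using assms by (simp add: L2_on_def)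
  have "(\<lambda>x. G x \<bullet> axis j 1) \<in> borel_measurable (lebesgue_on \<Omega>)" using G by measurable
  then show m: "(\<lambda>x. G x $ j) \<in> borel_measurable (lebesgue_on \<Omega>)" by (simp add: inner_axis)
  have "integrable (lebesgue_on \<Omega>) (\<lambda>x. (norm (G x))\<^sup>2)" using assms by (simp add: L2_on_def)
  then show "integrable (lebesgue_on \<Omega>) (\<lambda>x. (norm (G x $ j))\<^sup>2)"
    by (rule Bochner_Integration.integrable_bound)
       (use m in \<open>auto intro!: AE_I2 simp: component_le_norm_cart abs_le_square_iff[symmetric]\<close>)
qed

lemma weak_grad_spec: "W12 \<Omega> w \<Longrightarrow> has_weak_grad \<Omega> w (weak_grad \<Omega> w)"
  unfolding W12_def weak_grad_def using someI_ex by metis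

text \<open>The second integration by parts: the weak gradient is tested with the partial
  derivatives of \<phi>, which are again test functions.\<close>

lemma weak_solution_Lap:
  fixes u :: "real^'n \<Rightarrow> nat \<Rightarrow> real"
  assumes ws: "weak_solution F m (ball 0 1) u" and i: "i < m" and t: "test_fun (ball 0 1) \<phi>"
  shows "(LINT x|lebesgue_on (ball 0 1). u x i * Lap \<phi> x) = (LINT x|lebesgue_on (ball 0 1). rhs F m u x i * \<phi> x)"
proof -
  define w where "w = (\<lambda>x. u x i)"
  define G where "G = weak_grad (ball 0 1) w"
  have W: "W12 (ball 0 1) w" using ws i by (simp add: weak_solution_def w_def)
  then have hG: "has_weak_grad (ball 0 1) w G" unfolding G_def by (rule weak_grad_spec)
  have L2w: "L2_on (ball 0 1) w" using W by (simp add: W12_def)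
  have L2G: "L2_on (ball 0 1) G" using hG by (simp add: has_weak_grad_def)
  note tg = test_fun_grad[OF t]
  have "(LINT x|lebesgue_on (ball 0 1). w x * Lap \<phi> x)
      = (\<Sum>j\<in>UNIV. LINT x|lebesgue_on (ball 0 1). w x * grad (\<lambda>y. grad \<phi> y $ j) x $ j)"
    unfolding Lap_def sum_distrib_left
    by (rule Bochner_Integration.integral_sum) (rule L2_mult_test_integrable[OF L2w test_fun_grad[OF tg]])
  also have "\<dots> = (\<Sum>j\<in>UNIV. - (LINT x|lebesgue_on (ball 0 1). G x $ j * grad \<phi> x $ j))"
    using hG tg unfolding has_weak_grad_def by (intro sum.cong refl) blast
  also have "\<dots> = - (LINT x|lebesgue_on (ball 0 1). (\<Sum>j\<in>UNIV. G x $ j * grad \<phi> x $ j))"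
    unfolding sum_negf
    by (subst Bochner_Integration.integral_sum) (auto intro: L2_mult_test_integrable[OF L2_on_component[OF L2G] tg])
  also have "\<dots> = - (LINT x|lebesgue_on (ball 0 1). G x \<bullet> grad \<phi> x)"
    by (simp add: inner_vec_def)
  also have "\<dots> = (LINT x|lebesgue_on (ball 0 1). rhs F m u x i * \<phi> x)"
    using ws i t unfolding weak_solution_def G_def w_def by blast
  finally show ?thesis by (simp add: w_def)
qed

lemma Lap_affine:
  assumes "Ck 2 f" shows "Lap (\<lambda>y. f ((y - a) /\<^sub>R r)) y = Lap f ((y - a) /\<^sub>R r) / r\<^sup>2"
proof -
  have f: "Ck (Suc (Suc 0)) f" using assms by (simp only: numeral_2_eq_2)
  have 1: "grad (\<lambda>y. f ((y - a) /\<^sub>R r)) = (\<lambda>y. (1 / r) *\<^sub>R grad f ((y - a) /\<^sub>R r))"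
    by (rule GD_grad[OF GD_affine[OF Ck_Suc_imp_GD[OF f]]])
  have "grad (\<lambda>y. (1 / r) * grad f ((y - a) /\<^sub>R r) $ j) = (\<lambda>y. (1 / r) *\<^sub>R (1 / r) *\<^sub>R grad (\<lambda>y. grad f y $ j) ((y - a) /\<^sub>R r))" for j
    by (rule GD_grad[OF GD_cmult[OF GD_affine[OF Ck_Suc_imp_GD[OF Ck_grad[OF f]]]]])
  then show ?thesis
    by (simp add: Lap_def 1 sum_divide_distrib power2_eq_square)
qed

lemma test_fun_rescaled_bump:
  fixes K :: "real^'n \<Rightarrow> real"
  assumes K: "bumpfn K" and s: "0 < s" "cball x s \<subseteq> ball 0 1"
  shows "test_fun (ball 0 1) (\<lambda>y. K ((y - x) /\<^sub>R s))"
proof -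
  have "{y. K ((y - x) /\<^sub>R s) \<noteq> 0} \<subseteq> cball x s"
  proof
    fix y assume "y \<in> {y. K ((y - x) /\<^sub>R s) \<noteq> 0}"
    then have "norm ((y - x) /\<^sub>R s) < 1" using bumpfn_out[OF K, of "(y - x) /\<^sub>R s"] by force
    then have "norm (y - x) < s" using s by (simp add: divide_simps del: scaleR_diff_right)
    then show "y \<in> cball x s" by (simp add: dist_norm norm_minus_commute)
  qed
  then have sub: "closure {y. K ((y - x) /\<^sub>R s) \<noteq> 0} \<subseteq> cball x s" by (rule closure_minimal) simp
  moreover have "compact (closure {y. K ((y - x) /\<^sub>R s) \<noteq> 0})"
    using bounded_subset[OF bounded_cball sub] by (simp add: compact_eq_bounded_closed)
  ultimately show ?thesis
    using K s(2) unfolding test_fun_def bumpfn_def by (auto intro: Ck_affine)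
qed

lemma lebesgue_on_ball_integral:
  fixes w \<psi> :: "real^'n \<Rightarrow> real"
  assumes w0: "w0 \<in> borel_measurable borel" "\<And>x. w0 x = (if x \<in> ball 0 1 then w x else 0)" and \<psi>: "\<psi> \<in> borel_measurable borel"
  shows "(LINT x|lebesgue_on (ball 0 1). w x * \<psi> x) = (LINT x|lborel. w0 x * \<psi> x)"
proof -
  have "(LINT x|lebesgue_on (ball 0 1). w x * \<psi> x) = (LINT x|lebesgue. indicator (ball 0 1) x *\<^sub>R (w x * \<psi> x))"
    by (rule integral_restrict_space) simp
  also have "\<dots> = (LINT x|lebesgue. w0 x * \<psi> x)"
    by (rule Bochner_Integration.integral_cong) (auto simp: w0(2))
  also have "\<dots> = (LINT x|lborel. w0 x * \<psi> x)"
    by (rule integral_completion) (use w0(1) \<psi> in measurable)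
  finally show ?thesis .
qed

lemma conv_rescale:
  fixes f K :: "real^'n \<Rightarrow> real"
  assumes f[measurable]: "f \<in> borel_measurable borel" and K[measurable]: "K \<in> borel_measurable borel" and s: "0 < s"
  shows "(LINT y|lborel. f y * K ((y - x) /\<^sub>R s)) = s ^ CARD('n) * conv f K x s"
proof -
  have "(LINT z|lborel. f (x + s *\<^sub>R z) * K ((x + s *\<^sub>R z - x) /\<^sub>R s)) = (LINT y|lborel. f y * K ((y - x) /\<^sub>R s)) / s ^ CARD('n)"
    using s by (intro lborel_integral_affine) auto
  then show ?thesis using s by (simp add: conv_def field_simps)
qed

text \<open>Passes from integrals over the ball with Lebesgue measure to \<open>lborel\<close>
  integrals of Borel functions extended by zero; the test functions are the rescaled bumps,
  supported in \<open>cball x s\<close>.\<close>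

lemma poissonI:
  fixes w b w0 b0 :: "real^'n \<Rightarrow> real"
  assumes w0: "w0 \<in> borel_measurable borel" "\<And>x. w0 x = (if x \<in> ball 0 1 then w x else 0)"
    and b0: "b0 \<in> borel_measurable borel" "\<And>x. b0 x = (if x \<in> ball 0 1 then b x else 0)"
    and cont: "continuous_on (ball 0 1) w" and G: "\<And>x. \<bar>b0 x\<bar> \<le> G"
    and weak: "\<And>\<phi>. test_fun (ball 0 1) \<phi> \<Longrightarrow>
       (LINT x|lebesgue_on (ball 0 1). w x * Lap \<phi> x) = (LINT x|lebesgue_on (ball 0 1). b x * \<phi> x)"
  shows "poisson w0 b0 G"
  unfolding poisson_def
proof (intro conjI allI impI)
  show "w0 \<in> borel_measurable borel" "b0 \<in> borel_measurable borel" by fact+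
  show "\<bar>b0 x\<bar> \<le> G" for x by (rule G)
  show "continuous_on (ball 0 1) w0" using cont by (rule continuous_on_eq) (simp add: w0(2))
  fix x :: "real^'n" and s :: real and K :: "real^'n \<Rightarrow> real"
  assume s: "0 < s" "cball x s \<subseteq> ball 0 1" and K: "bumpfn K"
  define \<phi> where "\<phi> y = K ((y - x) /\<^sub>R s)" for y
  have t: "test_fun (ball 0 1) \<phi>" unfolding \<phi>_def by (rule test_fun_rescaled_bump[OF K s])
  have K2: "Ck 2 K" using K by (simp add: bumpfn_def)
  have Lm: "Lap K \<in> borel_measurable borel" by (rule borel_measurable_continuous_onI[OF Lap_continuous[OF K2]])
  have Km: "K \<in> borel_measurable borel" by (rule bumpfn_measurable[OF K])
  have L\<phi>: "Lap \<phi> = (\<lambda>y. Lap K ((y - x) /\<^sub>R s) / s\<^sup>2)"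
    unfolding \<phi>_def[abs_def] using Lap_affine[OF K2] by blast
  have "(LINT y|lborel. w0 y * Lap \<phi> y) = (LINT y|lborel. b0 y * \<phi> y)"
    using weak[OF t] lebesgue_on_ball_integral[OF w0, of "Lap \<phi>"] lebesgue_on_ball_integral[OF b0, of \<phi>] Lm Km
    unfolding L\<phi> \<phi>_def by simp
  moreover have "(LINT y|lborel. w0 y * Lap \<phi> y) = s ^ CARD('n) * conv w0 (Lap K) x s / s\<^sup>2"
    unfolding L\<phi> using conv_rescale[OF w0(1) Lm s(1), of x] by simp
  moreover have "(LINT y|lborel. b0 y * \<phi> y) = s ^ CARD('n) * conv b0 K x s"
    unfolding \<phi>_def by (rule conv_rescale[OF b0(1) Km s(1)])
  ultimately show "conv w0 (Lap K) x s = s\<^sup>2 * conv b0 K x s" using s(1) by (simp add: field_simps)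
qed

section \<open>The nonlinearity and the cut-off solution\<close>

lemma structural_F:
  assumes st: "structural c\<^sub>0 C\<^sub>0 F"
  shows "continuous_on {0..} F" "continuous_on {0..} (f_of F)"
    and "0 \<le> s \<Longrightarrow> 2 * c\<^sub>0 * s \<le> F s" "0 \<le> s \<Longrightarrow> F s \<le> 2 * C\<^sub>0 * s"
    and "0 \<le> s \<Longrightarrow> c\<^sub>0 \<le> f_of F s" "0 \<le> s \<Longrightarrow> f_of F s \<le> C\<^sub>0"
proof -
  have d: "F differentiable_on {0..}" "hderiv F differentiable_on {0..}" and F0: "F 0 = 0"
    using st by (auto simp: structural_def C2_holder_def)
  show f: "0 \<le> s \<Longrightarrow> c\<^sub>0 \<le> f_of F s" "0 \<le> s \<Longrightarrow> f_of F s \<le> C\<^sub>0" for s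
    using st by (auto simp: structural_def)
  show c: "continuous_on {0..} F" using d(1) by (rule differentiable_imp_continuous_on)
  show "continuous_on {0..} (f_of F)"
    unfolding f_of_def[abs_def] by (intro continuous_intros differentiable_imp_continuous_on d)
  have D: "(F has_real_derivative 2 * f_of F t) (at t)" if "0 < t" for t
  proof -
    have "F differentiable (at t within {0..})" using d(1) that by (simp add: differentiable_on_def)
    then have "(F has_vector_derivative hderiv F t) (at t within {0..})"
      unfolding hderiv_def by (simp add: vector_derivative_works)
    moreover have "at t within {0..} = at t" using that by (intro at_within_interior) (simp add: interior_Ici[of 0 "-1"])
    ultimately show ?thesis by (simp add: has_real_derivative_iff_has_vector_derivative f_of_def)
  qed
  \<comment> \<open>Integration of F' = 2f from F(0) = 0. The lower bound turns energy into an L1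
    bound for |u|, the upper bound makes F(|u|) integrable. The derivative is used at positive
    arguments only, with continuity at 0.\<close>
  show "2 * c\<^sub>0 * s \<le> F s" if "0 \<le> s"
  proof -
    have "F 0 - 2 * c\<^sub>0 * 0 \<le> F s - 2 * c\<^sub>0 * s"
    proof (rule DERIV_nonneg_imp_increasing_open[OF that])
      fix t assume t: "0 < t" "t < s"
      have "((\<lambda>t. F t - 2 * c\<^sub>0 * t) has_real_derivative 2 * f_of F t - 2 * c\<^sub>0) (at t)"
        by (auto intro!: derivative_eq_intros D t)
      then show "\<exists>y. ((\<lambda>t. F t - 2 * c\<^sub>0 * t) has_real_derivative y) (at t) \<and> 0 \<le> y"
        using f(1)[of t] t by (intro exI conjI) auto
    qed (intro continuous_intros continuous_on_subset[OF c], auto)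
    then show ?thesis using F0 by simp
  qed
  show "F s \<le> 2 * C\<^sub>0 * s" if "0 \<le> s"
  proof -
    have "2 * C\<^sub>0 * 0 - F 0 \<le> 2 * C\<^sub>0 * s - F s"
    proof (rule DERIV_nonneg_imp_increasing_open[OF that])
      fix t assume t: "0 < t" "t < s"
      have "((\<lambda>t. 2 * C\<^sub>0 * t - F t) has_real_derivative 2 * C\<^sub>0 - 2 * f_of F t) (at t)"
        by (auto intro!: derivative_eq_intros D t)
      then show "\<exists>y. ((\<lambda>t. 2 * C\<^sub>0 * t - F t) has_real_derivative y) (at t) \<and> 0 \<le> y"
        using f(2)[of t] t by (intro exI conjI) auto
    qed (intro continuous_intros continuous_on_subset[OF c], auto)
    then show ?thesis using F0 by simp
  qed
qed

text \<open>Values of u outside the ball are arbitrary, possibly not even measurable; extension by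
  zero makes u and the right-hand side Borel functions on the whole space.\<close>

definition cutoff :: "(real^'n \<Rightarrow> nat \<Rightarrow> real) \<Rightarrow> real^'n \<Rightarrow> nat \<Rightarrow> real" where
  "cutoff u x i = (if x \<in> ball 0 1 then u x i else 0)"

lemma cutoff_in: "x \<in> ball 0 1 \<Longrightarrow> cutoff u x = u x"
  by (simp add: cutoff_def fun_eq_iff)

lemma solution_differentiable:
  assumes "solution F m u" "i < m" "x \<in> ball 0 1" shows "(\<lambda>x. u x i) differentiable (at x)"
proof -
  have "loc_C1_holder (1/2) (ball 0 1) (\<lambda>x. u x i)" using assms unfolding solution_def by auto
  then show ?thesis using assms(3) by (simp add: loc_C1_holder_def)
qed

lemma solution_continuous:
  assumes "solution F m u" "i < m" shows "continuous_on (ball 0 1) (\<lambda>x. u x i)"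
  using solution_differentiable[OF assms]
  by (auto intro!: continuous_at_imp_continuous_on differentiable_imp_continuous_within)

lemma cutoff_measurable:
  assumes "solution F m u" "i < m" shows "(\<lambda>x. cutoff u x i) \<in> borel_measurable borel"
proof -
  have "(\<lambda>x. indicator (ball 0 1) x *\<^sub>R u x i) \<in> borel_measurable borel"
    by (rule borel_measurable_continuous_on_indicator[OF _ solution_continuous[OF assms]]) simp
  moreover have "(\<lambda>x. indicator (ball 0 1) x *\<^sub>R u x i) = (\<lambda>x. cutoff u x i)"
    by (auto simp: cutoff_def fun_eq_iff)
  ultimately show ?thesis by simp
qed

lemma vnorm_cutoff_measurable:
  assumes "solution F m u" shows "(\<lambda>x. vnorm m (cutoff u) x) \<in> borel_measurable borel"
proof -
  have "(\<lambda>x. \<Sum>i<m. (cutoff u x i)\<^sup>2) \<in> borel_measurable borel"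
    using cutoff_measurable[OF assms] by (intro borel_measurable_sum borel_measurable_power) auto
  from borel_measurable_continuous_on[OF continuous_on_real_sqrt[OF continuous_on_id] this] show ?thesis
    by (simp add: vnorm_def L2_set_def)
qed

lemma half_line_comp_measurable:
  fixes f :: "real \<Rightarrow> real"
  assumes f: "continuous_on {0..} f" and v: "v \<in> borel_measurable M" "\<And>x. 0 \<le> v x"
  shows "(\<lambda>x. f (v x)) \<in> borel_measurable M"
proof -
  have "continuous_on UNIV (\<lambda>s. f (max 0 s))"
    by (intro continuous_on_compose2[OF f] continuous_intros) auto
  then have "(\<lambda>x. f (max 0 (v x))) \<in> borel_measurable M"
    using borel_measurable_continuous_on v(1) by blast
  then show ?thesis using v(2) by (simp add: max_absorb2)
qed

lemma vnorm_nonneg: "0 \<le> vnorm m u x"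
  by (simp add: vnorm_def)

lemma rhs_cutoff_measurable:
  assumes st: "structural c\<^sub>0 C\<^sub>0 F" and so: "solution F m u" and i: "i < m"
  shows "(\<lambda>x. cutoff (rhs F m u) x i) \<in> borel_measurable borel"
proof -
  have [measurable]: "(\<lambda>x. f_of F (vnorm m (cutoff u) x)) \<in> borel_measurable borel"
    by (rule half_line_comp_measurable[OF structural_F(2)[OF st] vnorm_cutoff_measurable[OF so] vnorm_nonneg])
  note [measurable] = vnorm_cutoff_measurable[OF so] cutoff_measurable[OF so i]
  have eq: "(\<lambda>x. cutoff (rhs F m u) x i) =
     (\<lambda>x. if vnorm m (cutoff u) x > 0 then f_of F (vnorm m (cutoff u) x) * (cutoff u x i / vnorm m (cutoff u) x) else 0)"
  proof
    fix x
    show "cutoff (rhs F m u) x i = (if vnorm m (cutoff u) x > 0 then f_of F (vnorm m (cutoff u) x) * (cutoff u x i / vnorm m (cutoff u) x) else 0)"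
      by (cases "x \<in> ball 0 1") (simp_all add: cutoff_def rhs_def vnorm_def L2_set_def)
  qed
  show ?thesis unfolding eq by measurable
qed

lemma rhs_L2_le:
  assumes st: "structural c\<^sub>0 C\<^sub>0 F" and c0: "0 < c\<^sub>0" shows "L2_set (rhs F m u x) {..<m} \<le> C\<^sub>0"
proof (cases "vnorm m u x > 0")
  case True
  define v where "v = vnorm m u x"
  have v: "v > 0" using True by (simp add: v_def)
  have f: "c\<^sub>0 \<le> f_of F v" "f_of F v \<le> C\<^sub>0" using structural_F(5,6)[OF st, of v] v by auto
  have "rhs F m u x = (\<lambda>i. (f_of F v / v) * u x i)" using True by (simp add: rhs_def v_def fun_eq_iff)
  moreover have "L2_set (\<lambda>i. (f_of F v / v) * u x i) {..<m} = (f_of F v / v) * vnorm m u x"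
    unfolding vnorm_def using f c0 v by (subst L2_set_right_distrib) auto
  ultimately show ?thesis using v f by (simp add: v_def)
next
  case False
  have "0 \<le> C\<^sub>0" using structural_F(5,6)[OF st, of 0] c0 by simp
  with False show ?thesis by (simp add: rhs_def[abs_def] L2_set_def)
qed

lemma rhs_inner:
  assumes st: "structural c\<^sub>0 C\<^sub>0 F" shows "c\<^sub>0 * vnorm m u x \<le> (\<Sum>k<m. rhs F m u x k * u x k)"
proof (cases "vnorm m u x > 0")
  case True
  define v where "v = vnorm m u x"
  have v: "v > 0" using True by (simp add: v_def)
  have sq: "(\<Sum>k<m. u x k * u x k) = v * v"
    by (simp add: v_def vnorm_def L2_set_def sum_nonneg power2_eq_square[symmetric])
  have "(\<Sum>k<m. rhs F m u x k * u x k) = f_of F v / v * (\<Sum>k<m. u x k * u x k)"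
    using True by (simp add: rhs_def v_def[symmetric] sum_distrib_left mult_ac)
  also have "\<dots> = f_of F v * v" using v by (simp add: sq)
  finally show ?thesis using structural_F(5)[OF st, of v] v by (simp add: v_def[symmetric])
next
  case False
  then have "vnorm m u x = 0" using vnorm_nonneg[of m u x] by simp
  with False show ?thesis by (simp add: rhs_def)
qed

lemma solution_vpoisson:
  fixes u :: "real^'n \<Rightarrow> nat \<Rightarrow> real"
  assumes st: "structural c\<^sub>0 C\<^sub>0 F" and c0: "0 < c\<^sub>0" and so: "solution F m u"
  shows "vpoisson m (cutoff u) (cutoff (rhs F m u)) C\<^sub>0"
  unfolding vpoisson_def
proof (intro allI impI)
  fix a :: "nat \<Rightarrow> real" assume a: "(\<Sum>i<m. (a i)\<^sup>2) \<le> 1"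
  have C0: "0 \<le> C\<^sub>0" using structural_F(5,6)[OF st, of 0] c0 by simp
  have ws: "weak_solution F m (ball 0 1) u" using so by (simp add: solution_def)
  interpret finite_measure "lebesgue_on (ball (0::real^'n) 1)" by (rule finite_measure_ball)
  show "poisson (comb m a (cutoff u)) (comb m a (cutoff (rhs F m u))) C\<^sub>0"
  proof (rule poissonI[where w = "comb m a u" and b = "comb m a (rhs F m u)"])
    show "comb m a (cutoff u) \<in> borel_measurable borel"
      unfolding comb_def[abs_def] using cutoff_measurable[OF so] by (intro borel_measurable_sum borel_measurable_times) auto
    show "comb m a (cutoff (rhs F m u)) \<in> borel_measurable borel"
      unfolding comb_def[abs_def] using rhs_cutoff_measurable[OF st so] by (intro borel_measurable_sum borel_measurable_times) auto
    show "comb m a (cutoff u) x = (if x \<in> ball 0 1 then comb m a u x else 0)"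
      "comb m a (cutoff (rhs F m u)) x = (if x \<in> ball 0 1 then comb m a (rhs F m u) x else 0)" for x
      by (simp_all add: comb_def cutoff_def)
    then show "\<bar>comb m a (cutoff (rhs F m u)) x\<bar> \<le> C\<^sub>0" for x
      using order_trans[OF comb_le_L2[OF a, of "rhs F m u" x] rhs_L2_le[OF st c0]] C0 by simp
    show "continuous_on (ball 0 1) (comb m a u)"
      unfolding comb_def[abs_def] using solution_continuous[OF so] by (intro continuous_intros) auto
    fix \<phi> :: "real^'n \<Rightarrow> real" assume t: "test_fun (ball 0 1) \<phi>"
    have Lm: "integrable (lebesgue_on (ball 0 1)) (\<lambda>x. u x i * Lap \<phi> x)" if "i < m" for i
    proof -
      have "L2_on (ball 0 1) (\<lambda>x. u x i)" using ws that by (simp add: weak_solution_def W12_def)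
      then show ?thesis unfolding Lap_def sum_distrib_left
        by (intro Bochner_Integration.integrable_sum L2_mult_test_integrable[OF _ test_fun_grad[OF test_fun_grad[OF t]]])
    qed
    have Rm: "integrable (lebesgue_on (ball 0 1)) (\<lambda>x. rhs F m u x i * \<phi> x)" if i: "i < m" for i
    proof -
      obtain B where B: "B > 0" "\<And>x. \<bar>\<phi> x\<bar> \<le> B" using test_fun_bounded[OF t] by blast
      have r: "\<bar>rhs F m u x i\<bar> \<le> C\<^sub>0" for x
        using member_le_L2_set[of "{..<m}" i "\<lambda>i. \<bar>rhs F m u x i\<bar>"] rhs_L2_le[OF st c0, of m u x] i by (simp add: L2_set_def)
      have "(\<lambda>x. cutoff (rhs F m u) x i) \<in> borel_measurable (lebesgue_on (ball 0 1))"
        by (intro measurable_restrict_space1 measurable_completion) (simp add: rhs_cutoff_measurable[OF st so i])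
      then have "(\<lambda>x. rhs F m u x i) \<in> borel_measurable (lebesgue_on (ball 0 1))"
        by (subst measurable_cong[where g = "\<lambda>x. cutoff (rhs F m u) x i"]) (auto simp: cutoff_def space_restrict_space)
      then have [measurable]: "(\<lambda>x. rhs F m u x i * \<phi> x) \<in> borel_measurable (lebesgue_on (ball 0 1))"
        using test_fun_measurable[OF t] by measurable
      show ?thesis
        by (rule integrable_const_bound[of _ "C\<^sub>0 * B"]) (use r B C0 in \<open>auto intro!: AE_I2 mult_mono simp: abs_mult\<close>)
    qed
    have "(LINT x|lebesgue_on (ball 0 1). comb m a u x * Lap \<phi> x)
       = (\<Sum>i<m. a i * (LINT x|lebesgue_on (ball 0 1). u x i * Lap \<phi> x))"
      unfolding comb_def sum_distrib_right mult.assoc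
      by (subst Bochner_Integration.integral_sum) (auto intro: Lm)
    also have "\<dots> = (\<Sum>i<m. a i * (LINT x|lebesgue_on (ball 0 1). rhs F m u x i * \<phi> x))"
      by (intro sum.cong refl) (simp add: weak_solution_Lap[OF ws _ t])
    also have "\<dots> = (LINT x|lebesgue_on (ball 0 1). comb m a (rhs F m u) x * \<phi> x)"
      unfolding comb_def sum_distrib_right mult.assoc
      by (subst Bochner_Integration.integral_sum) (auto intro: Rm)
    finally show "(LINT x|lebesgue_on (ball 0 1). comb m a u x * Lap \<phi> x) = (LINT x|lebesgue_on (ball 0 1). comb m a (rhs F m u) x * \<phi> x)" .
  qed
qed

lemma solution_coercive:
  assumes st: "structural c\<^sub>0 C\<^sub>0 F" shows "coercive m c\<^sub>0 (cutoff u) (cutoff (rhs F m u))"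
  unfolding coercive_def using rhs_inner[OF st, of m u] by (simp add: cutoff_in vnorm_def del: mem_ball)

section \<open>Energy and interior bounds\<close>

text \<open>Discard the nonnegative gradient part of the energy and use F(s) \<ge> 2
  \<open>c\<^sub>0\<close> s.\<close>

lemma solution_L1_bound:
  fixes u :: "real^'n \<Rightarrow> nat \<Rightarrow> real"
  assumes st: "structural c\<^sub>0 C\<^sub>0 F" and c0: "0 < c\<^sub>0" and so: "solution F m u"
  shows "integrable lborel (\<lambda>x. vnorm m (cutoff u) x)"
    and "(LINT x|lborel. vnorm m (cutoff u) x) \<le> energy F m u 0 1 / (2 * c\<^sub>0)"
proof -
  interpret finite_measure "lebesgue_on (ball (0::real^'n) 1)" by (rule finite_measure_ball)
  let ?M = "lebesgue_on (ball (0::real^'n) 1)"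
  have W: "W12 (ball 0 1) (\<lambda>x. u x i)" if "i < m" for i
    using so that by (simp add: solution_def weak_solution_def)
  have v0: "vnorm m (cutoff u) x = (if x \<in> ball 0 1 then vnorm m u x else 0)" for x
    by (simp add: vnorm_def cutoff_def L2_set_def)
  have vm0: "(\<lambda>x. vnorm m (cutoff u) x) \<in> borel_measurable borel" by (rule vnorm_cutoff_measurable[OF so])
  have "(\<lambda>x. vnorm m (cutoff u) x) \<in> borel_measurable ?M"
    by (intro measurable_restrict_space1 measurable_completion) (simp add: vm0)
  moreover have "vnorm m u \<in> borel_measurable ?M \<longleftrightarrow> vnorm m (cutoff u) \<in> borel_measurable ?M"
    by (rule measurable_cong) (simp add: v0 space_restrict_space)
  ultimately have vm: "vnorm m u \<in> borel_measurable ?M" by simp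
  have "integrable ?M (\<lambda>x. \<Sum>i<m. 1 + (norm (u x i))\<^sup>2)"
    using W by (intro Bochner_Integration.integrable_sum Bochner_Integration.integrable_add) (auto simp: W12_def L2_on_def)
  then have vi: "integrable ?M (vnorm m u)"
  proof (rule Bochner_Integration.integrable_bound[OF _ vm])
    have "vnorm m u x \<le> (\<Sum>i<m. 1 + (norm (u x i))\<^sup>2)" for x
    proof -
      have "vnorm m u x \<le> (\<Sum>i<m. \<bar>u x i\<bar>)" unfolding vnorm_def by (rule L2_set_le_sum_abs)
      also have "\<dots> \<le> (\<Sum>i<m. 1 + (norm (u x i))\<^sup>2)"
      proof (rule sum_mono)
        fix i show "\<bar>u x i\<bar> \<le> 1 + (norm (u x i))\<^sup>2"
          using sum_squares_bound[of "\<bar>u x i\<bar>" 1] by (simp add: power2_eq_square)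
      qed
      finally show ?thesis .
    qed
    then show "AE x in ?M. norm (vnorm m u x) \<le> norm (\<Sum>i<m. 1 + (norm (u x i))\<^sup>2)"
      by (intro AE_I2) (simp add: vnorm_nonneg order_trans[OF _ abs_ge_self])
  qed
  have Fm: "(\<lambda>x. F (vnorm m u x)) \<in> borel_measurable ?M"
    by (rule half_line_comp_measurable[OF structural_F(1)[OF st] vm vnorm_nonneg])
  have F1: "2 * c\<^sub>0 * vnorm m u x \<le> F (vnorm m u x)" and F2: "F (vnorm m u x) \<le> 2 * C\<^sub>0 * vnorm m u x" for x
    using structural_F(3,4)[OF st vnorm_nonneg] by auto
  \<comment> \<open>Integrability of both parts of the energy density is essential: the Bochner
    integral of a non-integrable function is 0 by convention, and the energy would then say nothing
    about |u|.\<close>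
  have Fi: "integrable ?M (\<lambda>x. F (vnorm m u x))"
  proof (rule Bochner_Integration.integrable_bound[OF _ Fm])
    show "integrable ?M (\<lambda>x. 2 * C\<^sub>0 * vnorm m u x)" using vi by simp
    have "\<bar>F (vnorm m u x)\<bar> \<le> 2 * C\<^sub>0 * vnorm m u x" for x
    proof -
      have "0 \<le> 2 * c\<^sub>0 * vnorm m u x" using c0 vnorm_nonneg[of m u x] by simp
      then show ?thesis using F1[of x] F2[of x] by linarith
    qed
    then show "AE x in ?M. norm (F (vnorm m u x)) \<le> norm (2 * C\<^sub>0 * vnorm m u x)"
      by (intro AE_I2) (metis abs_ge_self order_trans real_norm_def)
  qed
  define g where "g x = (\<Sum>i<m. (norm (weak_grad (ball 0 1) (\<lambda>y. u y i) x))\<^sup>2)" for x :: "real^'n"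
  have gi: "integrable ?M g"
    unfolding g_def using weak_grad_spec[OF W]
    by (intro Bochner_Integration.integrable_sum) (auto simp: has_weak_grad_def L2_on_def)
  have "2 * c\<^sub>0 * (LINT x|?M. vnorm m u x) = (LINT x|?M. 2 * c\<^sub>0 * vnorm m u x)" by simp
  also have "\<dots> \<le> (LINT x|?M. F (vnorm m u x))"
    using vi Fi F1 by (intro Bochner_Integration.integral_mono) auto
  also have "\<dots> \<le> (LINT x|?M. g x) + (LINT x|?M. F (vnorm m u x))"
    using Bochner_Integration.integral_nonneg[of ?M g] by (simp add: g_def sum_nonneg)
  also have "\<dots> = energy F m u 0 1"
    unfolding energy_def g_def[symmetric] using gi Fi by simp
  finally have le: "2 * c\<^sub>0 * (LINT x|?M. vnorm m u x) \<le> energy F m u 0 1" .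
  have "(LINT x|?M. vnorm m u x * 1) = (LINT x|lborel. vnorm m (cutoff u) x * 1)"
    by (rule lebesgue_on_ball_integral[OF vm0 v0]) simp
  then have eq: "(LINT x|lborel. vnorm m (cutoff u) x) = (LINT x|?M. vnorm m u x)" by simp
  show "(LINT x|lborel. vnorm m (cutoff u) x) \<le> energy F m u 0 1 / (2 * c\<^sub>0)"
    using le c0 unfolding eq by (simp add: field_simps)
  have "integrable lebesgue (\<lambda>x. indicator (ball 0 1) x *\<^sub>R vnorm m u x)"
    using vi by (subst (asm) integrable_restrict_space) auto
  moreover have "(\<lambda>x. indicator (ball 0 1) x *\<^sub>R vnorm m u x) = (\<lambda>x. vnorm m (cutoff u) x)"
    by (auto simp: v0 fun_eq_iff)
  ultimately have "integrable lebesgue (\<lambda>x. vnorm m (cutoff u) x)" by simp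
  then show "integrable lborel (\<lambda>x. vnorm m (cutoff u) x)"
    by (subst (asm) integrable_completion) (simp_all add: vm0)
qed

text \<open>The constant is fixed before m, F and u. Balls of radius 1/16 around points of norm
  below 15/16 stay in the unit ball, and the sup bound is applied to all combinations
  \<open>comb m a\<close>.\<close>

lemma solution_sup_bound:
  fixes c\<^sub>0 C\<^sub>0 E :: real
  assumes c0: "0 < c\<^sub>0" and C0: "0 < C\<^sub>0"
  shows "\<exists>S>0. \<forall>m F (u :: real^'n \<Rightarrow> nat \<Rightarrow> real) x. structural c\<^sub>0 C\<^sub>0 F \<longrightarrow> solution F m u \<longrightarrow> energy F m u 0 1 = E \<longrightarrow>
     norm x < 15/16 \<longrightarrow> vnorm m (cutoff u) x \<le> S"
proof -
  obtain C where C: "C > 0" "\<And>(u::real^'n \<Rightarrow> real) g G x R. poisson u g G \<Longrightarrow> integrable lborel u \<Longrightarrow> 0 < R \<Longrightarrow> cball x R \<subseteq> ball 0 1 \<Longrightarrow>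
     \<bar>u x\<bar> \<le> C * ((LINT y|lborel. \<bar>u y\<bar>) / R ^ CARD('n) + G * R\<^sup>2)"
    using poisson_sup_bound by blast
  \<comment> \<open>E is an arbitrary real here, hence the absolute value, which keeps S positive
    even when no solution has energy E.\<close>
  define S where "S = C * (\<bar>E\<bar> / (2 * c\<^sub>0) / (1/16) ^ CARD('n) + C\<^sub>0 * (1/16)\<^sup>2)"
  have "vnorm m (cutoff u) x \<le> S"
    if st: "structural c\<^sub>0 C\<^sub>0 F" and so: "solution F m u" and E: "energy F m u 0 1 = E" and x: "norm x < 15/16"
    for m F and u :: "real^'n \<Rightarrow> nat \<Rightarrow> real" and x
    unfolding vnorm_def
  proof (rule L2_set_le_dual)
    fix a :: "nat \<Rightarrow> real" assume a: "(\<Sum>i<m. (a i)\<^sup>2) \<le> 1"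
    let ?w = "comb m a (cutoff u)"
    have po: "poisson ?w (comb m a (cutoff (rhs F m u))) C\<^sub>0"
      using solution_vpoisson[OF st c0 so] a by (simp add: vpoisson_def)
    note v = solution_L1_bound[OF st c0 so]
    have le: "\<bar>?w y\<bar> \<le> vnorm m (cutoff u) y" for y unfolding vnorm_def by (rule comb_le_L2[OF a])
    have int: "integrable lborel ?w"
      by (rule Bochner_Integration.integrable_bound[OF v(1)])
         (use po le vnorm_nonneg[of m "cutoff u"] in \<open>auto simp: poisson_def\<close>)
    have "(LINT y|lborel. \<bar>?w y\<bar>) \<le> (LINT y|lborel. vnorm m (cutoff u) y)"
      using int v(1) le by (intro Bochner_Integration.integral_mono) auto
    also have "\<dots> \<le> \<bar>E\<bar> / (2 * c\<^sub>0)"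
    proof -
      have "E / (2 * c\<^sub>0) \<le> \<bar>E\<bar> / (2 * c\<^sub>0)" using c0 by (intro divide_right_mono) auto
      then show ?thesis using v(2) unfolding E by linarith
    qed
    finally have L1: "(LINT y|lborel. \<bar>?w y\<bar>) \<le> \<bar>E\<bar> / (2 * c\<^sub>0)" .
    have "cball x (1/16) \<subseteq> ball 0 1" using x by (simp add: cball_subset_ball_iff)
    then have "\<bar>?w x\<bar> \<le> C * ((LINT y|lborel. \<bar>?w y\<bar>) / (1/16) ^ CARD('n) + C\<^sub>0 * (1/16)\<^sup>2)"
      by (intro C(2)[OF po int]) auto
    also have "\<dots> \<le> S"
      unfolding S_def using L1 C(1) by (intro mult_left_mono add_right_mono divide_right_mono) auto
    finally have "?w x \<le> S" by simp
    then show "(\<Sum>i<m. a i * cutoff u x i) \<le> S" by (simp add: comb_def)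
  qed
  moreover have "S > 0"
    using C C0 c0 unfolding S_def by (intro mult_pos_pos add_nonneg_pos) auto
  ultimately show ?thesis by blast
qed

section \<open>From Lipschitz bounds to gradients\<close>

lemma derivative_le_local_lipschitz:
  fixes f :: "real^'n \<Rightarrow> real"
  assumes D: "(f has_derivative f') (at x)" and r: "0 < r"
    and lip: "\<And>h. norm h \<le> r \<Longrightarrow> \<bar>f (x + h) - f x\<bar> \<le> L * norm h"
  shows "\<bar>f' v\<bar> \<le> L * norm v"
proof (cases "v = 0")
  case True
  then show ?thesis using has_derivative_bounded_linear[OF D] by (simp add: bounded_linear.linear linear_0)
next
  case False
  show ?thesis
  proof (rule field_le_epsilon)
    fix e :: real assume e: "0 < e"
    have "0 < e / norm v" using e False by simp
    then obtain d where d: "0 < d" "\<And>y. norm (y - x) < d \<Longrightarrow> norm (f y - f x - f' (y - x)) \<le> e / norm v * norm (y - x)"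
      using D unfolding has_derivative_at_alt by blast
    define t where "t = min r (d / 2) / norm v"
    have t: "0 < t" using r d False by (simp add: t_def)
    have tv: "norm (t *\<^sub>R v) \<le> r" "norm (t *\<^sub>R v) < d" using r d False by (auto simp: t_def)
    have "f' (t *\<^sub>R v) = t * f' v"
      using linear_scale[OF bounded_linear.linear[OF has_derivative_bounded_linear[OF D]]] by simp
    then have "\<bar>f (x + t *\<^sub>R v) - f x - t * f' v\<bar> \<le> e / norm v * norm (t *\<^sub>R v)"
      using d(2)[of "x + t *\<^sub>R v"] tv by simp
    also have "\<dots> = t * e" using False t by simp
    finally have 1: "\<bar>f (x + t *\<^sub>R v) - f x - t * f' v\<bar> \<le> t * e" .
    have 2: "\<bar>f (x + t *\<^sub>R v) - f x\<bar> \<le> L * (t * norm v)" using lip[OF tv(1)] t by simp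
    have "t * \<bar>f' v\<bar> = \<bar>t * f' v\<bar>" using t by (simp add: abs_mult)
    also have "\<dots> \<le> L * (t * norm v) + t * e" using 1 2 by linarith
    also have "\<dots> = t * (L * norm v + e)" by (simp add: algebra_simps)
    finally show "\<bar>f' v\<bar> \<le> L * norm v + e" using t by simp
  qed
qed

text \<open>For each direction j the vector of all m partial derivatives is bounded by duality;
  summing over the n directions gives the factor \<open>CARD('n)\<close> and nothing that depends on
  m.\<close>

lemma grad_norm_le_lipschitz:
  fixes u :: "real^'n \<Rightarrow> nat \<Rightarrow> real" and L :: real
  assumes D: "\<And>k. k < m \<Longrightarrow> ((\<lambda>y. w y k) has_derivative (\<lambda>h. grad (\<lambda>y. u y k) x \<bullet> h)) (at x)" and r: "0 < r"
    and lip: "\<And>a h. (\<Sum>i<m. (a i)\<^sup>2) \<le> 1 \<Longrightarrow> norm h \<le> r \<Longrightarrow> \<bar>comb m a w (x + h) - comb m a w x\<bar> \<le> L * norm h"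
  shows "grad_norm m u x \<le> CARD('n) * L"
proof -
  define g where "g k = grad (\<lambda>y. u y k) x" for k
  have comp: "L2_set (\<lambda>k. g k $ j) {..<m} \<le> L" for j
  proof (rule L2_set_le_dual)
    fix a :: "nat \<Rightarrow> real" assume a: "(\<Sum>i<m. (a i)\<^sup>2) \<le> 1"
    have "((\<lambda>y. \<Sum>k<m. a k * w y k) has_derivative (\<lambda>h. \<Sum>k<m. a k * (g k \<bullet> h))) (at x)"
      using D by (intro has_derivative_sum has_derivative_mult_right) (auto simp: g_def)
    then have "(comb m a w has_derivative (\<lambda>h. \<Sum>k<m. a k * (g k \<bullet> h))) (at x)"
      by (simp add: comb_def[abs_def])
    from derivative_le_local_lipschitz[OF this r lip[OF a], of "axis j 1"]
    show "(\<Sum>k<m. a k * g k $ j) \<le> L" by (simp add: inner_axis)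
  qed
  have "grad_norm m u x \<le> L2_set (\<lambda>k. \<Sum>j\<in>UNIV. \<bar>g k $ j\<bar>) {..<m}"
    unfolding grad_norm_def g_def by (intro L2_set_mono norm_le_l1_cart) auto
  also have "\<dots> \<le> (\<Sum>j\<in>UNIV. L2_set (\<lambda>k. \<bar>g k $ j\<bar>) {..<m})" by (rule L2_set_sum_triangle) simp
  also have "\<dots> \<le> (\<Sum>j\<in>(UNIV::'n set). L)"
    by (rule sum_mono) (use comp in \<open>simp add: L2_set_def\<close>)
  finally show ?thesis by simp
qed

lemma cutoff_has_derivative:
  assumes so: "solution F m u" and k: "k < m" and x: "x \<in> ball 0 1"
  shows "((\<lambda>y. cutoff u y k) has_derivative (\<lambda>h. grad (\<lambda>y. u y k) x \<bullet> h)) (at x)"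
  by (rule has_derivative_transform_within_open[OF differentiable_imp_grad[OF solution_differentiable[OF so k x]] open_ball x])
     (simp add: cutoff_in)

lemma \<Gamma>\<^sub>0_D:
  fixes u :: "real^'n \<Rightarrow> nat \<Rightarrow> real"
  assumes so: "solution F m u" and y: "y \<in> \<Gamma>\<^sub>0 m u"
  shows "y \<in> ball 0 1" "vnorm m u y = 0" "grad_norm m u y = 0"
    "k < m \<Longrightarrow> cutoff u y k = 0" "k < m \<Longrightarrow> ((\<lambda>z. cutoff u z k) has_derivative (\<lambda>_. 0)) (at y)"
proof -
  define A where "A = {x \<in> ball 0 1. vnorm m u x > 0}"
  show y1: "y \<in> ball 0 1" and g0: "grad_norm m u y = 0" using y by (auto simp: \<Gamma>\<^sub>0_def)
  \<comment> \<open>The positivity set is open, so it contains none of its frontier points; this is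
    how u = 0 follows on the frontier.\<close>
  have "continuous_on (ball 0 1) (vnorm m u)"
    unfolding vnorm_def[abs_def] L2_set_def using solution_continuous[OF so]
    by (intro continuous_on_real_sqrt continuous_on_sum continuous_on_power) auto
  from continuous_open_preimage[OF this open_ball open_greaterThan[of 0]]
  have "open A" by (simp add: A_def vimage_def Int_def)
  moreover have "y \<in> frontier A" using y by (simp add: \<Gamma>\<^sub>0_def A_def)
  ultimately have "y \<notin> A" by (simp add: frontier_def interior_open)
  then show v0: "vnorm m u y = 0" using y1 vnorm_nonneg[of m u y] by (auto simp: A_def)
  have "u y k = 0" "grad (\<lambda>z. u z k) y = 0" if "k < m"
    using v0 g0 that by (auto simp: vnorm_def grad_norm_def L2_set_eq_0_iff)
  then show "k < m \<Longrightarrow> cutoff u y k = 0" "k < m \<Longrightarrow> ((\<lambda>z. cutoff u z k) has_derivative (\<lambda>_. 0)) (at y)"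
    using cutoff_has_derivative[OF so _ y1, of k] y1 by (auto simp: cutoff_def)
qed

text \<open>Pointwise bounds pass to the infimum after dividing by C, and in the quadratic case
  after a square root. For empty S the infimum is infinite and, C being positive, so are the
  right-hand sides.\<close>

lemma edist_set_bounds:
  assumes C: "0 < C" and a: "0 \<le> a" "\<And>y. y \<in> S \<Longrightarrow> a \<le> C * (dist x y)\<^sup>2" and b: "\<And>y. y \<in> S \<Longrightarrow> b \<le> C * dist x y"
  shows "ennreal a \<le> ennreal C * (edist_set x S)\<^sup>2" "ennreal b \<le> ennreal C * edist_set x S"
proof -
  have "ennreal (sqrt (a / C)) \<le> edist_set x S"
    unfolding edist_set_def
  proof (rule INF_greatest, rule ennreal_leI)
    fix y assume "y \<in> S"
    then have "a / C \<le> (dist x y)\<^sup>2" using a(2) C by (simp add: pos_divide_le_eq mult.commute)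
    then show "sqrt (a / C) \<le> dist x y" by (simp add: real_le_lsqrt)
  qed
  then have "(ennreal (sqrt (a / C)))\<^sup>2 \<le> (edist_set x S)\<^sup>2" by (rule power_mono) simp
  moreover have "(ennreal (sqrt (a / C)))\<^sup>2 = ennreal (a / C)"
    using a(1) C by (simp add: ennreal_power)
  ultimately have "ennreal C * ennreal (a / C) \<le> ennreal C * (edist_set x S)\<^sup>2"
    by (intro mult_left_mono) auto
  then show "ennreal a \<le> ennreal C * (edist_set x S)\<^sup>2"
    using a(1) C by (simp add: ennreal_mult[symmetric])
  have "ennreal (b / C) \<le> edist_set x S"
    unfolding edist_set_def
    by (rule INF_greatest, rule ennreal_leI) (use b C in \<open>simp add: pos_divide_le_eq mult.commute\<close>)
  then have "ennreal C * ennreal (b / C) \<le> ennreal C * edist_set x S" by (intro mult_left_mono) auto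
  moreover have "ennreal C * ennreal (b / C) = ennreal b"
    using C by (subst ennreal_mult'[symmetric]) auto
  ultimately show "ennreal b \<le> ennreal C * edist_set x S" by simp
qed

section \<open>The growth estimate\<close>

theorem proposition3p5:
  fixes c\<^sub>0 C\<^sub>0 E :: real
  assumes "CARD('n::finite) \<ge> 2" and "c\<^sub>0 > 0" and "C\<^sub>0 > 0"
  shows "\<exists>C::real. C > 0 \<and>
    (\<forall>m\<ge>1. \<forall>F. \<forall>u :: real^'n \<Rightarrow> nat \<Rightarrow> real.
       structural c\<^sub>0 C\<^sub>0 F \<and> solution F m u \<and> energy F m u 0 1 = E \<longrightarrow>
       (\<forall>x \<in> ball 0 (1/2).
          ennreal (vnorm m u x) \<le> ennreal C * (edist_set x (\<Gamma>\<^sub>0 m u))\<^sup>2 \<and>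
          ennreal (grad_norm m u x) \<le> ennreal C * edist_set x (\<Gamma>\<^sub>0 m u)))"
proof -
  obtain S where S: "S > 0" "\<And>m F (u :: real^'n \<Rightarrow> nat \<Rightarrow> real) x. structural c\<^sub>0 C\<^sub>0 F \<Longrightarrow> solution F m u \<Longrightarrow> energy F m u 0 1 = E \<Longrightarrow>
     norm x < 15/16 \<Longrightarrow> vnorm m (cutoff u) x \<le> S"
    using solution_sup_bound[OF assms(2,3)] by blast
  \<comment> \<open>The growth estimate with R0 = 1/8: it needs a ball of radius 1/4 around the free
    boundary point, on which the sup bound S holds.\<close>
  obtain C1 where C1: "C1 > 0" "\<And>m (u::real^'n \<Rightarrow> nat \<Rightarrow> real) g x h R. vpoisson m u g C\<^sub>0 \<Longrightarrow> coercive m c\<^sub>0 u g \<Longrightarrow>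
     cball x (2 * (1/8)) \<subseteq> ball 0 1 \<Longrightarrow> \<forall>y\<in>cball x (2 * (1/8)). L2_set (u y) {..<m} \<le> S \<Longrightarrow> \<forall>k<m. u x k = 0 \<Longrightarrow>
     \<forall>k<m. ((\<lambda>y. u y k) has_derivative (\<lambda>_. 0)) (at x) \<Longrightarrow> 0 < R \<Longrightarrow> R \<le> 1/8 \<Longrightarrow> norm h \<le> R \<Longrightarrow>
     L2_set (u (x + h)) {..<m} \<le> C1 * R\<^sup>2"
    using quadratic_growth[OF assms(2), of C\<^sub>0 S "1/8"] assms(3) S(1) by (metis divide_pos_pos less_imp_le zero_less_numeral zero_less_one)
  obtain C2 where C2: "C2 > 0" "\<And>(u::real^'n \<Rightarrow> real) g G S x h R. poisson u g G \<Longrightarrow> 0 < R \<Longrightarrow> cball x (2 * R) \<subseteq> ball 0 1 \<Longrightarrow>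
     \<forall>y\<in>cball x (2 * R). \<bar>u y\<bar> \<le> S \<Longrightarrow> norm h \<le> R \<Longrightarrow> \<bar>u (x + h) - u x\<bar> \<le> C2 * norm h * (S / R + G * R)"
    using poisson_lipschitz_bound by blast
  define n where "n = real CARD('n)"
  have n: "0 \<le> n" by (simp add: n_def)
  \<comment> \<open>L1 is the gradient bound from the Lipschitz estimate with radius 1/8 and sup
    bound S. L2 d is the one with radius d/2 and sup bound C1 (2d)^2.\<close>
  define L1 where "L1 = n * (C2 * (8 * S + C\<^sub>0 / 8))"
  define L2 where "L2 = n * (C2 * (8 * C1 + C\<^sub>0 / 2))"
  \<comment> \<open>256 = 16^2 and 16 convert fixed bounds into multiples of d^2 and d when d \<ge>
    1/16; C1 and L2 serve smaller distances.\<close>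
  define C where "C = 256 * S + C1 + 16 * L1 + L2"
  have L: "0 \<le> L1" "0 \<le> L2" using n C1 C2 S assms(3) by (simp_all add: L1_def L2_def)
  have Cpos: "C > 0" using L S C1 by (simp add: C_def)
  have main: "vnorm m u x \<le> C * (dist x y)\<^sup>2 \<and> grad_norm m u x \<le> C * dist x y"
    if st: "structural c\<^sub>0 C\<^sub>0 F" and so: "solution F m u" and en: "energy F m u 0 1 = E"
      and x: "x \<in> ball 0 (1/2)" and y: "y \<in> \<Gamma>\<^sub>0 m u"
    for m F and u :: "real^'n \<Rightarrow> nat \<Rightarrow> real" and x y
  proof -
    define w where "w = cutoff u"
    define d where "d = dist x y"
    have d0: "0 \<le> d" by (simp add: d_def)
    have nx: "norm x < 1/2" using x by simp
    have vp: "vpoisson m w (cutoff (rhs F m u)) C\<^sub>0" unfolding w_def by (rule solution_vpoisson[OF st assms(2) so])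
    have wS: "L2_set (w z) {..<m} \<le> S" if "norm z < 15/16" for z
      using S(2)[OF st so en that] by (simp add: vnorm_def w_def)
    have x1: "x \<in> ball 0 1" using x by simp
    have ux: "vnorm m u x = L2_set (w x) {..<m}" unfolding w_def vnorm_def cutoff_in[OF x1] ..
    have gradle: "grad_norm m u x \<le> n * (C2 * (B / r + C\<^sub>0 * r))"
      if r: "0 < r" "cball x (2 * r) \<subseteq> ball 0 1" and B: "\<And>z. z \<in> cball x (2 * r) \<Longrightarrow> L2_set (w z) {..<m} \<le> B" for r B
      unfolding n_def
    proof (rule grad_norm_le_lipschitz[where w = w, OF _ r(1)])
      show "((\<lambda>y. w y k) has_derivative (\<bullet>) (grad (\<lambda>y. u y k) x)) (at x)" if "k < m" for k
        unfolding w_def by (rule cutoff_has_derivative[OF so that x1])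
      fix a :: "nat \<Rightarrow> real" and h :: "real^'n" assume a: "(\<Sum>i<m. (a i)\<^sup>2) \<le> 1" and h: "norm h \<le> r"
      have "\<forall>z\<in>cball x (2 * r). \<bar>comb m a w z\<bar> \<le> B"
        using B comb_le_L2[OF a, of w] by (meson order_trans)
      then have "\<bar>comb m a w (x + h) - comb m a w x\<bar> \<le> C2 * norm h * (B / r + C\<^sub>0 * r)"
        using vp a by (intro C2(2)[OF _ r _ h]) (auto simp: vpoisson_def)
      then show "\<bar>comb m a w (x + h) - comb m a w x\<bar> \<le> C2 * (B / r + C\<^sub>0 * r) * norm h" by (simp add: mult_ac)
    qed
    \<comment> \<open>Far from y the interior bounds suffice. For d < 1/16 the point y has norm
      below 9/16, so the ball of radius 1/4 around it has norms below 13/16, and 2d < 1/8 is still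
      an admissible radius for the growth estimate.\<close>
    consider "d = 0" | "1/16 \<le> d" | "0 < d" "d < 1/16" using d0 by linarith
    then show ?thesis
    proof cases
      case 1
      then have "x = y" by (simp add: d_def)
      then show ?thesis using \<Gamma>\<^sub>0_D(2,3)[OF so y] by simp
    next
      case 2
      have "L2_set (w x) {..<m} \<le> 256 * S * d\<^sup>2"
      proof -
        have "(1/16)\<^sup>2 \<le> d\<^sup>2" using 2 by (intro power_mono) auto
        then have "S * 1 \<le> S * (256 * d\<^sup>2)" using S(1) by (intro mult_left_mono) (auto simp: power2_eq_square)
        then show ?thesis using wS[of x] nx by simp
      qed
      also have "\<dots> \<le> C * d\<^sup>2" using L C1(1) by (intro mult_right_mono) (auto simp: C_def)
      finally have u: "vnorm m u x \<le> C * d\<^sup>2" by (simp add: ux)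
      have "grad_norm m u x \<le> n * (C2 * (S / (1/8) + C\<^sub>0 * (1/8)))"
      proof (rule gradle)
        show "cball x (2 * (1/8)) \<subseteq> ball 0 1" using nx by (simp add: cball_subset_ball_iff)
        show "L2_set (w z) {..<m} \<le> S" if z: "z \<in> cball x (2 * (1/8))" for z
          using z nx norm_triangle_sub[of z x] by (intro wS) (simp add: dist_norm norm_minus_commute)
      qed simp
      then have "grad_norm m u x \<le> L1" by (simp add: L1_def mult.commute[of S])
      also have "\<dots> \<le> L1 * (16 * d)" using 2 L mult_left_mono[of 1 "16 * d" L1] by simp
      also have "\<dots> \<le> C * d" using L C1(1) S(1) d0 mult_right_mono[of "16 * L1" C d] by (simp add: C_def mult_ac)
      finally show ?thesis using u by (simp add: d_def)
    next
      case 3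
      have dyx: "norm (x - y) = d" by (simp add: d_def dist_norm)
      have ny: "norm y < 9/16" using 3 nx dyx norm_triangle_sub[of y x] by (simp add: norm_minus_commute)
      have growth: "L2_set (w z) {..<m} \<le> C1 * R\<^sup>2" if "norm (z - y) \<le> R" "0 < R" "R \<le> 1/8" for z R
      proof -
        have "L2_set (w (y + (z - y))) {..<m} \<le> C1 * R\<^sup>2"
        proof (rule C1(2)[OF vp])
          show "coercive m c\<^sub>0 w (cutoff (rhs F m u))" unfolding w_def by (rule solution_coercive[OF st])
          show "cball y (2 * (1/8)) \<subseteq> ball 0 1" using ny by (simp add: cball_subset_ball_iff)
          show "\<forall>z\<in>cball y (2 * (1/8)). L2_set (w z) {..<m} \<le> S"
          proof
            fix z assume "z \<in> cball y (2 * (1/8))"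
            then show "L2_set (w z) {..<m} \<le> S"
              using ny norm_triangle_sub[of z y] by (intro wS) (simp add: dist_norm norm_minus_commute)
          qed
        qed (use that \<Gamma>\<^sub>0_D(4,5)[OF so y] in \<open>auto simp: w_def\<close>)
        then show ?thesis by simp
      qed
      have "L2_set (w x) {..<m} \<le> C1 * d\<^sup>2" by (rule growth) (use 3 dyx in auto)
      also have "\<dots> \<le> C * d\<^sup>2" using L S(1) by (intro mult_right_mono) (auto simp: C_def)
      finally have u: "vnorm m u x \<le> C * d\<^sup>2" by (simp add: ux)
      \<comment> \<open>The ball of radius d around x lies in the ball of radius 2d around y, where
        growth bounds |u| by C1 (2d)^2; the Lipschitz estimate at radius d/2 then gains one power of
        d.\<close>
      have "grad_norm m u x \<le> n * (C2 * (C1 * (2 * d)\<^sup>2 / (d / 2) + C\<^sub>0 * (d / 2)))"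
      proof (rule gradle)
        show "cball x (2 * (d / 2)) \<subseteq> ball 0 1" using nx 3 by (simp add: cball_subset_ball_iff)
        show "L2_set (w z) {..<m} \<le> C1 * (2 * d)\<^sup>2" if z: "z \<in> cball x (2 * (d / 2))" for z
        proof (rule growth)
          show "norm (z - y) \<le> 2 * d"
            using z dyx norm_triangle_ineq[of "z - x" "x - y"] by (simp add: dist_norm norm_minus_commute)
        qed (use 3 in auto)
      qed (use 3 in simp)
      also have "\<dots> = L2 * d" using 3 by (simp add: L2_def field_simps power2_eq_square)
      also have "\<dots> \<le> C * d" using L C1(1) S(1) d0 by (intro mult_right_mono) (auto simp: C_def)
      finally show ?thesis using u by (simp add: d_def)
    qed
  qed
  show ?thesis
  proof (intro exI[of _ C] conjI Cpos allI impI ballI)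
    fix m F and u :: "real^'n \<Rightarrow> nat \<Rightarrow> real" and x :: "real^'n"
    assume h: "structural c\<^sub>0 C\<^sub>0 F \<and> solution F m u \<and> energy F m u 0 1 = E" and x: "x \<in> ball 0 (1/2)"
    note M = main[of F m u x, OF conjunct1[OF h] conjunct1[OF conjunct2[OF h]] conjunct2[OF conjunct2[OF h]] x]
    show "ennreal (vnorm m u x) \<le> ennreal C * (edist_set x (\<Gamma>\<^sub>0 m u))\<^sup>2"
      by (rule edist_set_bounds(1)[OF Cpos vnorm_nonneg]) (use M in auto)
    show "ennreal (grad_norm m u x) \<le> ennreal C * edist_set x (\<Gamma>\<^sub>0 m u)"
      by (rule edist_set_bounds(2)[OF Cpos vnorm_nonneg[of m u x]]) (use M in auto)
  qed
qed

end
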